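(* Consider the two-dimensional Poisson setting and the procedure $\mathbf{REDUCE}$ described in the context, with marking parameter $\theta\in(0,1]$, and set $\bar\gamma=(1-\theta)+\theta/2$. Fix $\epsilon>0$, and let $R$ and $r_{\mathcal D,\epsilon}\eqsim\|p_{\mathcal D}\|_\infty^{-2-2\epsilon}$ be the reliability and efficiency constants of the context. Let $\mathcal D\in\mathbb D^c$, $f_{\mathcal D}\in F_{\mathcal D}$, and let $\mathcal D=\mathcal D_0\le\mathcal D_1\le\cdots$ be the sequence of $hp$-partitions produced by $\mathbf{REDUCE}(\varrho,\mathcal D,f_{\mathcal D})$. Then in each iteration the quantity $$|u(f_{\mathcal D})-u_{\mathcal D_i}(f_{\mathcal D})|^2_{H^1(\Omega)}+(1-\sqrt{\bar\gamma})\,r_{\mathcal D,\epsilon}\,\mathcal E^2_{\mathcal D_i}(u_{\mathcal D_i}(f_{\mathcal D}),f_{\mathcal D})$$ is reduced by at least a factor $1-\frac{(1-\sqrt{\bar\gamma})^2}{2}\frac{r_{\mathcal D,\epsilon}}{R}$, and this quantity is equivalent to $|u(f_{\mathcal D})-u_{\mathcal D_i}(f_{\mathcal D})|^2_{H^1(\Omega)}$. Consequently, in order to reduce the initial error $|u(f_{\mathcal D})-u_{\mathcal D}(f_{\mathcal D})|_{H^1(\Omega)}$ by a factor $\varrho\in(0,1]$ by an application of $\mathbf{REDUCE}$, the number of iterations that are required is $$M\eqsim\log(1/\varrho)\,\|p_{\mathcal D}\|_\infty^{2+2\epsilon}.$$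
   Context: $\Omega\subset\mathbb R^2$ is a polygonal domain; for $f\in L^2(\Omega)$, $u(f)\in H^1_0(\Omega)$ is the weak solution of $-\Delta u=f$ in $\Omega$, $u=0$ on $\partial\Omega$. $\mathcal K_0$ is an initial conforming triangulation of $\bar\Omega$ in which each triangle has a vertex designated as its newest vertex, such that if an internal edge is opposite to the newest vertex of the triangle on one side, it is also opposite to the newest vertex of the triangle on the other side. $\mathbb K$ is the collection of all triangulations obtained from $\mathcal K_0$ by newest vertex bisection (repeatedly bisecting a triangle by connecting its newest vertex to the midpoint of the opposite edge; the newest vertex of the two children is that midpoint), $\mathfrak K$ is the set (binary tree) of all triangles that can arise, and $\mathbb K^c\subset\mathbb K$ the subset of conforming triangulations. For $d\in\mathbb N=\{1,2,\dots\}$, $p(d)$ is the largest $p\in\mathbb N$ with $\dim\mathbb P_{p-1}(K)=\binom{p+1}{2}\le d$. An $hp$-element is $D=(K_D,d_D)\in\mathfrak K\times\mathbb N$, with $p_D:=p(d_D)$. An $hp$-partition $\mathcal D\in\mathbb D$ is a collection of $hp$-elements with $\mathcal K(\mathcal D):=\{K_D:D\in\mathcal D\}\in\mathbb K$. $\mathbb D^c$ is the set of $\mathcal D\in\mathbb D$ with $\mathcal K(\mathcal D)\in\mathbb K^c$ and such that $p_D$ and $p_{D'}$ differ by at most a fixed constant factor whenever $D,D'\in\mathcal D$, $K_D\cap K_{D'}\ne\emptyset$. $\|p_{\mathcal D}\|_\infty:=\max_{D\in\mathcal D}p_D$. $F_{\mathcal D}:=\prod_{D\in\mathcal D}\mathbb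 P_{p_D-1}(K_D)$, $V^c_{\mathcal D}:=H^1_0(\Omega)\cap\prod_{D\in\mathcal D}\mathbb P_{p_D}(K_D)$. $u_{\mathcal D}(f)\in V^c_{\mathcal D}$ is the Galerkin approximation to $u(f)$, i.e. its best approximation from $V^c_{\mathcal D}$ in $|\cdot|_{H^1(\Omega)}$. $\mathcal D\le\tilde{\mathcal D}$ means that $\mathcal K(\tilde{\mathcal D})$ is a refinement of $\mathcal K(\mathcal D)$ and $d_{\tilde D}\ge d_D$ whenever $K_{\tilde D}\subseteq K_D$. **Estimator.** $\mathcal E(\mathcal D)$ denotes the set of edges of $\mathcal K(\mathcal D)$; $p_{e,\mathcal D}:=\min\{p_D:D\in\mathcal D,\ e\subset\partial K_D\}$; $\llbracket\cdot\rrbracket$ is the jump over $e$, $\mathbf n_e$ a unit normal. For $D\in\mathcal D\in\mathbb D^c$, $$\eta^2_{D,\mathcal D}(w,f)=\frac{|K_D|}{p_D^2}\|f+\Delta w\|^2_{L^2(K_D)}+\sum_{\{e\in\mathcal E(\mathcal D):e\subset\partial K_D\cap\Omega\}}\frac{|e|}{2p_{e,\mathcal D}}\|\llbracket\nabla w\cdot\mathbf n_e\rrbracket\|^2_{L^2(e)}$$ (sum over the edges of $K_D$ interior to $\Omega$); for $\mathcal M\subset\mathcal D$, $\mathcal E_{\mathcal D}(\mathcal M,w,f)=\big(\sum_{D\in\mathcal M}\eta^2_{D,\mathcal D}(w,f)\big)^{1/2}$, and $\mathcal E_{\mathcal D}(w,f)=\mathcal E_{\mathcal D}(\mathcal D,w,f)$.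 **Reliability and efficiency constants.** $R>0$ is a constant such that $|u(f_{\mathcal D})-u_{\mathcal D}(f_{\mathcal D})|^2_{H^1(\Omega)}\le R\,\mathcal E^2_{\mathcal D}(u_{\mathcal D}(f_{\mathcal D}),f_{\mathcal D})$ for all $\mathcal D\in\mathbb D^c$, $f_{\mathcal D}\in F_{\mathcal D}$. For $\epsilon>0$ and $\mathcal D\in\mathbb D^c$, $r_{\mathcal D,\epsilon}\eqsim\|p_{\mathcal D}\|_\infty^{-2-2\epsilon}$ is such that $r_{\mathcal D,\epsilon}\,\mathcal E^2_{\mathcal D}(w,f_{\mathcal D})\le|u(f_{\mathcal D})-w|^2_{H^1(\Omega)}$ for all $f_{\mathcal D}\in F_{\mathcal D}$, $w\in V^c_{\mathcal D}$. (Such constants exist, by results of Melenk and Wohlmuth. The maximal degree does not change during $\mathbf{REDUCE}$, so the same value $r_{\mathcal D,\epsilon}$ is used for all $\mathcal D_i$.) **Refinement.** For $\mathcal M\subset\mathcal D\in\mathbb D^c$, $\bar{\mathcal D}(\mathcal M)\in\mathbb D^c$ is such that $\mathcal K(\bar{\mathcal D}(\mathcal M))$ is the smallest partition in $\mathbb K^c$ in which each $K_D$, $D\in\mathcal M$, has been replaced by its four grandchildren in $\mathfrak K$, and each element of $\bar{\mathcal D}(\mathcal M)$ inherits its polynomial degree from the element of $\mathcal D$ whose triangle contains it. **$\mathbf{REDUCE}(\varrho,\mathcal D,f_{\mathcal D})$.** Set $\mathcal D_0=\mathcal D$. For $i=1,\dots,M$: with $u_{i-1}=u_{\mathcal D_{i-1}}(f_{\mathcal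 D})$, select $\mathcal M_{i-1}\subseteq\mathcal D_{i-1}$ with $\mathcal E^2_{\mathcal D_{i-1}}(\mathcal M_{i-1},u_{i-1},f_{\mathcal D})\ge\theta\,\mathcal E^2_{\mathcal D_{i-1}}(u_{i-1},f_{\mathcal D})$, and set $\mathcal D_i=\bar{\mathcal D}(\mathcal M_{i-1})$. The output partition is $\mathcal D_M$. $A\eqsim B$ means that each of $A$, $B$ is bounded by a constant multiple of the other, independently of $\mathcal D$, $f_{\mathcal D}$ and $\varrho$.
   Formalization: As M is an integer, M ≂ log(1/ϱ)‖p‖^{2+2ε} cannot hold uniformly as ϱ tends to 1; it is stated with constants uniform for ϱ in (0,ϱ0] for each ϱ0<1, and for ϱ=1. M is a number of iterations that suffices for every f_D and every marking. *)

theory Defs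
  imports "HOL-Analysis.Analysis"
begin

section \<open>Function spaces on a planar domain\<close>

type_synonym point = "real^2"
type_synonym func = "point \<Rightarrow> real"

definition pd :: "2 \<Rightarrow> func \<Rightarrow> func" where
  "pd i w x = frechet_derivative w (at x) (axis i 1)"

definition grad :: "func \<Rightarrow> point \<Rightarrow> point" where
  "grad w x = (\<chi> i. pd i w x)"

definition laplacian :: "func \<Rightarrow> func" where
  "laplacian w x = (\<Sum>i\<in>UNIV. pd i (pd i w) x)"

fun C_k :: "nat \<Rightarrow> func \<Rightarrow> bool" where
  "C_k 0 w \<longleftrightarrow> continuous_on UNIV w"
| "C_k (Suc k) w \<longleftrightarrow> (\<forall>x. w differentiable (at x)) \<and> (\<forall>i. C_k k (pd i w))"

definition test_functions :: "point set \<Rightarrow> func set" where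
  "test_functions \<Omega> = {w. (\<forall>k. C_k k w) \<and> compact (closure {x. w x \<noteq> 0})
                         \<and> closure {x. w x \<noteq> 0} \<subseteq> \<Omega>}"

text \<open>Elements of the Lebesgue and Sobolev spaces are represented by functions on the whole
  plane, of which only the values almost everywhere on the domain matter.\<close>

definition L2 :: "point set \<Rightarrow> func set" where
  "L2 \<Omega> = {w. w \<in> borel_measurable (lebesgue_on \<Omega>) \<and> integrable (lebesgue_on \<Omega>) (\<lambda>x. (w x)\<^sup>2)}"

definition weak_gradient :: "point set \<Rightarrow> func \<Rightarrow> (point \<Rightarrow> point) \<Rightarrow> bool" where
  "weak_gradient \<Omega> w g \<longleftrightarrow> (\<forall>i. (\<lambda>x. g x $ i) \<in> L2 \<Omega>) \<and>
     (\<forall>\<phi>\<in>test_functions \<Omega>. \<forall>i. (LINT x|lebesgue_on \<Omega>. w x * pd i \<phi> x)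
                                = - (LINT x|lebesgue_on \<Omega>. g x $ i * \<phi> x))"

definition H1 :: "point set \<Rightarrow> func set" where
  "H1 \<Omega> = {w \<in> L2 \<Omega>. \<exists>g. weak_gradient \<Omega> w g}"

text \<open>The choice is unique up to null sets.\<close>
definition wgrad :: "point set \<Rightarrow> func \<Rightarrow> point \<Rightarrow> point" where
  "wgrad \<Omega> w = (SOME g. weak_gradient \<Omega> w g)"

definition H1_seminorm :: "point set \<Rightarrow> func \<Rightarrow> real" where
  "H1_seminorm \<Omega> w = sqrt (LINT x|lebesgue_on \<Omega>. (norm (wgrad \<Omega> w x))\<^sup>2)"

definition H1_norm :: "point set \<Rightarrow> func \<Rightarrow> real" where
  "H1_norm \<Omega> w = sqrt ((LINT x|lebesgue_on \<Omega>. (w x)\<^sup>2) + (H1_seminorm \<Omega> w)\<^sup>2)"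

definition H10 :: "point set \<Rightarrow> func set" where
  "H10 \<Omega> = {w \<in> H1 \<Omega>. \<exists>\<phi>::nat \<Rightarrow> func. (\<forall>n. \<phi> n \<in> test_functions \<Omega>)
                 \<and> (\<lambda>n. H1_norm \<Omega> (\<lambda>x. w x - \<phi> n x)) \<longlonglongrightarrow> 0}"

definition weak_solution :: "point set \<Rightarrow> func \<Rightarrow> func \<Rightarrow> bool" where
  "weak_solution \<Omega> f u \<longleftrightarrow> u \<in> H10 \<Omega> \<and>
     (\<forall>v\<in>H10 \<Omega>. (LINT x|lebesgue_on \<Omega>. wgrad \<Omega> u x \<bullet> wgrad \<Omega> v x)
                 = (LINT x|lebesgue_on \<Omega>. f x * v x))"

definition best_approximation :: "point set \<Rightarrow> func set \<Rightarrow> func \<Rightarrow> func \<Rightarrow> bool" where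
  "best_approximation \<Omega> V u U \<longleftrightarrow> U \<in> V \<and>
     (\<forall>w\<in>V. H1_seminorm \<Omega> (\<lambda>x. u x - U x) \<le> H1_seminorm \<Omega> (\<lambda>x. u x - w x))"

section \<open>Polygonal domains and triangulations\<close>

text \<open>The regularity condition \<open>interior (closure \<Omega>) = \<Omega>\<close> says that the domain lies locally on
  one side of its boundary edges, so that it is determined by a triangulation of its closure;
  it excludes slits and removed points.\<close>
definition polygonal_domain :: "point set \<Rightarrow> bool" where
  "polygonal_domain \<Omega> \<longleftrightarrow> open \<Omega> \<and> connected \<Omega> \<and> bounded \<Omega> \<and> \<Omega> \<noteq> {} \<and>
     interior (closure \<Omega>) = \<Omega> \<and>
     (\<exists>S. finite S \<and> frontier \<Omega> = (\<Union>(a, b)\<in>S. closed_segment a b))"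

text \<open>A triangle is stored as \<open>(v, a, b)\<close>, where \<open>v\<close> is its newest vertex.\<close>
type_synonym tri = "point \<times> point \<times> point"

fun verts :: "tri \<Rightarrow> point set" where
  "verts (v, a, b) = {v, a, b}"

definition hl :: "tri \<Rightarrow> point set" where
  "hl K = convex hull (verts K)"

text \<open>Edges are represented by their sets of endpoints.\<close>
fun refinement_edge :: "tri \<Rightarrow> point set" where
  "refinement_edge (v, a, b) = {a, b}"

fun tri_edges :: "tri \<Rightarrow> point set set" where
  "tri_edges (v, a, b) = {{v, a}, {v, b}, {a, b}}"

fun children :: "tri \<Rightarrow> tri set" where
  "children (v, a, b) = {(midpoint a b, v, a), (midpoint a b, v, b)}"

definition grandchildren :: "tri \<Rightarrow> tri set" where
  "grandchildren K = (\<Union>K'\<in>children K. children K')"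

definition triangulation :: "point set \<Rightarrow> tri set \<Rightarrow> bool" where
  "triangulation \<Omega> T \<longleftrightarrow> finite T \<and> (\<forall>K\<in>T. \<not> collinear (verts K)) \<and>
     (\<Union>K\<in>T. hl K) = closure \<Omega> \<and>
     (\<forall>K\<in>T. \<forall>K'\<in>T. K \<noteq> K' \<longrightarrow> interior (hl K) \<inter> interior (hl K') = {})"

definition conforming :: "tri set \<Rightarrow> bool" where
  "conforming T \<longleftrightarrow> (\<forall>K\<in>T. \<forall>K'\<in>T. K \<noteq> K' \<longrightarrow> hl K \<inter> hl K' = convex hull (verts K \<inter> verts K'))"

definition initial_triangulation :: "point set \<Rightarrow> tri set \<Rightarrow> bool" where
  "initial_triangulation \<Omega> K0 \<longleftrightarrow> triangulation \<Omega> K0 \<and> conforming K0 \<and>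
     (\<forall>K\<in>K0. \<forall>K'\<in>K0. K \<noteq> K' \<longrightarrow> (\<forall>e \<in> tri_edges K \<inter> tri_edges K'.
         e = refinement_edge K \<longleftrightarrow> e = refinement_edge K'))"

inductive_set tree :: "tri set \<Rightarrow> tri set" for K0 :: "tri set" where
  root: "K \<in> K0 \<Longrightarrow> K \<in> tree K0"
| child: "K \<in> tree K0 \<Longrightarrow> K' \<in> children K \<Longrightarrow> K' \<in> tree K0"

inductive_set partitions :: "tri set \<Rightarrow> tri set set" for K0 :: "tri set" where
  init: "K0 \<in> partitions K0"
| bisect: "T \<in> partitions K0 \<Longrightarrow> K \<in> T \<Longrightarrow> (T - {K}) \<union> children K \<in> partitions K0"

definition conf_partitions :: "tri set \<Rightarrow> tri set set" where
  "conf_partitions K0 = {T \<in> partitions K0. conforming T}"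

definition refines :: "tri set \<Rightarrow> tri set \<Rightarrow> bool" where
  "refines T' T \<longleftrightarrow> (\<forall>K'\<in>T'. \<exists>K\<in>T. hl K' \<subseteq> hl K)"

section \<open>hp-partitions\<close>

type_synonym hp = "(tri \<times> nat) set"

definition p_of :: "nat \<Rightarrow> nat" where
  "p_of d = (GREATEST p. 1 \<le> p \<and> (p + 1) choose 2 \<le> d)"

definition hp_partitions :: "tri set \<Rightarrow> hp set" where
  "hp_partitions K0 = {D. D \<subseteq> tree K0 \<times> {1..} \<and> inj_on fst D \<and> fst ` D \<in> partitions K0}"

text \<open>\<open>\<kappa>\<close> is the fixed factor by which neighbouring degrees may differ.\<close>
definition conf_hp_partitions :: "tri set \<Rightarrow> real \<Rightarrow> hp set" where
  "conf_hp_partitions K0 \<kappa> = {D \<in> hp_partitions K0. fst ` D \<in> conf_partitions K0 \<and>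
     (\<forall>(K, d)\<in>D. \<forall>(K', d')\<in>D. hl K \<inter> hl K' \<noteq> {} \<longrightarrow> real (p_of d) \<le> \<kappa> * real (p_of d'))}"

definition pmax :: "hp \<Rightarrow> nat" where
  "pmax D = Max ((\<lambda>(K, d). p_of d) ` D)"

definition hp_le :: "hp \<Rightarrow> hp \<Rightarrow> bool" where
  "hp_le D D' \<longleftrightarrow> refines (fst ` D') (fst ` D) \<and>
     (\<forall>(K, d)\<in>D. \<forall>(K', d')\<in>D'. hl K' \<subseteq> hl K \<longrightarrow> d \<le> d')"

text \<open>Polynomials of total degree at most \<open>n\<close>.\<close>
definition polys :: "nat \<Rightarrow> func set" where
  "polys n = {q. \<exists>c. \<forall>x. q x = (\<Sum>i\<le>n. \<Sum>j\<le>n - i. c i j * (x $ 1) ^ i * (x $ 2) ^ j)}"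

definition F_space :: "hp \<Rightarrow> func set" where
  "F_space D = {f. \<forall>(K, d)\<in>D. \<exists>q \<in> polys (p_of d - 1). AE x in lebesgue_on (hl K). f x = q x}"

definition Vc_space :: "point set \<Rightarrow> hp \<Rightarrow> func set" where
  "Vc_space \<Omega> D = {w \<in> H10 \<Omega>.
     \<forall>(K, d)\<in>D. \<exists>q \<in> polys (p_of d). AE x in lebesgue_on (hl K). w x = q x}"

section \<open>The error estimator\<close>

text \<open>The polynomial with which a piecewise polynomial function agrees on a triangle; it
  provides the derivatives inside the triangle and their traces on its boundary.\<close>
definition piece :: "func \<Rightarrow> tri \<Rightarrow> func" where
  "piece w K = (SOME q. (\<exists>n. q \<in> polys n) \<and> (AE x in lebesgue_on (hl K). w x = q x))"

definition unit_normal :: "point set \<Rightarrow> point" where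
  "unit_normal e = (SOME n. norm n = 1 \<and> (\<forall>x\<in>e. \<forall>y\<in>e. (x - y) \<bullet> n = 0))"

text \<open>Jump of the normal derivative over an edge shared by two triangles of \<open>T\<close>. Its sign depends
  on the chosen order of the triangles and on the chosen normal, its square does not.\<close>
definition normal_jump :: "tri set \<Rightarrow> point set \<Rightarrow> func \<Rightarrow> func" where
  "normal_jump T e w x =
     (let (K1, K2) = (SOME (K1, K2). K1 \<in> T \<and> K2 \<in> T \<and> K1 \<noteq> K2 \<and>
                         convex hull e \<subseteq> frontier (hl K1) \<and> convex hull e \<subseteq> frontier (hl K2))
      in (grad (piece w K1) x - grad (piece w K2) x) \<bullet> unit_normal e)"

text \<open>Integral with respect to arc length over the segment with endpoint set \<open>e\<close>.\<close>
definition edge_integral :: "point set \<Rightarrow> func \<Rightarrow> real" where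
  "edge_integral e g = (let (a, b) = (SOME (a, b). e = {a, b})
                        in dist a b * integral {0..1} (\<lambda>t. g (a + t *\<^sub>R (b - a))))"

definition edges :: "hp \<Rightarrow> point set set" where
  "edges D = (\<Union>K\<in>fst ` D. tri_edges K)"

definition p_edge :: "hp \<Rightarrow> point set \<Rightarrow> nat" where
  "p_edge D e = Min {p_of d | K d. (K, d) \<in> D \<and> convex hull e \<subseteq> frontier (hl K)}"

text \<open>The endpoints of an interior edge may lie on the boundary of the domain, hence the
  relative interior below.\<close>
definition inner_edges :: "point set \<Rightarrow> hp \<Rightarrow> tri \<Rightarrow> point set set" where
  "inner_edges \<Omega> D K = {e \<in> edges D. convex hull e \<subseteq> frontier (hl K)
                              \<and> rel_interior (convex hull e) \<subseteq> \<Omega>}"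

definition indicator_sq :: "point set \<Rightarrow> hp \<Rightarrow> func \<Rightarrow> func \<Rightarrow> tri \<times> nat \<Rightarrow> real" where
  "indicator_sq \<Omega> D w f = (\<lambda>(K, d).
     measure lebesgue (hl K) / (real (p_of d))\<^sup>2
       * (LINT x|lebesgue_on (hl K). (f x + laplacian (piece w K) x)\<^sup>2)
     + (\<Sum>e\<in>inner_edges \<Omega> D K. diameter e / (2 * real (p_edge D e))
                               * edge_integral e (\<lambda>x. (normal_jump (fst ` D) e w x)\<^sup>2)))"

definition estimator :: "point set \<Rightarrow> hp \<Rightarrow> hp \<Rightarrow> func \<Rightarrow> func \<Rightarrow> real" where
  "estimator \<Omega> D M w f = sqrt (\<Sum>E\<in>M. indicator_sq \<Omega> D w f E)"

section \<open>Refinement and the procedure REDUCE\<close>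

definition admissible_refinements :: "tri set \<Rightarrow> hp \<Rightarrow> hp \<Rightarrow> tri set set" where
  "admissible_refinements K0 D M = {T \<in> conf_partitions K0. refines T (fst ` D)
                                       \<and> (\<forall>(K, d)\<in>M. grandchildren K \<subseteq> T)}"

definition is_refinement :: "tri set \<Rightarrow> real \<Rightarrow> hp \<Rightarrow> hp \<Rightarrow> hp \<Rightarrow> bool" where
  "is_refinement K0 \<kappa> D M D' \<longleftrightarrow> D' \<in> conf_hp_partitions K0 \<kappa> \<and>
     fst ` D' \<in> admissible_refinements K0 D M \<and>
     (\<forall>T\<in>admissible_refinements K0 D M. refines T (fst ` D')) \<and>
     (\<forall>(K', d')\<in>D'. \<forall>(K, d)\<in>D. hl K' \<subseteq> hl K \<longrightarrow> d' = d)"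

text \<open>\<open>Ds 0, \<dots>, Ds N\<close> is a sequence produced by \<open>N\<close> iterations of REDUCE started in \<open>D\<close> with
  right-hand side \<open>f\<close>; \<open>uD\<close> maps a partition and a right-hand side to the Galerkin
  approximation.\<close>
definition reduce_run ::
  "point set \<Rightarrow> tri set \<Rightarrow> real \<Rightarrow> real \<Rightarrow> (hp \<Rightarrow> func \<Rightarrow> func) \<Rightarrow> hp \<Rightarrow> func \<Rightarrow> nat \<Rightarrow> (nat \<Rightarrow> hp) \<Rightarrow> bool"
  where
  "reduce_run \<Omega> K0 \<kappa> \<theta> uD D f N Ds \<longleftrightarrow> Ds 0 = D \<and>
     (\<forall>i<N. \<exists>M \<subseteq> Ds i.
        (estimator \<Omega> (Ds i) M (uD (Ds i) f) f)\<^sup>2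
           \<ge> \<theta> * (estimator \<Omega> (Ds i) (Ds i) (uD (Ds i) f) f)\<^sup>2 \<and>
        is_refinement K0 \<kappa> (Ds i) M (Ds (Suc i)))"

definition err :: "point set \<Rightarrow> (func \<Rightarrow> func) \<Rightarrow> (hp \<Rightarrow> func \<Rightarrow> func) \<Rightarrow> hp \<Rightarrow> func \<Rightarrow> real" where
  "err \<Omega> u uD D f = H1_seminorm \<Omega> (\<lambda>x. u f x - uD D f x)"

text \<open>The efficiency constant \<open>r\<close> is that of the partition \<open>D\<close> from which REDUCE was started, while
  error and estimator are those of the current partition \<open>D'\<close>.\<close>
definition reduce_quantity ::
  "point set \<Rightarrow> (func \<Rightarrow> func) \<Rightarrow> (hp \<Rightarrow> func \<Rightarrow> func) \<Rightarrow> (hp \<Rightarrow> real) \<Rightarrow> real \<Rightarrow> hp \<Rightarrow> func \<Rightarrow> hp \<Rightarrow> real"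
  where
  "reduce_quantity \<Omega> u uD r \<gamma> D f D' =
     (err \<Omega> u uD D' f)\<^sup>2 + (1 - sqrt \<gamma>) * r D * (estimator \<Omega> D' D' (uD D' f) f)\<^sup>2"

text \<open>Equivalence of two quantities up to the constant \<open>C\<close>.\<close>
definition equiv_upto :: "real \<Rightarrow> real \<Rightarrow> real \<Rightarrow> bool" where
  "equiv_upto C a b \<longleftrightarrow> a \<le> C * b \<and> b \<le> C * a"

end

theory Submission
  imports Defs
begin

text \<open>
  Write \<open>e\<close> and \<open>E\<close> for the squared error and the squared estimator on the
  current mesh, \<open>e'\<close> and \<open>E'\<close> for those on the next one, and \<open>z\<close> for the squared energy distance
  of the two discrete solutions. The proof combines three facts.

  The discrete spaces are nested, so by Galerkin orthogonality \<open>e = e' + z\<close>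
  (\<open>best_approximation_pythagoras\<close>).

  For a fixed discrete function, passing to the next mesh multiplies the squared estimator by at most
  \<open>\<gamma> = 1 - \<theta> / 2\<close> (\<open>estimator_reduction\<close>). Refinement creates no new jumps, since the function is
  a polynomial on every old triangle; it never increases the weights; and for a marked triangle,
  replaced by its grandchildren, all weights are at least halved because every side is cut at its
  midpoint.

  Replacing the old discrete function by the new one on the new mesh changes the estimator by at most
  its value at the difference, with right-hand side zero (\<open>estimator_young\<close>), and by efficiency this
  value is controlled by \<open>z / r\<close>.

  Hence \<open>E' \<le> sqrt \<gamma> * E + z / ((1 - sqrt \<gamma>) * r)\<close>. In the combination
  \<open>e' + (1 - sqrt \<gamma>) * r * E'\<close> the contributions of \<open>z\<close> cancel, and reliability turns the remaining
  decrease of \<open>E\<close> into the stated contraction (\<open>contraction_arithmetic\<close>, \<open>contraction\<close>). Efficiency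
  makes the contracted quantity equivalent to \<open>e\<close>, and as the degrees are inherited, the constant \<open>r\<close>
  stays the same throughout. The number of iterations follows by taking logarithms
  (\<open>iteration_bounds\<close>).

  Three groups of lemmas prepare these facts. The seminorm is defined through a chosen weak
  gradient, so that treating it as a Hilbert seminorm rests on the uniqueness of weak gradients, that
  is, on the fundamental lemma of the calculus of variations. The jumps are defined through chosen
  triangles and normals, so that handling them rests on the geometry of conforming triangulations: an
  edge inside the domain has exactly two adjacent triangles, on opposite sides. Finally, two distinct triangles
  of the coarse mesh whose descendants share an edge share an edge themselves, which contains it.
\<close>

section \<open>Bump functions and the fundamental lemma of the calculus of variations\<close>

lemma pd_eqI: "(w has_derivative w') (at x) \<Longrightarrow> pd i w x = w' (axis i 1)"
  unfolding pd_def using frechet_derivative_at by metis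

lemma pd_lincomb:
  assumes "f differentiable (at x)" "g differentiable (at x)"
  shows "pd i (\<lambda>x. \<alpha> * f x + \<beta> * g x) x = \<alpha> * pd i f x + \<beta> * pd i g x"
proof -
  have "((\<lambda>x. \<alpha> * f x + \<beta> * g x) has_derivative
      (\<lambda>h. \<alpha> * frechet_derivative f (at x) h + \<beta> * frechet_derivative g (at x) h)) (at x)"
    using assms unfolding frechet_derivative_works
    by (intro has_derivative_add has_derivative_mult_right)
  from pd_eqI[OF this] show ?thesis by (simp add: pd_def)
qed

lemma pd_mult:
  assumes "f differentiable (at x)" "g differentiable (at x)"
  shows "pd i (\<lambda>x. f x * g x) x = f x * pd i g x + pd i f x * g x"
proof -
  have "((\<lambda>x. f x * g x) has_derivative
      (\<lambda>h. f x * frechet_derivative g (at x) h + frechet_derivative f (at x) h * g x)) (at x)"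
    using assms unfolding frechet_derivative_works
    by (intro has_derivative_mult)
  from pd_eqI[OF this] show ?thesis by (simp add: pd_def)
qed

lemma C_k_Suc_imp: "C_k (Suc k) w \<Longrightarrow> C_k k w"
proof (induction k arbitrary: w)
  case 0
  then show ?case
    by (auto intro!: continuous_at_imp_continuous_on differentiable_imp_continuous_within)
next
  case (Suc k)
  then show ?case by (metis C_k.simps(2))
qed

lemma C_k_lincomb: "C_k k f \<Longrightarrow> C_k k g \<Longrightarrow> C_k k (\<lambda>x. \<alpha> * f x + \<beta> * g x)"
proof (induction k arbitrary: f g)
  case 0
  then show ?case by (auto intro!: continuous_intros)
next
  case (Suc k)
  have "pd i (\<lambda>x. \<alpha> * f x + \<beta> * g x) = (\<lambda>x. \<alpha> * pd i f x + \<beta> * pd i g x)" for i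
    using Suc.prems by (auto simp: pd_lincomb)
  then show ?case using Suc by (auto intro!: differentiable_add differentiable_mult differentiable_const)
qed

lemma C_k_mult: "C_k k f \<Longrightarrow> C_k k g \<Longrightarrow> C_k k (\<lambda>x. f x * g x)"
proof (induction k arbitrary: f g)
  case 0
  then show ?case by (auto intro!: continuous_intros)
next
  case (Suc k)
  have pd: "pd i (\<lambda>x. f x * g x) = (\<lambda>x. 1 * (f x * pd i g x) + 1 * (pd i f x * g x))" for i
    using Suc.prems by (auto simp: pd_mult)
  have "C_k k (pd i (\<lambda>x. f x * g x))" for i
    unfolding pd using Suc.prems C_k_Suc_imp
    by (intro C_k_lincomb Suc.IH) auto
  then show ?case using Suc.prems by (auto intro!: differentiable_mult)
qed

text \<open>For \<open>P = 1\<close> this is the standard smooth function that is flat at the origin. The polynomial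
  factor makes the family closed under differentiation, which gives smoothness of all orders by one
  induction.\<close>
definition flat :: "real poly \<Rightarrow> real \<Rightarrow> real" where
  "flat P t = (if t > 0 then poly P (1 / t) * exp (- (1 / t)) else 0)"

text \<open>For \<open>k = 1\<close> and \<open>s = 1 / t\<close> this is the convergence to zero of the difference quotients of
  \<open>flat P\<close> at the origin, from the right. The other powers serve the induction over \<open>P\<close>.\<close>
lemma poly_times_exp_tendsto_0: "((\<lambda>s. s ^ k * poly P s * exp (- s)) \<longlongrightarrow> (0::real)) at_top"
proof (induction P arbitrary: k)
  case 0
  then show ?case by simp
next
  case (pCons a P)
  have "((\<lambda>s. a * (s ^ k / exp s) + s ^ Suc k * poly P s * exp (- s)) \<longlongrightarrow> a * 0 + 0) at_top"
    by (intro tendsto_add tendsto_mult tendsto_const tendsto_power_div_exp_0 pCons.IH)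
  then show ?case
    by (simp add: algebra_simps exp_minus divide_inverse)
qed

lemma flat_has_derivative:
  "(flat P has_real_derivative flat ([:0, 0, 1:] * (P - pderiv P)) t) (at t)"
proof -
  consider "t > 0" | "t < 0" | "t = 0" by linarith
  then show ?thesis
  proof cases
    case 1
    have "((\<lambda>t. poly P (1 / t) * exp (- (1 / t))) has_real_derivative
       flat ([:0, 0, 1:] * (P - pderiv P)) t) (at t)"
      using 1 by (auto intro!: derivative_eq_intros poly_DERIV DERIV_chain2[where f = "poly P"]
          simp: flat_def field_simps power2_eq_square)
    moreover have "\<forall>\<^sub>F s in nhds t. flat P s = poly P (1 / s) * exp (- (1 / s))"
      using eventually_nhds_in_open[of "{0<..}" t] 1 by (auto elim!: eventually_mono simp: flat_def)
    ultimately show ?thesis by (subst DERIV_cong_ev[OF refl _ refl]) auto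
  next
    case 2
    have "\<forall>\<^sub>F s in nhds t. flat P s = 0"
      using eventually_nhds_in_open[of "{..<0}" t] 2 by (auto elim!: eventually_mono simp: flat_def)
    then have "(flat P has_real_derivative 0) (at t)" by (subst DERIV_cong_ev[OF refl _ refl]) auto
    then show ?thesis using 2 by (simp add: flat_def)
  next
    case 3
    have "((\<lambda>s. s ^ 1 * poly P s * exp (- s)) \<longlongrightarrow> 0) at_top"
      by (rule poly_times_exp_tendsto_0)
    from filterlim_compose[OF this filterlim_inverse_at_top_right]
    have "((\<lambda>h. inverse h * poly P (inverse h) * exp (- inverse h)) \<longlongrightarrow> 0) (at_right 0)"
      by simp
    then have "((\<lambda>h. flat P h / h) \<longlongrightarrow> 0) (at_right 0)"
      by (rule Lim_transform_eventually)
        (auto intro!: eventually_at_rightI[of 0 1] simp: flat_def field_simps)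
    moreover have "((\<lambda>h. flat P h / h) \<longlongrightarrow> 0) (at_left 0)"
      by (rule Lim_transform_eventually[OF tendsto_const])
        (auto intro!: eventually_at_leftI[of "-1" 0] simp: flat_def)
    ultimately have "((\<lambda>h. flat P h / h) \<longlongrightarrow> 0) (at 0)"
      by (simp add: filterlim_split_at)
    then show ?thesis using 3 by (simp add: DERIV_def flat_def)
  qed
qed

lemma C_k_flat: "C_k k (\<lambda>x. flat P (c * x $ i + d))"
proof (induction k arbitrary: P)
  case 0
  have "continuous_on UNIV (flat P)" 
    using flat_has_derivative DERIV_isCont by (blast intro: continuous_at_imp_continuous_on)
  then show ?case by (auto intro!: continuous_on_compose2[of UNIV "flat P"] continuous_intros)
next
  case (Suc k)
  let ?Q = "[:0, 0, 1:] * (P - pderiv P)"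
  have D: "((\<lambda>x. flat P (c * x $ i + d)) has_derivative
         (\<lambda>h. flat ?Q (c * x $ i + d) * (c * h $ i))) (at x)" for x :: point
    by (rule has_derivative_compose[of "\<lambda>x. c * x $ i + d" "\<lambda>h. c * h $ i" x UNIV "flat P" "\<lambda>h. flat ?Q (c * x $ i + d) * h"])
      (auto intro!: derivative_eq_intros bounded_linear_imp_has_derivative bounded_linear_vec_nth
        simp: flat_has_derivative[unfolded has_field_derivative_def] simp del: mult_pCons_left)
  have pd: "pd j (\<lambda>x. flat P (c * x $ i + d)) =
      (\<lambda>x. (c * axis j 1 $ i) * flat ?Q (c * x $ i + d) + 0 * flat ?Q (c * x $ i + d))" for j
    using pd_eqI[OF D] by auto
  have "C_k k (pd j (\<lambda>x. flat P (c * x $ i + d)))" for j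
    unfolding pd by (intro C_k_lincomb Suc.IH)
  moreover have "(\<lambda>x. flat P (c * x $ i + d)) differentiable (at x)" for x :: point
    using D unfolding differentiable_def by blast
  ultimately show ?case by simp
qed

text \<open>A smooth function that is positive exactly on the open box. The parameter \<open>c\<close> sharpens it: as
  \<open>c\<close> grows, it approaches the indicator function of the box, because
  \<open>exp (- 1 / (c * s))\<close> tends to 1 for each \<open>s > 0\<close>. This replaces mollification.\<close>
definition bump :: "real \<Rightarrow> point \<Rightarrow> point \<Rightarrow> func" where
  "bump c a b x = flat 1 (c * x $ 1 + - c * a $ 1) * flat 1 (- c * x $ 1 + c * b $ 1)
     * (flat 1 (c * x $ 2 + - c * a $ 2) * flat 1 (- c * x $ 2 + c * b $ 2))"

lemma flat_1: "flat 1 t = (if t > 0 then exp (- (1 / t)) else 0)"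
  by (simp add: flat_def)

lemma bump_bounds: "0 \<le> bump c a b x" "bump c a b x \<le> 1"
  by (auto simp: bump_def flat_1 mult_le_one)

lemma bump_support: "c > 0 \<Longrightarrow> bump c a b x \<noteq> 0 \<longleftrightarrow> x \<in> box a b"
proof -
  assume c: "c > 0"
  have *: "0 < c * s + - c * t \<longleftrightarrow> t < s" "0 < - c * s + c * t \<longleftrightarrow> s < t" for s t
    using c by (auto simp: mult_less_cancel_left_pos)
  show ?thesis unfolding bump_def flat_1 *
    by (auto simp: mem_box_cart forall_2)
qed

lemma bump_C_k: "C_k k (bump c a b)"
  unfolding bump_def[abs_def] by (intro C_k_mult C_k_flat)

lemma bump_test_function:
  assumes "c > 0" "cbox a b \<subseteq> \<Omega>"
  shows "bump c a b \<in> test_functions \<Omega>"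
proof -
  have "{x. bump c a b x \<noteq> 0} = box a b" using bump_support assms by auto
  moreover have "closure (box a b) \<subseteq> cbox a b"
    by (metis box_subset_cbox closed_cbox closure_minimal order_refl)
  moreover have "compact (closure (box a b))"
    using bounded_box compact_closure by blast
  ultimately show ?thesis using assms bump_C_k by (auto simp: test_functions_def)
qed

lemma bump_tendsto: "(\<lambda>n. bump (real (Suc n)) a b x) \<longlonglongrightarrow> indicator (box a b) x"
proof (cases "x \<in> box a b")
  case True
  have *: "(\<lambda>n. flat 1 (real (Suc n) * s)) \<longlonglongrightarrow> 1" if "s > 0" for s
  proof -
    have "(\<lambda>n. exp (- ((1 / s) * inverse (real (Suc n))))) \<longlonglongrightarrow> exp (- ((1 / s) * 0))"
      by (intro tendsto_intros LIMSEQ_inverse_real_of_nat)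
    moreover have "exp (- ((1 / s) * inverse (real (Suc n)))) = flat 1 (real (Suc n) * s)" for n
    proof -
      have "real (Suc n) * s > 0" using that by simp
      then show ?thesis unfolding flat_1 using that by (simp add: divide_inverse ac_simps)
    qed
    ultimately show ?thesis by simp
  qed
  have e: "c * s + - c * t = c * (s - t)" "- c * s + c * t = c * (t - s)" for c s t :: real
    by (auto simp: algebra_simps)
  have "(\<lambda>n. bump (real (Suc n)) a b x) \<longlonglongrightarrow> (1 * 1) * (1 * 1)"
    unfolding bump_def e using True
    by (intro tendsto_mult *) (auto simp: mem_box_cart)
  then show ?thesis using True by simp
next
  case False
  then have "bump (real (Suc n)) a b x = 0" for n using bump_support[of "real (Suc n)"] by auto
  then show ?thesis using False by simp
qed

lemma test_function_continuous:
  assumes "\<phi> \<in> test_functions \<Omega>"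
  shows "continuous_on UNIV \<phi>" "continuous_on UNIV (pd i \<phi>)" "\<phi> differentiable (at x)"
proof -
  have "C_k 0 \<phi>" "C_k 1 \<phi>" using assms by (auto simp: test_functions_def)
  then show "continuous_on UNIV \<phi>" "continuous_on UNIV (pd i \<phi>)" "\<phi> differentiable (at x)" by auto
qed

lemma continuous_measurable_lebesgue_on:
  fixes f :: func
  assumes "continuous_on UNIV f" "S \<in> sets lebesgue"
  shows "f \<in> borel_measurable (lebesgue_on S)"
  using assms by (meson continuous_imp_measurable_on_sets_lebesgue continuous_on_subset subset_UNIV)

text \<open>By the Lebesgue differentiation theorem for cubes, almost every value of \<open>g\<close> is the limit of its
  means over shrinking cubes, and these means vanish.\<close>
lemma integral_zero_on_boxes_imp_AE_zero:
  fixes g :: func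
  assumes \<Omega>: "open \<Omega>" and g: "integrable (lebesgue_on \<Omega>) g"
    and 0: "\<And>a b. cbox a b \<subseteq> \<Omega> \<Longrightarrow> integral (cbox a b) g = 0"
  shows "AE x in lebesgue_on \<Omega>. g x = 0"
proof -
  let ?G = "\<lambda>x. if x \<in> \<Omega> then g x else 0"
  have m: "\<Omega> \<in> sets lebesgue" using \<Omega> by auto
  have "g absolutely_integrable_on \<Omega>"
    using g m by (simp add: integrable_restrict_space set_integrable_def)
  then have "?G absolutely_integrable_on UNIV"
    by (simp add: absolutely_integrable_restrict_UNIV)
  then have "?G integrable_on cbox a b" for a b
    by (meson absolutely_integrable_on_def integrable_on_subcbox subset_UNIV)
  then obtain N where N: "negligible N" and lim: "\<And>x e. \<lbrakk>x \<notin> N; 0 < e\<rbrakk> \<Longrightarrow>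
      \<exists>d>0. \<forall>h. 0 < h \<and> h < d \<longrightarrow>
         norm(integral (cbox x (x + h *\<^sub>R One)) ?G /\<^sub>R h ^ DIM(point) - ?G x) < e"
    by (rule integrable_ccontinuous_explicit) blast
  have "g x = 0" if x: "x \<in> \<Omega>" "x \<notin> N" for x
  proof (rule ccontr)
    assume "g x \<noteq> 0"
    then obtain d where d: "d > 0" and dd: "\<forall>h. 0 < h \<and> h < d \<longrightarrow>
         norm(integral (cbox x (x + h *\<^sub>R One)) ?G /\<^sub>R h ^ DIM(point) - ?G x) < \<bar>g x\<bar>"
      using lim[OF x(2), of "\<bar>g x\<bar>"] by auto
    obtain r where r: "r > 0" "ball x r \<subseteq> \<Omega>" using \<Omega> x(1) open_contains_ball by blast
    define h where "h = min (d / 2) (r / 4)"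
    have h: "0 < h" "h < d" "h \<le> r / 4" using d r by (auto simp: h_def)
    have sub: "cbox x (x + h *\<^sub>R One) \<subseteq> \<Omega>"
    proof
      fix y assume y: "y \<in> cbox x (x + h *\<^sub>R One)"
      have c: "\<bar>(y - x) \<bullet> i\<bar> \<le> h" if "i \<in> Basis" for i
        using y that h(1) by (auto simp: mem_box inner_simps abs_le_iff dest!: bspec[of _ _ i])
      have "norm (y - x) \<le> (\<Sum>i\<in>Basis. \<bar>(y - x) \<bullet> i\<bar>)" by (rule norm_le_l1)
      also have "\<dots> \<le> real (card (Basis :: point set)) * h" by (rule sum_bounded_above) (rule c)
      also have "\<dots> = 2 * h" by simp
      also have "\<dots> < r" using h r by linarith
      finally show "y \<in> \<Omega>" using r by (auto simp: dist_norm norm_minus_commute)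
    qed
    have "integral (cbox x (x + h *\<^sub>R One)) ?G = integral (cbox x (x + h *\<^sub>R One)) g"
      using sub by (intro integral_cong) auto
    then show False using dd h 0[OF sub] x(1) by (auto simp del: One_nat_def)
  qed
  then show ?thesis
    using N m unfolding AE_restrict_space_iff[OF sets.Int_space_eq2[OF m, THEN ssubst[where P = "\<lambda>s. s \<in> _"], OF m]]
    by (intro AE_I'[of N]) (auto simp: negligible_iff_null_sets)
qed

text \<open>Dominated convergence along the sharpening bumps turns the hypothesis into vanishing integrals over
  boxes. This lemma is what makes weak gradients unique, and hence the seminorm quadratic.\<close>
lemma fundamental_lemma:
  fixes g :: func
  assumes \<Omega>: "open \<Omega>" and g: "integrable (lebesgue_on \<Omega>) g"
    and 0: "\<And>\<phi>. \<phi> \<in> test_functions \<Omega> \<Longrightarrow> (LINT x|lebesgue_on \<Omega>. g x * \<phi> x) = 0"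
  shows "AE x in lebesgue_on \<Omega>. g x = 0"
proof (rule integral_zero_on_boxes_imp_AE_zero[OF \<Omega> g])
  fix a b assume ab: "cbox a b \<subseteq> \<Omega>"
  have m: "\<Omega> \<in> sets lebesgue" using \<Omega> by auto
  have gm: "g \<in> borel_measurable (lebesgue_on \<Omega>)" using g by auto
  have box: "box a b \<in> sets (lebesgue_on \<Omega>)"
    using ab m box_subset_cbox[of a b] by (subst sets_restrict_space_iff) auto
  have "(\<lambda>n. LINT x|lebesgue_on \<Omega>. g x * bump (real (Suc n)) a b x) \<longlonglongrightarrow>
         (LINT x|lebesgue_on \<Omega>. g x * indicator (box a b) x)"
  proof (rule integral_dominated_convergence[where w = "\<lambda>x. \<bar>g x\<bar>"])
    show "(\<lambda>x. g x * indicator (box a b) x) \<in> borel_measurable (lebesgue_on \<Omega>)"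
      using gm box by (intro borel_measurable_times borel_measurable_indicator)
    show "(\<lambda>x. g x * bump (real (Suc n)) a b x) \<in> borel_measurable (lebesgue_on \<Omega>)" for n
      using bump_C_k[of 0] by (intro borel_measurable_times[OF gm continuous_measurable_lebesgue_on[OF _ m]]) auto
    show "integrable (lebesgue_on \<Omega>) (\<lambda>x. \<bar>g x\<bar>)" using g by auto
    show "AE x in lebesgue_on \<Omega>. (\<lambda>n. g x * bump (real (Suc n)) a b x) \<longlonglongrightarrow> g x * indicator (box a b) x"
      by (intro AE_I2 tendsto_mult tendsto_const bump_tendsto)
    show "AE x in lebesgue_on \<Omega>. norm (g x * bump (real (Suc n)) a b x) \<le> \<bar>g x\<bar>" for n
      using bump_bounds[of "real (Suc n)" a b] by (intro AE_I2) (simp add: abs_mult mult_left_le)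
  qed
  moreover have "(LINT x|lebesgue_on \<Omega>. g x * bump (real (Suc n)) a b x) = 0" for n
    by (rule 0) (rule bump_test_function, use ab in auto)
  ultimately have "(LINT x|lebesgue_on \<Omega>. g x * indicator (box a b) x) = 0"
    by (simp add: LIMSEQ_const_iff)
  moreover have "(LINT x|lebesgue_on \<Omega>. g x * indicator (box a b) x) = integral \<Omega> (\<lambda>x. g x * indicator (box a b) x)"
    using g by (intro lebesgue_integral_eq_integral m) (intro integrable_real_mult_indicator box)
  moreover have "integral \<Omega> (\<lambda>x. g x * indicator (box a b) x) = integral (box a b) g"
  proof -
    have "box a b \<inter> \<Omega> = box a b" using ab box_subset_cbox by blast
    moreover have "(\<lambda>x. g x * indicator (box a b) x) = (\<lambda>x. if x \<in> box a b then g x else 0)"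
      by (auto simp: indicator_def)
    ultimately show ?thesis using integral_restrict_Int[of \<Omega> "box a b" g] by (simp add: Int_commute)
  qed
  ultimately show "integral (cbox a b) g = 0" by (simp add: integral_open_interval)
qed

section \<open>The Dirichlet form on the Sobolev space\<close>

lemma test_function_bounded:
  assumes "\<phi> \<in> test_functions \<Omega>"
  obtains B where "\<And>x. \<bar>\<phi> x\<bar> \<le> B" "\<And>x i. \<bar>pd i \<phi> x\<bar> \<le> B"
    "\<And>x. x \<notin> closure {x. \<phi> x \<noteq> 0} \<Longrightarrow> \<phi> x = 0" "\<And>x i. x \<notin> closure {x. \<phi> x \<noteq> 0} \<Longrightarrow> pd i \<phi> x = 0"
proof -
  define K where "K = closure {x. \<phi> x \<noteq> 0}"
  have K: "compact K" using assms by (simp add: test_functions_def K_def)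
  have out: "\<phi> x = 0" if "x \<notin> K" for x
    using that closure_subset[of "{x. \<phi> x \<noteq> 0}"] by (auto simp: subset_iff K_def)
  have outd: "pd i \<phi> x = 0" if "x \<notin> K" for x i
  proof -
    have "(\<phi> has_derivative (\<lambda>h. 0)) (at x)"
      by (rule has_derivative_transform_within_open[of "\<lambda>x. 0" _ _ _ "- K"]) (use K in \<open>simp_all add: that out open_Compl compact_imp_closed\<close>)
    then show ?thesis by (simp add: pd_eqI)
  qed
  have bd: "\<exists>B. \<forall>x. \<bar>f x\<bar> \<le> B" if c: "continuous_on UNIV f" and o: "\<And>x. x \<notin> K \<Longrightarrow> f x = 0" for f :: func
  proof -
    have "bounded (f ` K)"
      by (intro compact_imp_bounded compact_continuous_image K continuous_on_subset[OF c]) simp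
    then obtain B where B: "\<forall>x\<in>K. \<bar>f x\<bar> \<le> B" unfolding bounded_iff by auto
    have "\<bar>f x\<bar> \<le> max B 0" for x
      by (cases "x \<in> K") (use B o[of x] in \<open>auto intro: max.coboundedI1\<close>)
    then show ?thesis by blast
  qed
  obtain B where B: "\<forall>x. \<bar>\<phi> x\<bar> \<le> B"
    using bd[OF test_function_continuous(1)[OF assms] out] by auto
  have "\<forall>i. \<exists>B. \<forall>x. \<bar>pd i \<phi> x\<bar> \<le> B"
    by (intro allI bd[OF test_function_continuous(2)[OF assms] outd])
  then obtain B' where B': "\<forall>i x. \<bar>pd i \<phi> x\<bar> \<le> B' i" by metis
  show ?thesis
  proof (rule that[of "max B (max (B' 1) (B' 2))"])
    show "\<bar>\<phi> x\<bar> \<le> max B (max (B' 1) (B' 2))" for x using B[rule_format, of x] by linarith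
    show "\<bar>pd i \<phi> x\<bar> \<le> max B (max (B' 1) (B' 2))" for x i
    proof -
      have "\<bar>pd 1 \<phi> x\<bar> \<le> max B (max (B' 1) (B' 2))" "\<bar>pd 2 \<phi> x\<bar> \<le> max B (max (B' 1) (B' 2))"
        using B'[rule_format, of 1 x] B'[rule_format, of 2 x] by linarith+
      then show ?thesis using exhaust_2[of i] by metis
    qed
  qed (use out outd in \<open>simp_all add: K_def[symmetric]\<close>)
qed

lemma test_function_outside:
  assumes "\<phi> \<in> test_functions \<Omega>" "x \<notin> closure {x. \<phi> x \<noteq> 0}"
  shows "\<phi> x = 0" "pd i \<phi> x = 0"
proof -
  show "\<phi> x = 0"
    by (rule test_function_bounded[OF assms(1)]) (use assms(2) in blast)
  show "pd i \<phi> x = 0"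
    by (rule test_function_bounded[OF assms(1)]) (use assms(2) in blast)
qed

lemma L2_lincomb:
  assumes "f \<in> L2 \<Omega>" "g \<in> L2 \<Omega>"
  shows "(\<lambda>x. \<alpha> * f x + \<beta> * g x) \<in> L2 \<Omega>"
proof -
  have m: "f \<in> borel_measurable (lebesgue_on \<Omega>)" "g \<in> borel_measurable (lebesgue_on \<Omega>)"
    and i: "integrable (lebesgue_on \<Omega>) (\<lambda>x. (f x)\<^sup>2)" "integrable (lebesgue_on \<Omega>) (\<lambda>x. (g x)\<^sup>2)"
    using assms by (auto simp: L2_def)
  have *: "(\<alpha> * s + \<beta> * t)\<^sup>2 \<le> 2 * \<alpha>\<^sup>2 * s\<^sup>2 + 2 * \<beta>\<^sup>2 * t\<^sup>2" for s t :: real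
    using zero_le_power2[of "\<alpha> * s - \<beta> * t"] by (simp add: power2_eq_square algebra_simps)
  have "integrable (lebesgue_on \<Omega>) (\<lambda>x. (\<alpha> * f x + \<beta> * g x)\<^sup>2)"
  proof (rule Bochner_Integration.integrable_bound[where f = "\<lambda>x. 2 * \<alpha>\<^sup>2 * (f x)\<^sup>2 + 2 * \<beta>\<^sup>2 * (g x)\<^sup>2"])
    show "AE x in lebesgue_on \<Omega>. norm ((\<alpha> * f x + \<beta> * g x)\<^sup>2)
        \<le> norm (2 * \<alpha>\<^sup>2 * (f x)\<^sup>2 + 2 * \<beta>\<^sup>2 * (g x)\<^sup>2)"
      using * by (intro AE_I2) (simp only: real_norm_def abs_of_nonneg[OF zero_le_power2], meson abs_ge_self order_trans)
  qed (use m i in simp_all)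
  then show ?thesis using m by (auto simp: L2_def)
qed

lemma L2_mult_integrable:
  assumes "f \<in> L2 \<Omega>" "g \<in> L2 \<Omega>"
  shows "integrable (lebesgue_on \<Omega>) (\<lambda>x. f x * g x)"
proof -
  have m: "f \<in> borel_measurable (lebesgue_on \<Omega>)" "g \<in> borel_measurable (lebesgue_on \<Omega>)"
    and i: "integrable (lebesgue_on \<Omega>) (\<lambda>x. (f x)\<^sup>2)" "integrable (lebesgue_on \<Omega>) (\<lambda>x. (g x)\<^sup>2)"
    using assms by (auto simp: L2_def)
  have *: "\<bar>s * t\<bar> \<le> s\<^sup>2 + t\<^sup>2" for s t :: real
  proof -
    have "0 \<le> \<bar>s\<bar> * \<bar>t\<bar>" by simp
    moreover have "2 * \<bar>s\<bar> * \<bar>t\<bar> \<le> s\<^sup>2 + t\<^sup>2"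
      using zero_le_power2[of "\<bar>s\<bar> - \<bar>t\<bar>"] by (simp add: power2_diff)
    ultimately show ?thesis unfolding abs_mult by linarith
  qed
  show ?thesis
  proof (rule Bochner_Integration.integrable_bound[where f = "\<lambda>x. (f x)\<^sup>2 + (g x)\<^sup>2"])
    show "AE x in lebesgue_on \<Omega>. norm (f x * g x) \<le> norm ((f x)\<^sup>2 + (g x)\<^sup>2)"
      using * by (intro AE_I2) (simp only: real_norm_def, meson abs_ge_self order_trans)
  qed (use m i in simp_all)
qed

lemma L2_bounded:
  assumes "bounded \<Omega>" "\<Omega> \<in> sets lebesgue" "f \<in> borel_measurable (lebesgue_on \<Omega>)"
    and "\<And>x. x \<in> \<Omega> \<Longrightarrow> \<bar>f x\<bar> \<le> B"
  shows "f \<in> L2 \<Omega>"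
proof -
  have "finite_measure (lebesgue_on \<Omega>)"
    using assms(1,2) bounded_set_imp_lmeasurable finite_measure_lebesgue_on by blast
  moreover have "(f x)\<^sup>2 \<le> B\<^sup>2" if "x \<in> \<Omega>" for x
    using assms(4)[OF that] abs_le_square_iff by fastforce
  ultimately have "integrable (lebesgue_on \<Omega>) (\<lambda>x. (f x)\<^sup>2)"
    using assms(3) by (intro finite_measure.integrable_const_bound[of _ _ "B\<^sup>2"]) (auto intro!: AE_I2)
  then show ?thesis using assms(3) by (simp add: L2_def)
qed

locale bounded_open_set =
  fixes \<Omega> :: "point set"
  assumes open_\<Omega>: "open \<Omega>" and bounded_\<Omega>: "bounded \<Omega>"
begin

lemma meas_\<Omega>: "\<Omega> \<in> sets lebesgue" using open_\<Omega> by auto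

lemma L2_integrable: "f \<in> L2 \<Omega> \<Longrightarrow> integrable (lebesgue_on \<Omega>) f"
  using L2_mult_integrable[of f \<Omega> "\<lambda>x. 1"] L2_bounded[OF bounded_\<Omega> meas_\<Omega>, of "\<lambda>x. 1" 1] by auto

lemma test_function_L2:
  assumes "\<phi> \<in> test_functions \<Omega>"
  shows "\<phi> \<in> L2 \<Omega>" "pd i \<phi> \<in> L2 \<Omega>"
proof -
  obtain B where B: "\<And>x. \<bar>\<phi> x\<bar> \<le> B" "\<And>x i. \<bar>pd i \<phi> x\<bar> \<le> B" by (rule test_function_bounded[OF assms]) (rule that; assumption)
  show "\<phi> \<in> L2 \<Omega>" "pd i \<phi> \<in> L2 \<Omega>"
    by (rule L2_bounded[OF bounded_\<Omega> meas_\<Omega> continuous_measurable_lebesgue_on[OF _ meas_\<Omega>]],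
        rule test_function_continuous[OF assms], rule B)+
qed

lemma weak_gradient_lincomb:
  assumes "w \<in> L2 \<Omega>" "v \<in> L2 \<Omega>" "weak_gradient \<Omega> w g" "weak_gradient \<Omega> v h"
  shows "weak_gradient \<Omega> (\<lambda>x. \<alpha> * w x + \<beta> * v x) (\<lambda>x. \<alpha> *\<^sub>R g x + \<beta> *\<^sub>R h x)"
  unfolding weak_gradient_def
proof (intro conjI allI ballI)
  fix i
  have gh: "(\<lambda>x. g x $ i) \<in> L2 \<Omega>" "(\<lambda>x. h x $ i) \<in> L2 \<Omega>"
    using assms by (auto simp: weak_gradient_def)
  show "(\<lambda>x. (\<alpha> *\<^sub>R g x + \<beta> *\<^sub>R h x) $ i) \<in> L2 \<Omega>"
    using L2_lincomb[OF gh] by simp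
  fix \<phi> assume \<phi>: "\<phi> \<in> test_functions \<Omega>"
  have "(LINT x|lebesgue_on \<Omega>. (\<alpha> * w x + \<beta> * v x) * pd i \<phi> x)
      = (LINT x|lebesgue_on \<Omega>. \<alpha> * (w x * pd i \<phi> x) + \<beta> * (v x * pd i \<phi> x))"
    by (simp add: algebra_simps)
  also have "\<dots> = \<alpha> * (LINT x|lebesgue_on \<Omega>. w x * pd i \<phi> x) + \<beta> * (LINT x|lebesgue_on \<Omega>. v x * pd i \<phi> x)"
    using L2_mult_integrable[OF _ test_function_L2(2)[OF \<phi>]] assms by simp
  also have "\<dots> = \<alpha> * (- (LINT x|lebesgue_on \<Omega>. g x $ i * \<phi> x)) + \<beta> * (- (LINT x|lebesgue_on \<Omega>. h x $ i * \<phi> x))"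
    using assms \<phi> by (auto simp: weak_gradient_def)
  also have "\<dots> = - (LINT x|lebesgue_on \<Omega>. \<alpha> * (g x $ i * \<phi> x) + \<beta> * (h x $ i * \<phi> x))"
    using L2_mult_integrable[OF _ test_function_L2(1)[OF \<phi>]] gh by simp
  also have "\<dots> = - (LINT x|lebesgue_on \<Omega>. (\<alpha> *\<^sub>R g x + \<beta> *\<^sub>R h x) $ i * \<phi> x)"
    by (simp add: algebra_simps)
  finally show "(LINT x|lebesgue_on \<Omega>. (\<alpha> * w x + \<beta> * v x) * pd i \<phi> x)
      = - (LINT x|lebesgue_on \<Omega>. (\<alpha> *\<^sub>R g x + \<beta> *\<^sub>R h x) $ i * \<phi> x)" .
qed

text \<open>The operator \<open>wgrad\<close> is an arbitrary choice of weak gradient. Only through uniqueness does it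
  become linear, up to null sets.\<close>
lemma weak_gradient_unique:
  assumes "weak_gradient \<Omega> w g" "weak_gradient \<Omega> w h"
  shows "AE x in lebesgue_on \<Omega>. g x = h x"
proof -
  have "AE x in lebesgue_on \<Omega>. g x $ i = h x $ i" for i
  proof -
    have gh: "(\<lambda>x. g x $ i) \<in> L2 \<Omega>" "(\<lambda>x. h x $ i) \<in> L2 \<Omega>"
      using assms by (auto simp: weak_gradient_def)
    have "AE x in lebesgue_on \<Omega>. g x $ i - h x $ i = 0"
    proof (rule fundamental_lemma[OF open_\<Omega>])
      show "integrable (lebesgue_on \<Omega>) (\<lambda>x. g x $ i - h x $ i)"
        using gh L2_integrable by auto
      fix \<phi> assume \<phi>: "\<phi> \<in> test_functions \<Omega>"
      have "(LINT x|lebesgue_on \<Omega>. g x $ i * \<phi> x) = (LINT x|lebesgue_on \<Omega>. h x $ i * \<phi> x)"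
      proof -
        have "(LINT x|lebesgue_on \<Omega>. w x * pd i \<phi> x) = - (LINT x|lebesgue_on \<Omega>. g x $ i * \<phi> x)"
          using assms(1) \<phi> unfolding weak_gradient_def by blast
        moreover have "(LINT x|lebesgue_on \<Omega>. w x * pd i \<phi> x) = - (LINT x|lebesgue_on \<Omega>. h x $ i * \<phi> x)"
          using assms(2) \<phi> unfolding weak_gradient_def by blast
        ultimately show ?thesis by linarith
      qed
      then show "(LINT x|lebesgue_on \<Omega>. (g x $ i - h x $ i) * \<phi> x) = 0"
        using L2_mult_integrable[OF _ test_function_L2(1)[OF \<phi>]] gh
        by (simp add: left_diff_distrib)
    qed
    then show ?thesis by simp
  qed
  from this[of 1] this[of 2] show ?thesis
    by eventually_elim (simp add: vec_eq_iff forall_2)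
qed

lemma wgrad: "w \<in> H1 \<Omega> \<Longrightarrow> weak_gradient \<Omega> w (wgrad \<Omega> w)"
  unfolding H1_def wgrad_def using someI[of "weak_gradient \<Omega> w"] by blast

lemma H1_lincomb: "w \<in> H1 \<Omega> \<Longrightarrow> v \<in> H1 \<Omega> \<Longrightarrow> (\<lambda>x. \<alpha> * w x + \<beta> * v x) \<in> H1 \<Omega>"
  unfolding H1_def using L2_lincomb weak_gradient_lincomb by blast

lemma wgrad_lincomb:
  assumes "w \<in> H1 \<Omega>" "v \<in> H1 \<Omega>"
  shows "AE x in lebesgue_on \<Omega>.
    wgrad \<Omega> (\<lambda>x. \<alpha> * w x + \<beta> * v x) x = \<alpha> *\<^sub>R wgrad \<Omega> w x + \<beta> *\<^sub>R wgrad \<Omega> v x"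
  using assms H1_lincomb
  by (intro weak_gradient_unique[OF wgrad weak_gradient_lincomb[OF _ _ wgrad wgrad]]) (auto simp: H1_def)

definition dirichlet :: "func \<Rightarrow> func \<Rightarrow> real" where
  "dirichlet w v = (LINT x|lebesgue_on \<Omega>. wgrad \<Omega> w x \<bullet> wgrad \<Omega> v x)"

lemma wgrad_components_L2: "w \<in> H1 \<Omega> \<Longrightarrow> (\<lambda>x. wgrad \<Omega> w x $ i) \<in> L2 \<Omega>"
  using wgrad by (auto simp: weak_gradient_def)

lemma wgrad_measurable: "w \<in> H1 \<Omega> \<Longrightarrow> wgrad \<Omega> w \<in> borel_measurable (lebesgue_on \<Omega>)"
  using wgrad_components_L2[of w]
  by (subst borel_measurable_euclidean_space) (auto simp: L2_def Basis_vec_def inner_axis)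

lemma dirichlet_integrable:
  assumes "w \<in> H1 \<Omega>" "v \<in> H1 \<Omega>"
  shows "integrable (lebesgue_on \<Omega>) (\<lambda>x. wgrad \<Omega> w x \<bullet> wgrad \<Omega> v x)"
  unfolding inner_vec_def using assms
  by (auto intro!: Bochner_Integration.integrable_sum L2_mult_integrable wgrad_components_L2)

lemma dirichlet_commute: "dirichlet w v = dirichlet v w"
  by (simp add: dirichlet_def inner_commute)

lemma dirichlet_lincomb_left:
  assumes "w \<in> H1 \<Omega>" "v \<in> H1 \<Omega>" "z \<in> H1 \<Omega>"
  shows "dirichlet (\<lambda>x. \<alpha> * w x + \<beta> * v x) z = \<alpha> * dirichlet w z + \<beta> * dirichlet v z"
proof -
  have "dirichlet (\<lambda>x. \<alpha> * w x + \<beta> * v x) z =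
     (LINT x|lebesgue_on \<Omega>. \<alpha> * (wgrad \<Omega> w x \<bullet> wgrad \<Omega> z x) + \<beta> * (wgrad \<Omega> v x \<bullet> wgrad \<Omega> z x))"
    unfolding dirichlet_def
  proof (rule integral_cong_AE)
    show "AE x in lebesgue_on \<Omega>. wgrad \<Omega> (\<lambda>x. \<alpha> * w x + \<beta> * v x) x \<bullet> wgrad \<Omega> z x =
       \<alpha> * (wgrad \<Omega> w x \<bullet> wgrad \<Omega> z x) + \<beta> * (wgrad \<Omega> v x \<bullet> wgrad \<Omega> z x)"
      using wgrad_lincomb[OF assms(1,2), of \<alpha> \<beta>] by eventually_elim (simp add: inner_simps)
  qed (use assms H1_lincomb wgrad_measurable in auto)
  also have "\<dots> = \<alpha> * dirichlet w z + \<beta> * dirichlet v z"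
    unfolding dirichlet_def using dirichlet_integrable assms by simp
  finally show ?thesis .
qed

lemma dirichlet_lincomb_right:
  assumes "w \<in> H1 \<Omega>" "v \<in> H1 \<Omega>" "z \<in> H1 \<Omega>"
  shows "dirichlet z (\<lambda>x. \<alpha> * w x + \<beta> * v x) = \<alpha> * dirichlet z w + \<beta> * dirichlet z v"
  using dirichlet_lincomb_left[OF assms] by (simp add: dirichlet_commute)

lemma H1_seminorm_sq: "(H1_seminorm \<Omega> w)\<^sup>2 = dirichlet w w"
  unfolding H1_seminorm_def dirichlet_def
  by (simp add: dot_square_norm[symmetric] integral_nonneg_AE)

lemma dirichlet_nonneg: "dirichlet w w \<ge> 0"
  using H1_seminorm_sq[of w] by (metis zero_le_power2)

lemma dirichlet_lincomb_self:
  assumes "w \<in> H1 \<Omega>" "v \<in> H1 \<Omega>"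
  shows "dirichlet (\<lambda>x. \<alpha> * w x + \<beta> * v x) (\<lambda>x. \<alpha> * w x + \<beta> * v x)
    = \<alpha>\<^sup>2 * dirichlet w w + 2 * \<alpha> * \<beta> * dirichlet w v + \<beta>\<^sup>2 * dirichlet v v"
  using assms by (simp add: dirichlet_lincomb_left dirichlet_lincomb_right H1_lincomb
      dirichlet_commute[of v w] power2_eq_square algebra_simps)

text \<open>Translation invariance of the Lebesgue measure makes the integrals of all difference quotients of
  \<open>F\<close> vanish. By the mean value theorem the quotients are bounded, with bounded support, so the
  limit can be taken under the integral.\<close>
lemma integral_pd_eq_0:
  assumes K: "compact K" "K \<subseteq> \<Omega>" and out: "\<And>x. x \<notin> K \<Longrightarrow> F x = 0" "\<And>x. x \<notin> K \<Longrightarrow> pd i F x = 0"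
    and diff: "\<And>x. F differentiable (at x)" and cont: "continuous_on UNIV (pd i F)"
  shows "(LINT x|lebesgue_on \<Omega>. pd i F x) = 0"
proof -
  let ?e = "axis i 1 :: point"
  have contF: "continuous_on UNIV F"
    by (intro continuous_at_imp_continuous_on ballI differentiable_imp_continuous_within diff)
  have Fint: "integrable lborel F"
  proof -
    have "integrable lborel (\<lambda>x. indicator K x *\<^sub>R F x)"
      by (intro borel_integrable_compact K continuous_on_subset[OF contF]) simp
    moreover have "(\<lambda>x. indicator K x *\<^sub>R F x) = F"
      using out(1) by (auto simp: indicator_def fun_eq_iff)
    ultimately show ?thesis by simp
  qed
  have Fm: "F \<in> borel_measurable borel" using Fint by auto
  have pdm: "pd i F \<in> borel_measurable borel" using cont by (rule borel_measurable_continuous_onI)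
  obtain B where B: "\<And>x. \<bar>pd i F x\<bar> \<le> B" "B \<ge> 0"
  proof -
    have "bounded (pd i F ` K)"
      by (intro compact_imp_bounded compact_continuous_image K continuous_on_subset[OF cont]) simp
    then obtain B where B: "\<forall>x\<in>K. \<bar>pd i F x\<bar> \<le> B" unfolding bounded_iff by auto
    have "\<bar>pd i F x\<bar> \<le> max B 0" for x
      by (cases "x \<in> K") (use B out(2)[of x] in \<open>auto intro: max.coboundedI1\<close>)
    then show ?thesis by (rule that) simp
  qed
  obtain r where r: "K \<subseteq> cball 0 r" using compact_imp_bounded[OF K(1)] unfolding bounded_iff by (auto simp: subset_iff)
  define q where "q n x = (F (x + inverse (real (Suc n)) *\<^sub>R ?e) - F x) / inverse (real (Suc n))" for n x
  have line: "((\<lambda>t. F (x + t *\<^sub>R ?e)) has_real_derivative pd i F (x + t *\<^sub>R ?e)) (at t)" for x t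
  proof -
    have "((\<lambda>t. F (x + t *\<^sub>R ?e)) has_derivative (\<lambda>h. frechet_derivative F (at (x + t *\<^sub>R ?e)) (h *\<^sub>R ?e))) (at t)"
      by (rule has_derivative_compose[of _ _ _ UNIV F])
        (use diff[of "x + t *\<^sub>R ?e"] in \<open>auto intro!: derivative_eq_intros simp: frechet_derivative_works\<close>)
    moreover have "frechet_derivative F (at (x + t *\<^sub>R ?e)) (h *\<^sub>R ?e) = h * pd i F (x + t *\<^sub>R ?e)" for h
      unfolding pd_def using linear_frechet_derivative[OF diff] by (simp add: linear_scale)
    ultimately show ?thesis by (simp add: has_field_derivative_def mult.commute[of _ "pd i F _"])
  qed
  have qlim: "(\<lambda>n. q n x) \<longlonglongrightarrow> pd i F x" for x
  proof -
    have "((\<lambda>h. (F (x + h *\<^sub>R ?e) - F x) / h) \<longlongrightarrow> pd i F x) (at 0)"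
      using line[of x 0] by (simp add: DERIV_def)
    moreover have "filterlim (\<lambda>n. inverse (real (Suc n))) (at 0) sequentially"
      unfolding filterlim_at using LIMSEQ_inverse_real_of_nat by auto
    ultimately show ?thesis unfolding q_def by (rule filterlim_compose)
  qed
  have qb: "norm (q n x) \<le> B * indicator (cball 0 (r + 1)) x" for n x
  proof -
    define h where "h = inverse (real (Suc n))"
    have h: "0 < h" "h \<le> 1" by (auto simp: h_def field_simps)
    obtain t where t: "0 < t" "t < h" "F (x + h *\<^sub>R ?e) - F (x + 0 *\<^sub>R ?e) = (h - 0) * pd i F (x + t *\<^sub>R ?e)"
      using MVT2[OF h(1) line] by auto
    then have q: "q n x = pd i F (x + t *\<^sub>R ?e)" unfolding q_def h_def[symmetric] using h by simp
    show ?thesis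
    proof (cases "x \<in> cball 0 (r + 1)")
      case True then show ?thesis using B q by simp
    next
      case False
      have "norm x \<le> norm (x + t *\<^sub>R ?e) + norm (t *\<^sub>R ?e)"
        using norm_triangle_ineq4[of "x + t *\<^sub>R ?e" "t *\<^sub>R ?e"] by simp
      then have "x + t *\<^sub>R ?e \<notin> K" using False t h r by (auto simp: norm_axis_1)
      then show ?thesis using q out(2) False by simp
    qed
  qed
  have "(\<lambda>n. LINT x|lborel. q n x) \<longlonglongrightarrow> (LINT x|lborel. pd i F x)"
  proof (rule integral_dominated_convergence[where w = "\<lambda>x. B * indicator (cball 0 (r + 1)) x"])
    show "integrable lborel (\<lambda>x::point. B * indicator (cball 0 (r + 1)) x)"
      using emeasure_bounded_finite[of "cball (0::point) (r+1)"] by auto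
    show "q n \<in> borel_measurable lborel" for n
      unfolding q_def[abs_def] using Fm by measurable
  qed (use pdm qlim qb in \<open>auto intro!: AE_I2\<close>)
  moreover have "(LINT x|lborel. q n x) = 0" for n
  proof -
    let ?c = "inverse (real (Suc n)) *\<^sub>R ?e"
    have "(LINT x|lborel. F x) = (LINT x|distr lborel borel ((+) ?c). F x)"
      by (simp add: lborel_distr_plus)
    also have "\<dots> = (LINT x|lborel. F (?c + x))"
      using Fm by (intro integral_distr) auto
    finally have e: "(LINT x|lborel. F x) = (LINT x|lborel. F (x + ?c))" by (simp add: add.commute)
    have "integrable (distr lborel borel ((+) ?c)) F" using Fint by (simp add: lborel_distr_plus)
    then have "integrable lborel (\<lambda>x. F (x + ?c))"
      using Fm by (subst (asm) integrable_distr_eq) (auto simp: add.commute)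
    then show ?thesis using e Fint by (simp add: q_def)
  qed
  ultimately have "(LINT x|lborel. pd i F x) = 0" by (simp add: LIMSEQ_const_iff)
  moreover have "(LINT x|lebesgue_on \<Omega>. pd i F x) = (LINT x|lebesgue. indicator \<Omega> x *\<^sub>R pd i F x)"
    using meas_\<Omega> by (intro integral_restrict_space) auto
  moreover have "(\<lambda>x. indicator \<Omega> x *\<^sub>R pd i F x) = pd i F"
    using K(2) out(2) by (auto simp: indicator_def fun_eq_iff)
  moreover have "(LINT x|lebesgue. pd i F x) = (LINT x|lborel. pd i F x)"
    using pdm by (intro integral_completion) auto
  ultimately show ?thesis by simp
qed

text \<open>The space \<open>H10\<close> is defined through \<open>H1_norm \<Omega> (\<lambda>x. w x - \<phi> x)\<close>, which is meaningful only if
  test functions have weak gradients.\<close>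
lemma weak_gradient_test_function:
  assumes \<phi>: "\<phi> \<in> test_functions \<Omega>"
  shows "weak_gradient \<Omega> \<phi> (grad \<phi>)"
  unfolding weak_gradient_def
proof (intro conjI allI ballI)
  fix i
  show "(\<lambda>x. grad \<phi> x $ i) \<in> L2 \<Omega>" using test_function_L2[OF \<phi>] by (simp add: grad_def)
  fix \<psi> assume \<psi>: "\<psi> \<in> test_functions \<Omega>"
  define K where "K = closure {x. \<phi> x \<noteq> 0}"
  have K: "compact K" "K \<subseteq> \<Omega>" using \<phi> by (auto simp: test_functions_def K_def)
  note c = test_function_continuous[OF \<phi>] test_function_continuous[OF \<psi>]
  have p: "pd i (\<lambda>x. \<phi> x * \<psi> x) = (\<lambda>x. \<phi> x * pd i \<psi> x + pd i \<phi> x * \<psi> x)"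
    using pd_mult c by auto
  have out: "\<phi> x = 0" "pd i \<phi> x = 0" if "x \<notin> K" for x
    using test_function_outside[OF \<phi> that[unfolded K_def]] .
  have "(LINT x|lebesgue_on \<Omega>. pd i (\<lambda>x. \<phi> x * \<psi> x) x) = 0"
    by (rule integral_pd_eq_0[OF K])
      (use out c p in \<open>auto intro!: continuous_intros\<close>)
  then have "(LINT x|lebesgue_on \<Omega>. \<phi> x * pd i \<psi> x) + (LINT x|lebesgue_on \<Omega>. pd i \<phi> x * \<psi> x) = 0"
    unfolding p using L2_mult_integrable test_function_L2 \<phi> \<psi> by simp
  then show "(LINT x|lebesgue_on \<Omega>. \<phi> x * pd i \<psi> x) = - (LINT x|lebesgue_on \<Omega>. grad \<phi> x $ i * \<psi> x)"
    by (simp add: grad_def)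
qed

lemma test_function_H1: "\<phi> \<in> test_functions \<Omega> \<Longrightarrow> \<phi> \<in> H1 \<Omega>"
  using weak_gradient_test_function test_function_L2 by (auto simp: H1_def)

lemma test_function_lincomb:
  assumes "\<phi> \<in> test_functions \<Omega>" "\<psi> \<in> test_functions \<Omega>"
  shows "(\<lambda>x. \<alpha> * \<phi> x + \<beta> * \<psi> x) \<in> test_functions \<Omega>"
proof -
  have "closure {x. \<alpha> * \<phi> x + \<beta> * \<psi> x \<noteq> 0} \<subseteq> closure ({x. \<phi> x \<noteq> 0} \<union> {x. \<psi> x \<noteq> 0})"
    by (intro closure_mono) auto
  then have s: "closure {x. \<alpha> * \<phi> x + \<beta> * \<psi> x \<noteq> 0} \<subseteq> closure {x. \<phi> x \<noteq> 0} \<union> closure {x. \<psi> x \<noteq> 0}"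
    by (simp add: closure_Un)
  moreover have "compact (closure {x. \<phi> x \<noteq> 0} \<union> closure {x. \<psi> x \<noteq> 0})"
    using assms by (auto simp: test_functions_def)
  ultimately have "compact (closure {x. \<alpha> * \<phi> x + \<beta> * \<psi> x \<noteq> 0})"
    using s unfolding compact_eq_bounded_closed by (blast intro: bounded_subset)
  then show ?thesis using assms s C_k_lincomb by (auto simp: test_functions_def)
qed

lemma H1_norm_sq: "(H1_norm \<Omega> w)\<^sup>2 = (LINT x|lebesgue_on \<Omega>. (w x)\<^sup>2) + dirichlet w w"
  unfolding H1_norm_def using dirichlet_nonneg[of w] by (simp add: H1_seminorm_sq integral_nonneg_AE)

text \<open>The nonnegativity of the quadratic form at \<open>\<alpha> w - \<beta> v\<close>, a cheap substitute for the triangle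
  inequality that suffices for passing to limits.\<close>
lemma H1_norm_lincomb:
  assumes "w \<in> H1 \<Omega>" "v \<in> H1 \<Omega>"
  shows "(H1_norm \<Omega> (\<lambda>x. \<alpha> * w x + \<beta> * v x))\<^sup>2
    \<le> 2 * \<alpha>\<^sup>2 * (H1_norm \<Omega> w)\<^sup>2 + 2 * \<beta>\<^sup>2 * (H1_norm \<Omega> v)\<^sup>2"
proof -
  have L2: "w \<in> L2 \<Omega>" "v \<in> L2 \<Omega>" "(\<lambda>x. \<alpha> * w x + \<beta> * v x) \<in> L2 \<Omega>"
    using assms L2_lincomb by (auto simp: H1_def)
  have "(LINT x|lebesgue_on \<Omega>. (\<alpha> * w x + \<beta> * v x)\<^sup>2)
      \<le> (LINT x|lebesgue_on \<Omega>. 2 * \<alpha>\<^sup>2 * (w x)\<^sup>2 + 2 * \<beta>\<^sup>2 * (v x)\<^sup>2)"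
  proof (rule integral_mono)
    show "(\<alpha> * w x + \<beta> * v x)\<^sup>2 \<le> 2 * \<alpha>\<^sup>2 * (w x)\<^sup>2 + 2 * \<beta>\<^sup>2 * (v x)\<^sup>2" for x
      using zero_le_power2[of "\<alpha> * w x - \<beta> * v x"] by (simp add: power2_eq_square algebra_simps)
  qed (use L2 in \<open>auto simp: L2_def\<close>)
  also have "\<dots> = 2 * \<alpha>\<^sup>2 * (LINT x|lebesgue_on \<Omega>. (w x)\<^sup>2) + 2 * \<beta>\<^sup>2 * (LINT x|lebesgue_on \<Omega>. (v x)\<^sup>2)"
    using L2 by (simp add: L2_def)
  finally have 1: "(LINT x|lebesgue_on \<Omega>. (\<alpha> * w x + \<beta> * v x)\<^sup>2) \<le>
    2 * \<alpha>\<^sup>2 * (LINT x|lebesgue_on \<Omega>. (w x)\<^sup>2) + 2 * \<beta>\<^sup>2 * (LINT x|lebesgue_on \<Omega>. (v x)\<^sup>2)" .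
  have "0 \<le> dirichlet (\<lambda>x. \<alpha> * w x + (- \<beta>) * v x) (\<lambda>x. \<alpha> * w x + (- \<beta>) * v x)"
    by (rule dirichlet_nonneg)
  then have "dirichlet (\<lambda>x. \<alpha> * w x + \<beta> * v x) (\<lambda>x. \<alpha> * w x + \<beta> * v x) \<le>
     2 * \<alpha>\<^sup>2 * dirichlet w w + 2 * \<beta>\<^sup>2 * dirichlet v v"
    unfolding dirichlet_lincomb_self[OF assms] by (simp add: algebra_simps)
  with 1 show ?thesis unfolding H1_norm_sq by (simp add: algebra_simps)
qed

lemma H10_H1: "w \<in> H10 \<Omega> \<Longrightarrow> w \<in> H1 \<Omega>"
  by (simp add: H10_def)

lemma H10_lincomb:
  assumes "w \<in> H10 \<Omega>" "v \<in> H10 \<Omega>"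
  shows "(\<lambda>x. \<alpha> * w x + \<beta> * v x) \<in> H10 \<Omega>"
proof -
  obtain \<phi> \<psi> :: "nat \<Rightarrow> func" where \<phi>: "\<And>n. \<phi> n \<in> test_functions \<Omega>"
      "(\<lambda>n. H1_norm \<Omega> (\<lambda>x. w x - \<phi> n x)) \<longlonglongrightarrow> 0"
    and \<psi>: "\<And>n. \<psi> n \<in> test_functions \<Omega>" "(\<lambda>n. H1_norm \<Omega> (\<lambda>x. v x - \<psi> n x)) \<longlonglongrightarrow> 0"
    using assms unfolding H10_def by blast
  have H1: "w \<in> H1 \<Omega>" "v \<in> H1 \<Omega>" using assms H10_H1 by auto
  let ?d = "\<lambda>n. H1_norm \<Omega> (\<lambda>x. (\<alpha> * w x + \<beta> * v x) - (\<alpha> * \<phi> n x + \<beta> * \<psi> n x))"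
  let ?u = "\<lambda>n. 2 * \<alpha>\<^sup>2 * (H1_norm \<Omega> (\<lambda>x. w x - \<phi> n x))\<^sup>2 + 2 * \<beta>\<^sup>2 * (H1_norm \<Omega> (\<lambda>x. v x - \<psi> n x))\<^sup>2"
  have "(?d n)\<^sup>2 \<le> ?u n" for n
  proof -
    have "(\<lambda>x. w x - \<phi> n x) \<in> H1 \<Omega>" "(\<lambda>x. v x - \<psi> n x) \<in> H1 \<Omega>"
      using H1_lincomb[OF H1(1) test_function_H1[OF \<phi>(1)], of 1 "-1"]
        H1_lincomb[OF H1(2) test_function_H1[OF \<psi>(1)], of 1 "-1"] by simp_all
    moreover have "(\<lambda>x. \<alpha> * (w x - \<phi> n x) + \<beta> * (v x - \<psi> n x))
        = (\<lambda>x. (\<alpha> * w x + \<beta> * v x) - (\<alpha> * \<phi> n x + \<beta> * \<psi> n x))"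
      by (simp add: fun_eq_iff algebra_simps)
    ultimately show ?thesis using H1_norm_lincomb[of "\<lambda>x. w x - \<phi> n x" "\<lambda>x. v x - \<psi> n x" \<alpha> \<beta>]
      by (simp only:)
  qed
  moreover have "?u \<longlonglongrightarrow> 2 * \<alpha>\<^sup>2 * 0\<^sup>2 + 2 * \<beta>\<^sup>2 * 0\<^sup>2"
    by (intro tendsto_intros \<phi> \<psi>)
  ultimately have "(\<lambda>n. (?d n)\<^sup>2) \<longlonglongrightarrow> 0"
    by (intro real_tendsto_sandwich[of "\<lambda>_. 0" "\<lambda>n. (?d n)\<^sup>2" sequentially ?u 0]) simp_all
  from tendsto_real_sqrt[OF this] have "(\<lambda>n. \<bar>?d n\<bar>) \<longlonglongrightarrow> 0" by simp
  then have "?d \<longlonglongrightarrow> 0" by (rule tendsto_rabs_zero_cancel)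
  moreover have "(\<lambda>x. \<alpha> * \<phi> n x + \<beta> * \<psi> n x) \<in> test_functions \<Omega>" for n
    using test_function_lincomb \<phi> \<psi> by auto
  ultimately show ?thesis unfolding H10_def mem_Collect_eq using H1_lincomb[OF H1]
    by (intro conjI exI[of _ "\<lambda>n x. \<alpha> * \<phi> n x + \<beta> * \<psi> n x"] allI)
qed

text \<open>Minimality along the line through \<open>U\<close> in direction \<open>U - w\<close> forces \<open>u - U\<close> to be orthogonal
  to that direction. This is Galerkin orthogonality.\<close>
lemma best_approximation_pythagoras:
  assumes V: "V \<subseteq> H1 \<Omega>" "\<And>w v \<alpha> \<beta>. w \<in> V \<Longrightarrow> v \<in> V \<Longrightarrow> (\<lambda>x. \<alpha> * w x + \<beta> * v x) \<in> V"
    and u: "u \<in> H1 \<Omega>" and U: "best_approximation \<Omega> V u U" and w: "w \<in> V"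
  shows "(H1_seminorm \<Omega> (\<lambda>x. u x - w x))\<^sup>2
    = (H1_seminorm \<Omega> (\<lambda>x. u x - U x))\<^sup>2 + (H1_seminorm \<Omega> (\<lambda>x. U x - w x))\<^sup>2"
proof -
  have UV: "U \<in> V" using U by (simp add: best_approximation_def)
  let ?e = "\<lambda>x. u x - U x" and ?z = "\<lambda>x. U x - w x"
  have z: "?z \<in> V" using V(2)[OF UV w, of 1 "-1"] by simp
  have e1: "?e \<in> H1 \<Omega>" using H1_lincomb[OF u, of U 1 "-1"] UV V(1) by auto
  have z1: "?z \<in> H1 \<Omega>" using z V(1) by auto
  define a where "a = dirichlet ?e ?z"
  define b where "b = dirichlet ?z ?z"
  have b: "b \<ge> 0" by (simp add: b_def dirichlet_nonneg)
  have *: "2 * t * a \<le> t\<^sup>2 * b" for t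
  proof -
    have "(\<lambda>x. 1 * U x + t * ?z x) \<in> V" using V(2)[OF UV z, of 1 t] by simp
    then have "H1_seminorm \<Omega> ?e \<le> H1_seminorm \<Omega> (\<lambda>x. u x - (1 * U x + t * ?z x))"
      using U by (simp add: best_approximation_def)
    moreover have "(\<lambda>x. u x - (1 * U x + t * ?z x)) = (\<lambda>x. 1 * ?e x + (- t) * ?z x)" by auto
    moreover have "0 \<le> H1_seminorm \<Omega> ?e" unfolding H1_seminorm_def by (simp add: integral_nonneg_AE)
    ultimately have "(H1_seminorm \<Omega> ?e)\<^sup>2 \<le> (H1_seminorm \<Omega> (\<lambda>x. 1 * ?e x + (- t) * ?z x))\<^sup>2"
      by (intro power_mono) (simp_all only:)
    then show ?thesis
      unfolding H1_seminorm_sq dirichlet_lincomb_self[OF e1 z1] by (simp add: a_def b_def)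
  qed
  have "a = 0"
  proof (rule ccontr)
    assume "a \<noteq> 0"
    \<comment> \<open>minimises the quadratic up to the shift by 1, which allows for \<open>b = 0\<close>\<close>
    define t where "t = a / (b + 1)"
    have a: "a = t * (b + 1)" using b by (simp add: t_def)
    then have a2: "t\<^sup>2 > 0" using \<open>a \<noteq> 0\<close> by auto
    have "t\<^sup>2 * (b + 2) \<le> 0" using *[of t] by (simp add: a power2_eq_square algebra_simps)
    then show False using a2 b by (simp add: mult_le_0_iff)
  qed
  moreover have "(\<lambda>x. u x - w x) = (\<lambda>x. 1 * ?e x + 1 * ?z x)" by auto
  ultimately show ?thesis
    using dirichlet_lincomb_self[OF e1 z1, of 1 1] unfolding H1_seminorm_sq a_def by simp
qed

text \<open>The weak solution for the zero right-hand side has zero energy, hence is invisible to the seminorm.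
  Efficiency for that right-hand side therefore bounds the estimator of any discrete function by its
  own seminorm.\<close>
lemma H1_seminorm_minus_weak_solution_0:
  assumes "weak_solution \<Omega> (\<lambda>x. 0) u" "w \<in> H1 \<Omega>"
  shows "H1_seminorm \<Omega> (\<lambda>x. u x - w x) = H1_seminorm \<Omega> w"
proof -
  have u: "u \<in> H10 \<Omega>" "dirichlet u v = 0" if "v \<in> H10 \<Omega>" for v
    using assms that by (auto simp: weak_solution_def dirichlet_def)
  have uH: "u \<in> H1 \<Omega>" and uu: "dirichlet u u = 0"
    using assms u H10_H1 by (auto simp: weak_solution_def)
  have uw: "dirichlet u w = 0"
  proof -
    have *: "0 \<le> 2 * t * dirichlet u w + dirichlet w w" for t
      using dirichlet_nonneg[of "\<lambda>x. t * u x + 1 * w x"] uu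
      unfolding dirichlet_lincomb_self[OF uH assms(2)] by simp
    show ?thesis
    proof (rule ccontr)
      assume "dirichlet u w \<noteq> 0"
      then have "2 * (- (dirichlet w w + 1) / (2 * dirichlet u w)) * dirichlet u w = - (dirichlet w w + 1)"
        by (simp add: divide_simps)
      then show False using *[of "- (dirichlet w w + 1) / (2 * dirichlet u w)"] by linarith
    qed
  qed
  have "(H1_seminorm \<Omega> (\<lambda>x. u x - w x))\<^sup>2 = (H1_seminorm \<Omega> w)\<^sup>2"
    using dirichlet_lincomb_self[OF uH assms(2), of 1 "-1"] uu uw by (simp add: H1_seminorm_sq)
  moreover have "0 \<le> H1_seminorm \<Omega> v" for v unfolding H1_seminorm_def by (simp add: integral_nonneg_AE)
  ultimately show ?thesis by (simp add: power2_eq_iff_nonneg)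
qed

end

section \<open>Polynomials on the plane\<close>

lemma polys_lincomb:
  assumes "q \<in> polys n" "q' \<in> polys n"
  shows "(\<lambda>x. \<alpha> * q x + \<beta> * q' x) \<in> polys n"
proof -
  obtain c c' where c: "\<And>x. q x = (\<Sum>i\<le>n. \<Sum>j\<le>n - i. c i j * (x $ 1) ^ i * (x $ 2) ^ j)"
    "\<And>x. q' x = (\<Sum>i\<le>n. \<Sum>j\<le>n - i. c' i j * (x $ 1) ^ i * (x $ 2) ^ j)"
    using assms unfolding polys_def by auto
  show ?thesis unfolding polys_def mem_Collect_eq
    by (rule exI[of _ "\<lambda>i j. \<alpha> * c i j + \<beta> * c' i j"])
      (simp add: c sum.distrib sum_distrib_left algebra_simps)
qed

lemma zero_in_polys: "(\<lambda>x. 0) \<in> polys n"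
  unfolding polys_def by (auto intro!: exI[of _ "\<lambda>i j. 0"])

lemma polys_real_polynomial_function:
  assumes "q \<in> polys n"
  shows "real_polynomial_function q"
proof -
  obtain c where c: "q = (\<lambda>x. \<Sum>i\<le>n. \<Sum>j\<le>n - i. c i j * (x $ 1) ^ i * (x $ 2) ^ j)"
    using assms unfolding polys_def by auto
  show ?thesis unfolding c
    by (intro real_polynomial_function_sum finite_atMost real_polynomial_function.intros(2,4)
        real_polynomial_function_power real_polynomial_function.intros(1) bounded_linear_vec_nth)
qed

lemma real_polynomial_function_pd:
  fixes q :: func
  assumes "real_polynomial_function q"
  shows "(\<forall>x. q differentiable (at x)) \<and> (\<forall>i. real_polynomial_function (pd i q))"
  using assms
proof (induction q rule: real_polynomial_function.induct)
  case (linear f)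
  have "pd i f = (\<lambda>x. f (axis i 1))" for i
    using pd_eqI[OF bounded_linear_imp_has_derivative[OF linear]] by auto
  then show ?case
    using bounded_linear_imp_differentiable[OF linear] by auto
next
  case (const c)
  have "pd i (\<lambda>x. c) = (\<lambda>x. 0)" for i
    by (rule ext, rule pd_eqI[where w' = "\<lambda>h. 0"], rule has_derivative_const)
  then show ?case by auto
next
  case (add f g)
  have "pd i (\<lambda>x. f x + g x) = (\<lambda>x. 1 * pd i f x + 1 * pd i g x)" for i
    using pd_lincomb[of f _ g i 1 1] add.IH by auto
  then show ?case using add by (auto intro: differentiable_add)
next
  case (mult f g)
  have "pd i (\<lambda>x. f x * g x) = (\<lambda>x. f x * pd i g x + pd i f x * g x)" for i
    using pd_mult[of f _ g i] mult.IH by auto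
  moreover have "real_polynomial_function (\<lambda>x. f x * pd i g x + pd i f x * g x)" for i
    by (intro real_polynomial_function.intros(3,4)) (use mult in auto)
  ultimately show ?case using mult by (auto intro: differentiable_mult)
qed

lemma real_polynomial_function_continuous:
  fixes q :: func
  assumes "real_polynomial_function q"
  shows "continuous_on S q"
  using assms real_polynomial_function_pd
  by (intro continuous_at_imp_continuous_on ballI differentiable_imp_continuous_within) auto

lemma real_polynomial_function_laplacian:
  "real_polynomial_function q \<Longrightarrow> real_polynomial_function (laplacian q)"
  unfolding laplacian_def[abs_def]
  by (intro real_polynomial_function_sum finite_class.finite_UNIV) (simp add: real_polynomial_function_pd)

text \<open>On the line joining \<open>y\<close> to a point of \<open>S\<close> the function is a univariate polynomial with infinitely
  many zeros.\<close>
lemma real_polynomial_function_eq_0: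
  fixes q :: func
  assumes q: "real_polynomial_function q" and S: "open S" "S \<noteq> {}" and 0: "\<And>x. x \<in> S \<Longrightarrow> q x = 0"
  shows "q y = 0"
proof -
  obtain x0 where x0: "x0 \<in> S" using S by auto
  let ?l = "\<lambda>t::real. x0 + t *\<^sub>R (y - x0)"
  have "polynomial_function ?l"
    by (intro polynomial_function_add polynomial_function_mult polynomial_function_id polynomial_function_const)
  then have "real_polynomial_function (q \<circ> ?l)" by (rule real_polynomial_function_compose) (rule q)
  then obtain a n where a: "q \<circ> ?l = (\<lambda>t. \<Sum>i\<le>n. a i * t ^ i)"
    using real_polynomial_function_imp_sum by blast
  have a': "q (?l t) = (\<Sum>i\<le>n. a i * t ^ i)" for t using fun_cong[OF a, of t] by simp
  have "open (?l -` S)"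
    by (intro open_vimage S continuous_intros)
  moreover have "0 \<in> ?l -` S" using x0 by simp
  ultimately obtain e where e: "e > 0" "ball 0 e \<subseteq> ?l -` S" unfolding open_contains_ball by blast
  have "ball 0 e \<subseteq> {t. (\<Sum>i\<le>n. a i * t ^ i) = 0}" using e(2) 0 by (auto simp: subset_iff a'[symmetric])
  moreover have "infinite (ball (0::real) e)" using e(1) by (simp add: ball_eq_greaterThanLessThan)
  ultimately have "infinite {t. (\<Sum>i\<le>n. a i * t ^ i) = 0}" using finite_subset by blast
  then have "\<forall>i\<le>n. a i = 0" unfolding Transcendental.polyfun_finite_roots by auto
  then show ?thesis using a'[of 1] by simp
qed

lemma real_polynomial_function_AE_eq:
  fixes q :: func
  assumes q: "real_polynomial_function q" "real_polynomial_function q'"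
    and T: "T \<in> sets lebesgue" "interior T \<noteq> {}" and ae: "AE x in lebesgue_on T. q x = q' x"
  shows "q = q'"
proof -
  let ?d = "\<lambda>x. q x - q' x"
  have d: "real_polynomial_function ?d" using q by (rule real_polynomial_function_diff)
  let ?S = "interior T \<inter> ?d -` (- {0})"
  have o: "open ?S"
    using continuous_open_preimage[OF real_polynomial_function_continuous[OF d, of "interior T"] open_interior, of "- {0}"]
    by (simp add: open_Compl)
  have "AE x in lebesgue. x \<in> T \<longrightarrow> q x = q' x"
    using ae T(1) by (simp add: AE_restrict_space_iff)
  then obtain N where "N \<in> null_sets lebesgue" "{x. \<not> (x \<in> T \<longrightarrow> q x = q' x)} \<subseteq> N"
    unfolding eventually_ae_filter by auto
  then have "negligible ?S" using interior_subset[of T] unfolding negligible_iff_null_sets[symmetric]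
    by (elim negligible_subset) auto
  then have "?S = {}" using open_not_negligible[OF o] by blast
  then have "?d x = 0" if "x \<in> interior T" for x using that by auto
  then have "?d x = 0" for x using real_polynomial_function_eq_0[OF d open_interior T(2)] by blast
  then show ?thesis by auto
qed

text \<open>Polynomials that agree almost everywhere on a triangle with interior are equal, so the choice in
  \<open>piece\<close> is determined. In particular it is the same polynomial on a triangle and on its
  descendants.\<close>
lemma piece_eqI:
  assumes "q \<in> polys n" "AE x in lebesgue_on (hl K). w x = q x"
    and T: "hl K \<in> sets lebesgue" "interior (hl K) \<noteq> {}"
  shows "piece w K = q"
proof -
  have "(\<exists>n. piece w K \<in> polys n) \<and> (AE x in lebesgue_on (hl K). w x = piece w K x)"
    unfolding piece_def by (rule someI[of _ q]) (use assms in auto)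
  then obtain m where m: "piece w K \<in> polys m" and ae: "AE x in lebesgue_on (hl K). w x = piece w K x"
    by auto
  have "AE x in lebesgue_on (hl K). piece w K x = q x"
    using ae assms(2) by eventually_elim simp
  then show ?thesis
    by (intro real_polynomial_function_AE_eq[OF _ _ T] polys_real_polynomial_function[OF m]
        polys_real_polynomial_function[OF assms(1)])
qed

section \<open>Triangles in barycentric coordinates\<close>

text \<open>The planar cross product: twice the signed area of the triangle spanned by the two vectors.\<close>
definition cr :: "point \<Rightarrow> point \<Rightarrow> real" where
  "cr x y = x $ 1 * y $ 2 - x $ 2 * y $ 1"

lemma collinear_iff_cr: "collinear {c, a, b} \<longleftrightarrow> cr (a - c) (b - c) = 0"
proof -
  have "cr x y = 0 \<longleftrightarrow> x = 0 \<or> y = 0 \<or> (\<exists>t. y = t *\<^sub>R x)" for x y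
  proof
    assume 0: "cr x y = 0"
    show "x = 0 \<or> y = 0 \<or> (\<exists>t. y = t *\<^sub>R x)"
    proof (cases "x $ 1 = 0")
      case False
      then have "y = (y $ 1 / x $ 1) *\<^sub>R x"
        using 0 by (simp add: vec_eq_iff forall_2 cr_def field_simps)
      then show ?thesis by blast
    next
      case True
      show ?thesis
      proof (cases "x $ 2 = 0")
        case False
        then have "y = (y $ 2 / x $ 2) *\<^sub>R x"
          using 0 True by (simp add: vec_eq_iff forall_2 cr_def field_simps)
        then show ?thesis by blast
      next
        case True
        with \<open>x $ 1 = 0\<close> have "x = 0" by (simp add: vec_eq_iff forall_2)
        then show ?thesis by simp
      qed
    qed
  qed (auto simp: cr_def)
  moreover have "collinear {c, a, b} \<longleftrightarrow> collinear {0, a - c, b - c}"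
    using collinear_3[of a c b] by (simp add: insert_commute NO_MATCH_def)
  ultimately show ?thesis by (simp add: collinear_lemma)
qed

text \<open>The barycentric coordinate of \<open>x\<close> that belongs to the vertex \<open>c\<close> of the triangle \<open>c a b\<close>.\<close>
definition bc :: "point \<Rightarrow> point \<Rightarrow> point \<Rightarrow> point \<Rightarrow> real" where
  "bc c a b x = cr (a - x) (b - x) / cr (a - c) (b - c)"

lemma bc_cyclic:
  "bc a b c x = cr (b - x) (c - x) / cr (a - c) (b - c)"
  "bc b c a x = cr (c - x) (a - x) / cr (a - c) (b - c)"
  by (simp_all add: bc_def cr_def algebra_simps)

lemma bc_eval:
  assumes "cr (a - c) (b - c) \<noteq> 0" "\<alpha> + \<beta> + \<gamma> = 1" "x = \<alpha> *\<^sub>R c + \<beta> *\<^sub>R a + \<gamma> *\<^sub>R b"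
  shows "bc c a b x = \<alpha>" "bc a b c x = \<beta>" "bc b c a x = \<gamma>"
proof -
  have \<alpha>: "\<alpha> = 1 - \<beta> - \<gamma>" using assms(2) by simp
  have "cr (a - x) (b - x) = \<alpha> * cr (a - c) (b - c)" "cr (b - x) (c - x) = \<beta> * cr (a - c) (b - c)"
    "cr (c - x) (a - x) = \<gamma> * cr (a - c) (b - c)"
    unfolding assms(3) \<alpha> cr_def by (simp_all add: algebra_simps)
  then show "bc c a b x = \<alpha>" "bc a b c x = \<beta>" "bc b c a x = \<gamma>"
    unfolding bc_cyclic(1)[of a b c] bc_cyclic(2)[of b c a] bc_def[of c a b] using assms(1) by simp_all
qed

lemma bc_repr:
  assumes "cr (a - c) (b - c) \<noteq> 0"
  shows "bc c a b x + bc a b c x + bc b c a x = 1"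
    "x = bc c a b x *\<^sub>R c + bc a b c x *\<^sub>R a + bc b c a x *\<^sub>R b"
proof -
  let ?D = "cr (a - c) (b - c)"
  note e = bc_def[of c a b x] bc_cyclic(1)[of a b c x] bc_cyclic(2)[of b c a x]
  have "cr (a - x) (b - x) + cr (b - x) (c - x) + cr (c - x) (a - x) = ?D"
    by (simp add: cr_def algebra_simps)
  then show s: "bc c a b x + bc a b c x + bc b c a x = 1"
    unfolding e using assms by (simp add: add_divide_distrib[symmetric])
  have "?D * x $ i = cr (a - x) (b - x) * c $ i + cr (b - x) (c - x) * a $ i + cr (c - x) (a - x) * b $ i" for i
    using exhaust_2[of i] by (elim disjE) (simp_all add: cr_def algebra_simps)
  then have "x $ i = (cr (a - x) (b - x) * c $ i + cr (b - x) (c - x) * a $ i + cr (c - x) (a - x) * b $ i) / ?D" for i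
    using assms by (simp add: field_simps)
  then show "x = bc c a b x *\<^sub>R c + bc a b c x *\<^sub>R a + bc b c a x *\<^sub>R b"
    unfolding e vec_eq_iff by (simp add: add_divide_distrib)
qed

lemma bc_in_hull_iff:
  assumes "cr (a - c) (b - c) \<noteq> 0"
  shows "x \<in> convex hull {c, a, b} \<longleftrightarrow> 0 \<le> bc c a b x \<and> 0 \<le> bc a b c x \<and> 0 \<le> bc b c a x"
proof
  assume "x \<in> convex hull {c, a, b}"
  then obtain \<alpha> \<beta> \<gamma> where "0 \<le> \<alpha>" "0 \<le> \<beta>" "0 \<le> \<gamma>" "\<alpha> + \<beta> + \<gamma> = 1" "x = \<alpha> *\<^sub>R c + \<beta> *\<^sub>R a + \<gamma> *\<^sub>R b"
    unfolding convex_hull_3 by blast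
  then show "0 \<le> bc c a b x \<and> 0 \<le> bc a b c x \<and> 0 \<le> bc b c a x" using bc_eval[OF assms] by metis
next
  assume "0 \<le> bc c a b x \<and> 0 \<le> bc a b c x \<and> 0 \<le> bc b c a x"
  then show "x \<in> convex hull {c, a, b}" unfolding convex_hull_3 using bc_repr[OF assms, of x] by blast
qed

lemma bc_in_interior_iff:
  assumes "cr (a - c) (b - c) \<noteq> 0"
  shows "x \<in> interior (convex hull {c, a, b}) \<longleftrightarrow> 0 < bc c a b x \<and> 0 < bc a b c x \<and> 0 < bc b c a x"
proof -
  have i: "interior (convex hull {c, a, b}) =
      {v. \<exists>x y z. 0 < x \<and> 0 < y \<and> 0 < z \<and> x + y + z = 1 \<and> x *\<^sub>R c + y *\<^sub>R a + z *\<^sub>R b = v}"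
    using assms by (intro interior_convex_hull_3_minimal) (simp_all add: collinear_iff_cr)
  show ?thesis
  proof
    assume "x \<in> interior (convex hull {c, a, b})"
    then obtain \<alpha> \<beta> \<gamma> where "0 < \<alpha>" "0 < \<beta>" "0 < \<gamma>" "\<alpha> + \<beta> + \<gamma> = 1" "x = \<alpha> *\<^sub>R c + \<beta> *\<^sub>R a + \<gamma> *\<^sub>R b"
      unfolding i by blast
    then show "0 < bc c a b x \<and> 0 < bc a b c x \<and> 0 < bc b c a x" using bc_eval[OF assms] by metis
  next
    assume "0 < bc c a b x \<and> 0 < bc a b c x \<and> 0 < bc b c a x"
    then show "x \<in> interior (convex hull {c, a, b})" unfolding i mem_Collect_eq
      using bc_repr[OF assms, of x] by metis
  qed
qed

lemma bc_in_edge: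
  assumes "cr (a - c) (b - c) \<noteq> 0" "x \<in> convex hull {a, b}"
  shows "bc c a b x = 0"
proof -
  obtain \<beta> \<gamma> where "\<beta> + \<gamma> = 1" "x = \<beta> *\<^sub>R a + \<gamma> *\<^sub>R b"
    using assms(2) unfolding convex_hull_2 by blast
  then show ?thesis using bc_eval(1)[OF assms(1), of 0 \<beta> \<gamma> x] by simp
qed

lemma area_triangle: "measure lebesgue (convex hull {c, a, b}) = \<bar>cr (a - c) (b - c)\<bar> / 2"
proof -
  have "compact (convex hull {c, a, b})" by (intro finite_imp_compact_convex_hull) simp
  then have "convex hull {c, a, b} \<in> sets borel" by (simp add: borel_compact)
  then have "measure lebesgue (convex hull {c, a, b}) = measure lborel (convex hull {c, a, b})" by simp
  also have "\<dots> = \<bar>cr (a - c) (b - c)\<bar> / 2"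
    unfolding content_triangle by (simp add: cr_def abs_minus_commute algebra_simps)
  finally show ?thesis .
qed

section \<open>Bisection\<close>

lemma bisect_cr:
  "cr (v - midpoint a b) (a - midpoint a b) = cr (a - v) (b - v) / 2"
  "cr (v - midpoint a b) (b - midpoint a b) = - (cr (a - v) (b - v) / 2)"
  by (simp_all add: cr_def midpoint_def field_simps)

text \<open>The median from \<open>v\<close> is the set where the coordinates of \<open>a\<close> and \<open>b\<close> agree, so the two
  children are separated by comparing these coordinates.\<close>
lemma bisect_bc:
  assumes D: "cr (a - v) (b - v) \<noteq> 0"
  shows "x \<in> convex hull {midpoint a b, v, a} \<longleftrightarrow> 0 \<le> bc v a b x \<and> 0 \<le> bc b v a x \<and> bc b v a x \<le> bc a b v x"
    "x \<in> convex hull {midpoint a b, v, b} \<longleftrightarrow> 0 \<le> bc v a b x \<and> 0 \<le> bc a b v x \<and> bc a b v x \<le> bc b v a x"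
    "x \<in> interior (convex hull {midpoint a b, v, a}) \<longleftrightarrow> 0 < bc v a b x \<and> 0 < bc b v a x \<and> bc b v a x < bc a b v x"
    "x \<in> interior (convex hull {midpoint a b, v, b}) \<longleftrightarrow> 0 < bc v a b x \<and> 0 < bc a b v x \<and> bc a b v x < bc b v a x"
proof -
  define m where "m = midpoint a b"
  have D1: "cr (v - m) (a - m) \<noteq> 0" and D2: "cr (v - m) (b - m) \<noteq> 0"
    using D bisect_cr[of v a b] by (simp_all add: m_def)
  define \<alpha> where "\<alpha> = bc v a b x"
  define \<beta> where "\<beta> = bc a b v x"
  define \<gamma> where "\<gamma> = bc b v a x"
  have x: "x = \<alpha> *\<^sub>R v + \<beta> *\<^sub>R a + \<gamma> *\<^sub>R b" and s: "\<alpha> + \<beta> + \<gamma> = 1"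
    using bc_repr[OF D, of x] by (simp_all add: \<alpha>_def \<beta>_def \<gamma>_def)
  have x1: "x = (2 * \<gamma>) *\<^sub>R m + \<alpha> *\<^sub>R v + (\<beta> - \<gamma>) *\<^sub>R a"
    and x2: "x = (2 * \<beta>) *\<^sub>R m + \<alpha> *\<^sub>R v + (\<gamma> - \<beta>) *\<^sub>R b"
    unfolding x m_def midpoint_def by (simp_all add: algebra_simps)
  have e1: "bc m v a x = 2 * \<gamma>" "bc v a m x = \<alpha>" "bc a m v x = \<beta> - \<gamma>"
    using bc_eval[OF D1 _ x1] s by simp_all
  have e2: "bc m v b x = 2 * \<beta>" "bc v b m x = \<alpha>" "bc b m v x = \<gamma> - \<beta>"
    using bc_eval[OF D2 _ x2] s by simp_all
  show "x \<in> convex hull {midpoint a b, v, a} \<longleftrightarrow> 0 \<le> bc v a b x \<and> 0 \<le> bc b v a x \<and> bc b v a x \<le> bc a b v x"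
    "x \<in> convex hull {midpoint a b, v, b} \<longleftrightarrow> 0 \<le> bc v a b x \<and> 0 \<le> bc a b v x \<and> bc a b v x \<le> bc b v a x"
    "x \<in> interior (convex hull {midpoint a b, v, a}) \<longleftrightarrow> 0 < bc v a b x \<and> 0 < bc b v a x \<and> bc b v a x < bc a b v x"
    "x \<in> interior (convex hull {midpoint a b, v, b}) \<longleftrightarrow> 0 < bc v a b x \<and> 0 < bc a b v x \<and> bc a b v x < bc b v a x"
    unfolding m_def[symmetric] \<alpha>_def[symmetric] \<beta>_def[symmetric] \<gamma>_def[symmetric]
      bc_in_hull_iff[OF D1] bc_in_hull_iff[OF D2] bc_in_interior_iff[OF D1] bc_in_interior_iff[OF D2] e1 e2
    by linarith+
qed

lemma hl_simp: "hl (v, a, b) = convex hull {v, a, b}"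
  by (simp add: hl_def)

lemma children_noncollinear:
  assumes "\<not> collinear (verts K)" "K' \<in> children K"
  shows "\<not> collinear (verts K')"
proof -
  obtain v a b where K: "K = (v, a, b)" by (cases K)
  have "cr (a - v) (b - v) \<noteq> 0" using assms(1) by (simp add: K collinear_iff_cr)
  then have "\<not> collinear {midpoint a b, v, a}" "\<not> collinear {midpoint a b, v, b}"
    unfolding collinear_iff_cr bisect_cr by simp_all
  moreover have "K' = (midpoint a b, v, a) \<or> K' = (midpoint a b, v, b)" using assms(2) by (simp add: K)
  ultimately show ?thesis by (elim disjE) (simp_all only: verts.simps not_False_eq_True)
qed

lemma children_cover:
  assumes "\<not> collinear (verts K)"
  shows "(\<Union>K'\<in>children K. hl K') = hl K"
proof -
  obtain v a b where K: "K = (v, a, b)" by (cases K)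
  have D: "cr (a - v) (b - v) \<noteq> 0" using assms(1) by (simp add: K collinear_iff_cr)
  have "x \<in> (\<Union>K'\<in>children K. hl K') \<longleftrightarrow> x \<in> hl K" for x
    unfolding K children.simps UN_insert UN_empty Un_iff hl_simp bisect_bc[OF D] bc_in_hull_iff[OF D]
    by auto
  then show ?thesis by blast
qed

lemma child_subset:
  assumes "\<not> collinear (verts K)" "K' \<in> children K"
  shows "hl K' \<subseteq> hl K"
  using children_cover[OF assms(1)] assms(2) by auto

lemma children_disjoint:
  assumes "\<not> collinear (verts K)" "K1 \<in> children K" "K2 \<in> children K" "K1 \<noteq> K2"
  shows "interior (hl K1) \<inter> interior (hl K2) = {}"
proof -
  obtain v a b where K: "K = (v, a, b)" by (cases K)
  have D: "cr (a - v) (b - v) \<noteq> 0" using assms(1) by (simp add: K collinear_iff_cr)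
  have "interior (hl (midpoint a b, v, a)) \<inter> interior (hl (midpoint a b, v, b)) = {}"
    unfolding disjoint_iff hl_simp bisect_bc[OF D] by auto
  then show ?thesis using assms(2-4) unfolding K children.simps by auto
qed

lemma child_area:
  assumes "K' \<in> children K"
  shows "measure lebesgue (hl K') = measure lebesgue (hl K) / 2"
proof -
  obtain v a b where K: "K = (v, a, b)" by (cases K)
  have "measure lebesgue (hl (midpoint a b, v, a)) = measure lebesgue (hl (v, a, b)) / 2"
    "measure lebesgue (hl (midpoint a b, v, b)) = measure lebesgue (hl (v, a, b)) / 2"
    unfolding hl_simp area_triangle bisect_cr by simp_all
  then show ?thesis using assms unfolding K children.simps by auto
qed

lemma finite_children: "finite (children K)"
  by (cases K) simp

lemma triangulation_bisect:
  assumes T: "triangulation \<Omega> T" and K: "K \<in> T"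
  shows "triangulation \<Omega> ((T - {K}) \<union> children K)"
proof -
  have nc: "\<not> collinear (verts K)" and fin: "finite T" and cov: "(\<Union>K\<in>T. hl K) = closure \<Omega>"
    and dis: "\<And>K K'. K \<in> T \<Longrightarrow> K' \<in> T \<Longrightarrow> K \<noteq> K' \<Longrightarrow> interior (hl K) \<inter> interior (hl K') = {}"
    and nc': "\<And>K. K \<in> T \<Longrightarrow> \<not> collinear (verts K)"
    using T K unfolding triangulation_def by auto
  have sub: "interior (hl K') \<subseteq> interior (hl K)" if "K' \<in> children K" for K'
    using child_subset[OF nc that] by (rule interior_mono)
  have "interior (hl K1) \<inter> interior (hl K2) = {}"
    if K12: "K1 \<in> (T - {K}) \<union> children K" "K2 \<in> (T - {K}) \<union> children K" "K1 \<noteq> K2" for K1 K2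
  proof -
    consider "K1 \<in> T - {K}" "K2 \<in> T - {K}" | "K1 \<in> T - {K}" "K2 \<in> children K"
      | "K1 \<in> children K" "K2 \<in> T - {K}" | "K1 \<in> children K" "K2 \<in> children K"
      using K12 by blast
    then show ?thesis
    proof cases
      case 1 then show ?thesis using dis K12(3) by simp
    next
      case 2 then show ?thesis using dis[of K1 K] sub[of K2] K by blast
    next
      case 3 then show ?thesis using dis[of K2 K] sub[of K1] K by blast
    next
      case 4 then show ?thesis using children_disjoint[OF nc] K12(3) by simp
    qed
  qed
  moreover have "(\<Union>K'\<in>(T - {K}) \<union> children K. hl K') = closure \<Omega>"
  proof -
    have "(\<Union>K'\<in>(T - {K}) \<union> children K. hl K') = (\<Union>K'\<in>T - {K}. hl K') \<union> hl K"
      using children_cover[OF nc] by auto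
    also have "\<dots> = (\<Union>K'\<in>T. hl K')" using K by auto
    finally show ?thesis using cov by simp
  qed
  ultimately show ?thesis
    unfolding triangulation_def using fin finite_children nc' children_noncollinear[OF nc] by auto
qed

lemma partitions_triangulation:
  assumes "triangulation \<Omega> K0" "T \<in> partitions K0"
  shows "triangulation \<Omega> T"
  using assms(2)
proof (induction T rule: partitions.induct)
  case init
  then show ?case by (rule assms(1))
next
  case (bisect T K)
  show ?case by (rule triangulation_bisect[OF bisect.IH bisect.hyps(2)])
qed

section \<open>Conforming triangulations\<close>

lemma finite_verts: "finite (verts K)" and verts_nonempty: "verts K \<noteq> {}"
  by (cases K; simp)+

lemma hl_compact: "compact (hl K)"
  unfolding hl_def by (intro finite_imp_compact_convex_hull finite_verts)

lemma hl_convex: "convex (hl K)"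
  unfolding hl_def by (rule convex_convex_hull)

lemma hl_closed: "closed (hl K)" using hl_compact by (rule compact_imp_closed)

lemma hl_lebesgue: "hl K \<in> sets lebesgue" using hl_closed by auto

lemma noncollinear_distinct:
  fixes a b c :: point
  assumes "\<not> collinear {c, a, b}"
  shows "c \<noteq> a" "c \<noteq> b" "a \<noteq> b"
  using assms unfolding collinear_iff_cr by (auto simp: cr_def)

lemma interior_hl_nonempty:
  assumes "\<not> collinear (verts K)"
  shows "interior (hl K) \<noteq> {}"
proof -
  obtain v a b where K: "K = (v, a, b)" by (cases K)
  have D: "cr (a - v) (b - v) \<noteq> 0" using assms by (simp add: K collinear_iff_cr)
  have "(1/3) *\<^sub>R v + (1/3) *\<^sub>R a + (1/3) *\<^sub>R b \<in> interior (hl K)"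
    unfolding K hl_simp bc_in_interior_iff[OF D]
    using bc_eval[OF D, of "1/3" "1/3" "1/3" "(1/3) *\<^sub>R v + (1/3) *\<^sub>R a + (1/3) *\<^sub>R b"] by simp
  then show ?thesis by blast
qed

lemma closure_interior_hl:
  assumes "\<not> collinear (verts K)"
  shows "closure (interior (hl K)) = hl K"
  using convex_closure_interior[OF hl_convex interior_hl_nonempty[OF assms]] hl_closed by simp

lemma tri_edges_iff:
  assumes "\<not> collinear (verts K)"
  shows "e \<in> tri_edges K \<longleftrightarrow> e \<subseteq> verts K \<and> card e = 2"
proof -
  obtain v a b where K: "K = (v, a, b)" by (cases K)
  have d: "v \<noteq> a" "v \<noteq> b" "a \<noteq> b"
    using assms noncollinear_distinct[of v a b] by (auto simp: K)
  show ?thesis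
  proof
    assume "e \<in> tri_edges K" then show "e \<subseteq> verts K \<and> card e = 2" using d by (auto simp: K)
  next
    assume e: "e \<subseteq> verts K \<and> card e = 2"
    then obtain p q where "e = {p, q}" "p \<noteq> q" unfolding card_2_iff by blast
    then show "e \<in> tri_edges K" using e by (auto simp: K insert_commute)
  qed
qed

text \<open>Triangles store their vertices relative to the newest one. For statements about an arbitrary edge,
  this lemma brings the edge into a standard position, opposite to the first vertex.\<close>
lemma tri_edge_apex:
  assumes "\<not> collinear (verts K)" "e \<in> tri_edges K"
  obtains c a b where "e = {a, b}" "hl K = convex hull {c, a, b}" "verts K = {c, a, b}" "cr (a - c) (b - c) \<noteq> 0" "a \<noteq> b"
proof -
  obtain v p q where K: "K = (v, p, q)" by (cases K)
  have "\<exists>c a b. e = {a, b} \<and> verts K = {c, a, b}"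
  proof -
    consider "e = {v, p}" | "e = {v, q}" | "e = {p, q}" using assms(2) by (auto simp: K)
    then show ?thesis
    proof cases
      case 1
      moreover have "verts K = {q, v, p}" unfolding K verts.simps by blast
      ultimately show ?thesis by blast
    next
      case 2
      moreover have "verts K = {p, v, q}" unfolding K verts.simps by blast
      ultimately show ?thesis by blast
    next
      case 3
      moreover have "verts K = {v, p, q}" unfolding K verts.simps by blast
      ultimately show ?thesis by blast
    qed
  qed
  then obtain c a b where *: "e = {a, b}" "verts K = {c, a, b}" by blast
  then have "cr (a - c) (b - c) \<noteq> 0" "a \<noteq> b"
    using assms(1) noncollinear_distinct[of c a b] by (auto simp: collinear_iff_cr)
  then show ?thesis using that * by (simp add: hl_def)
qed

text \<open>The vertices are affinely independent, so the faces intersect like their sets of vertices.\<close>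
lemma faces_Int:
  assumes "\<not> collinear (verts K)" "F \<subseteq> verts K" "G \<subseteq> verts K"
  shows "convex hull F \<inter> convex hull G = convex hull (F \<inter> G)"
proof -
  obtain v a b where K: "K = (v, a, b)" by (cases K)
  have "\<not> affine_dependent (verts K)"
    using assms(1) unfolding K verts.simps collinear_3_eq_affine_dependent by simp
  then have "\<not> affine_dependent (F \<union> G)" by (rule affine_independent_subset) (use assms in auto)
  then show ?thesis by (rule convex_hull_Int[symmetric])
qed

lemma hull_le_1:
  assumes "finite F" "x \<in> convex hull F" "y \<in> convex hull F" "x \<noteq> y"
  shows "card F \<ge> 2"
proof (rule ccontr)
  assume "\<not> card F \<ge> 2"
  then consider "card F = 0" | "card F = 1" by linarith
  then show False
  proof cases
    case 1 then show False using assms by simp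
  next
    case 2 then obtain z where "F = {z}" by (rule card_1_singletonE)
    then show False using assms by simp
  qed
qed

lemma edges_meet:
  assumes K: "\<not> collinear (verts K)" "e \<in> tri_edges K" "g \<in> tri_edges K"
    and xy: "x \<noteq> y" "x \<in> convex hull e" "y \<in> convex hull e" "x \<in> convex hull g" "y \<in> convex hull g"
  shows "e = g"
proof -
  have e: "e \<subseteq> verts K" "card e = 2" and g: "g \<subseteq> verts K" "card g = 2"
    using K tri_edges_iff by auto
  have fin: "finite e" "finite g" using e g finite_verts finite_subset by blast+
  have "x \<in> convex hull (e \<inter> g)" "y \<in> convex hull (e \<inter> g)"
    using xy faces_Int[OF K(1) e(1) g(1)] by blast+
  then have "card (e \<inter> g) \<ge> 2" using xy(1) fin by (intro hull_le_1) auto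
  then have "card e \<le> card (e \<inter> g)" "card g \<le> card (e \<inter> g)" using e(2) g(2) by simp_all
  then have "e \<inter> g = e \<and> e \<inter> g = g"
    using card_seteq[OF fin(1) Int_lower1] card_seteq[OF fin(2) Int_lower2] by blast
  then show ?thesis by blast
qed

lemma edge_in_frontier:
  assumes "\<not> collinear (verts K)" "e \<in> tri_edges K"
  shows "convex hull e \<subseteq> frontier (hl K)"
proof
  fix x assume x: "x \<in> convex hull e"
  obtain c a b where *: "e = {a, b}" "hl K = convex hull {c, a, b}" "verts K = {c, a, b}" "cr (a - c) (b - c) \<noteq> 0"
    by (rule tri_edge_apex[OF assms])
  have "bc c a b x = 0" using bc_in_edge[OF *(4)] x *(1) by simp
  then have "x \<notin> interior (hl K)" unfolding *(2) bc_in_interior_iff[OF *(4)] by simp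
  moreover have "x \<in> hl K" using x hull_mono[of e "verts K"] * unfolding hl_def by auto
  ultimately show "x \<in> frontier (hl K)" using hl_closed by (simp add: frontier_def)
qed

lemma isCont_bc: "isCont (bc c a b) x"
  unfolding bc_def[abs_def] cr_def divide_inverse by (intro continuous_intros)

lemma bc_pos_eventually:
  assumes "bc c a b x > 0"
  shows "\<forall>\<^sub>F y in nhds x. bc c a b y > 0"
proof -
  have "(bc c a b \<longlongrightarrow> bc c a b x) (nhds x)"
    using isCont_bc[of x c a b] unfolding isCont_def by (rule tendsto_at_iff_tendsto_nhds[THEN iffD1])
  from order_tendstoD(1)[OF this assms] show ?thesis .
qed

lemma cr_midpoint_line:
  "cr (a - (midpoint a b + \<delta> *\<^sub>R (c - midpoint a b))) (b - (midpoint a b + \<delta> *\<^sub>R (c - midpoint a b)))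
    = \<delta> * cr (a - c) (b - c)"
  by (simp add: cr_def midpoint_def field_simps)

lemma bc_midpoint:
  assumes "cr (a - c) (b - c) \<noteq> 0"
  shows "bc a b c (midpoint a b) = 1/2" "bc b c a (midpoint a b) = 1/2"
  using bc_eval(2,3)[OF assms, of 0 "1/2" "1/2" "midpoint a b"] by (simp_all add: midpoint_def scaleR_right_distrib)

text \<open>Near the midpoint of a side, a triangle contains the half-disc on its own side of the line;
  two triangles on the same side of a common side therefore overlap.\<close>
lemma opposite_sides:
  assumes D: "cr (a - c) (b - c) \<noteq> 0" and D': "cr (a - c') (b - c') \<noteq> 0"
    and dis: "interior (convex hull {c, a, b}) \<inter> interior (convex hull {c', a, b}) = {}"
  shows "cr (a - c) (b - c) * cr (a - c') (b - c') < 0"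
proof (rule ccontr)
  assume "\<not> ?thesis"
  then have pos: "cr (a - c) (b - c) * cr (a - c') (b - c') > 0" using D D'
    by (metis linorder_neqE_linordered_idom mult_eq_0_iff)
  define m where "m = midpoint a b"
  \<comment> \<open>approach the midpoint from the apex: the coordinate of \<open>c\<close> at this point is \<open>\<delta>\<close>\<close>
  define y where "y \<delta> = m + \<delta> *\<^sub>R (c - m)" for \<delta> :: real
  have "(y \<longlongrightarrow> m + 0 *\<^sub>R (c - m)) (at_right 0)"
    unfolding y_def by (intro tendsto_intros)
  then have lim: "filterlim y (nhds m) (at_right 0)" by simp
  have ev: "\<forall>\<^sub>F z in nhds m. bc a b c z > 0 \<and> bc b c a z > 0 \<and> bc a b c' z > 0 \<and> bc b c' a z > 0"
    by (intro eventually_conj bc_pos_eventually) (simp_all add: m_def bc_midpoint D D')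
  have "\<forall>\<^sub>F \<delta> in at_right 0. bc a b c (y \<delta>) > 0 \<and> bc b c a (y \<delta>) > 0 \<and> bc a b c' (y \<delta>) > 0 \<and> bc b c' a (y \<delta>) > 0"
    using filterlim_iff[THEN iffD1, OF lim] ev by blast
  moreover have "\<forall>\<^sub>F \<delta> in at_right 0. \<delta> > (0::real)" by (rule eventually_at_right_less)
  ultimately have "\<forall>\<^sub>F \<delta> in at_right 0. \<delta> > 0 \<and> bc a b c (y \<delta>) > 0 \<and> bc b c a (y \<delta>) > 0 \<and> bc a b c' (y \<delta>) > 0 \<and> bc b c' a (y \<delta>) > 0"
    by (rule eventually_conj[rotated])
  then obtain \<delta> :: real where \<delta>: "\<delta> > 0" "bc a b c (y \<delta>) > 0" "bc b c a (y \<delta>) > 0" "bc a b c' (y \<delta>) > 0" "bc b c' a (y \<delta>) > 0"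
    using eventually_happens'[OF trivial_limit_at_right_real] by blast
  have crd: "cr (a - y \<delta>) (b - y \<delta>) = \<delta> * cr (a - c) (b - c)"
    unfolding y_def m_def by (rule cr_midpoint_line)
  have "bc c a b (y \<delta>) > 0" unfolding bc_def[of c] crd using D \<delta>(1) by simp
  then have "y \<delta> \<in> interior (convex hull {c, a, b})"
    unfolding bc_in_interior_iff[OF D] using \<delta> by simp
  moreover have "cr (a - c) (b - c) / cr (a - c') (b - c') > 0"
    using pos by (simp add: zero_less_divide_iff zero_less_mult_iff)
  then have "\<delta> * (cr (a - c) (b - c) / cr (a - c') (b - c')) > 0" using \<delta>(1) by (rule mult_pos_pos[rotated])
  then have "bc c' a b (y \<delta>) > 0" unfolding bc_def[of c'] crd by simp
  then have "y \<delta> \<in> interior (convex hull {c', a, b})"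
    unfolding bc_in_interior_iff[OF D'] using \<delta> by simp
  ultimately show False using dis by blast
qed

lemma rel_interior_edge:
  assumes D: "cr (a - c) (b - c) \<noteq> 0"
  shows "x \<in> rel_interior (convex hull {a, b}) \<Longrightarrow> bc a b c x > 0 \<and> bc b c a x > 0"
    "midpoint a b \<in> rel_interior (convex hull {a, b})"
proof -
  have ab: "a \<noteq> b" using D noncollinear_distinct[of c a b] by (simp add: collinear_iff_cr)
  have r: "rel_interior (convex hull {a, b}) = {y. \<exists>u. (\<forall>x \<in> {a, b}. 0 < u x) \<and> sum u {a, b} = 1 \<and> sum (\<lambda>x. u x *\<^sub>R x) {a, b} = y}"
    by (rule rel_interior_convex_hull_explicit) simp
  show "bc a b c x > 0 \<and> bc b c a x > 0" if x: "x \<in> rel_interior (convex hull {a, b})"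
  proof -
    obtain u where "0 < u a" "0 < u b" "u a + u b = 1" "u a *\<^sub>R a + u b *\<^sub>R b = x"
      using x ab unfolding r by auto
    then show ?thesis using bc_eval(2,3)[OF D, of 0 "u a" "u b" x] by simp
  qed
  show "midpoint a b \<in> rel_interior (convex hull {a, b})"
    unfolding r mem_Collect_eq
    by (rule exI[of _ "\<lambda>_. 1/2"]) (use ab in \<open>simp add: midpoint_def scaleR_right_distrib\<close>)
qed

text \<open>The half-discs contained in the two triangles fill a disc.\<close>
lemma shared_edge_nbhd:
  assumes D: "cr (a - c) (b - c) \<noteq> 0" and D': "cr (a - c') (b - c') \<noteq> 0"
    and opp: "cr (a - c) (b - c) * cr (a - c') (b - c') < 0"
    and x: "x \<in> rel_interior (convex hull {a, b})"
  shows "x \<in> interior (convex hull {c, a, b} \<union> convex hull {c', a, b})"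
proof -
  have "\<forall>\<^sub>F z in nhds x. bc a b c z > 0 \<and> bc b c a z > 0 \<and> bc a b c' z > 0 \<and> bc b c' a z > 0"
    using rel_interior_edge(1)[OF D x] rel_interior_edge(1)[OF D' x]
    by (intro eventually_conj bc_pos_eventually) simp_all
  then obtain S where S: "open S" "x \<in> S" and pos:
    "\<And>z. z \<in> S \<Longrightarrow> bc a b c z > 0 \<and> bc b c a z > 0 \<and> bc a b c' z > 0 \<and> bc b c' a z > 0"
    unfolding eventually_nhds by blast
  have "S \<subseteq> convex hull {c, a, b} \<union> convex hull {c', a, b}"
  proof
    fix z assume z: "z \<in> S"
    have "bc c a b z \<ge> 0 \<or> bc c' a b z \<ge> 0"
      using opp unfolding bc_def[of c] bc_def[of c'] zero_le_divide_iff mult_less_0_iff by linarith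
    then show "z \<in> convex hull {c, a, b} \<union> convex hull {c', a, b}"
      unfolding Un_iff bc_in_hull_iff[OF D] bc_in_hull_iff[OF D'] using pos[OF z] by auto
  qed
  then show ?thesis using S by (intro interiorI[of S])
qed

locale conforming_triangulation =
  fixes \<Omega> :: "point set" and T :: "tri set"
  assumes tri: "triangulation \<Omega> T" and conf: "conforming T"
    and interior_closure_\<Omega>: "interior (closure \<Omega>) = \<Omega>"
begin

lemma finite_T: "finite T" and noncollinear: "K \<in> T \<Longrightarrow> \<not> collinear (verts K)"
  and cover: "(\<Union>K\<in>T. hl K) = closure \<Omega>"
  and disjoint: "K \<in> T \<Longrightarrow> K' \<in> T \<Longrightarrow> K \<noteq> K' \<Longrightarrow> interior (hl K) \<inter> interior (hl K') = {}"
  using tri unfolding triangulation_def by auto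

lemma open_\<Omega>: "open \<Omega>" using interior_closure_\<Omega> open_interior by metis

lemma inter_hl: "K \<in> T \<Longrightarrow> K' \<in> T \<Longrightarrow> K \<noteq> K' \<Longrightarrow> hl K \<inter> hl K' = convex hull (verts K \<inter> verts K')"
  using conf unfolding conforming_def by auto

lemma hl_subset_eq:
  assumes "K \<in> T" "K' \<in> T" "S \<subseteq> hl K" "S \<subseteq> hl K'" "interior S \<noteq> {}"
  shows "K = K'"
  using disjoint[OF assms(1,2)] interior_mono[OF assms(3)] interior_mono[OF assms(4)] assms(5) by blast

lemma common_edge:
  assumes K: "K \<in> T" "K' \<in> T" "K \<noteq> K'"
    and xy: "x \<noteq> y" "x \<in> hl K" "x \<in> hl K'" "y \<in> hl K" "y \<in> hl K'"
  obtains e where "e \<in> tri_edges K" "e \<in> tri_edges K'" "hl K \<inter> hl K' = convex hull e"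
proof -
  let ?e = "verts K \<inter> verts K'"
  have h: "hl K \<inter> hl K' = convex hull ?e" by (rule inter_hl[OF K])
  have fin: "finite ?e" using finite_verts by simp
  have "card ?e \<ge> 2" using xy h fin by (intro hull_le_1[of _ x y]) auto
  moreover have "card ?e < 3"
  proof (rule ccontr)
    have c3: "card (verts L) \<le> 3" for L
      by (cases L) (auto simp: card_insert_if)
    assume "\<not> card ?e < 3"
    then have "card (verts K) \<le> card ?e" "card (verts K') \<le> card ?e" using c3[of K] c3[of K'] by linarith+
    then have "?e = verts K" "?e = verts K'"
      by (intro card_seteq; simp add: finite_verts)+
    then have "hl K = hl K'" unfolding hl_def by simp
    then show False using hl_subset_eq[OF K(1,2), of "hl K"] interior_hl_nonempty[OF noncollinear[OF K(1)]] K(3) by simp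
  qed
  ultimately have "card ?e = 2" by linarith
  then show ?thesis
    by (intro that[of ?e] h) (simp_all add: tri_edges_iff noncollinear K)
qed

lemma shared_edge_apexes:
  assumes K: "K \<in> T" "K' \<in> T" "K \<noteq> K'" and e: "e \<in> tri_edges K" "e \<in> tri_edges K'"
    and ca: "e = {a, b}" "hl K = convex hull {c, a, b}" "cr (a - c) (b - c) \<noteq> 0"
  obtains c' where "hl K' = convex hull {c', a, b}" "cr (a - c') (b - c') \<noteq> 0"
    "cr (a - c) (b - c) * cr (a - c') (b - c') < 0"
proof -
  obtain c' a' b' where *: "e = {a', b'}" "hl K' = convex hull {c', a', b'}" "cr (a' - c') (b' - c') \<noteq> 0"
    by (rule tri_edge_apex[OF noncollinear[OF K(2)] e(2)])
  have "(a' = a \<and> b' = b) \<or> (a' = b \<and> b' = a)" using *(1) ca(1) by (auto simp: doubleton_eq_iff)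
  moreover have "{c', b, a} = {c', a, b}" by blast
  moreover have "cr (b - c') (a - c') = - cr (a - c') (b - c')" by (simp add: cr_def)
  ultimately have h: "hl K' = convex hull {c', a, b}" and D: "cr (a - c') (b - c') \<noteq> 0"
    using *(2,3) by (metis, metis neg_equal_0_iff_equal)
  have "cr (a - c) (b - c) * cr (a - c') (b - c') < 0"
    by (rule opposite_sides[OF ca(3) D]) (use disjoint[OF K] h ca(2) in simp)
  then show ?thesis using that h D by blast
qed

text \<open>Of three triangles at a common edge, two would lie on the same side and overlap.\<close>
lemma at_most_two:
  assumes K: "K1 \<in> T" "K2 \<in> T" "K3 \<in> T" "K1 \<noteq> K2"
    and e: "e \<in> tri_edges K1" "e \<in> tri_edges K2" "e \<in> tri_edges K3"
  shows "K3 = K1 \<or> K3 = K2"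
proof (rule ccontr)
  assume n: "\<not> ?thesis"
  then have n1: "K1 \<noteq> K3" and n2: "K2 \<noteq> K3" by auto
  obtain c1 a b where 1: "e = {a, b}" "hl K1 = convex hull {c1, a, b}" "cr (a - c1) (b - c1) \<noteq> 0"
    by (rule tri_edge_apex[OF noncollinear[OF K(1)] e(1)])
  obtain c2 where 2: "hl K2 = convex hull {c2, a, b}" "cr (a - c2) (b - c2) \<noteq> 0"
    "cr (a - c1) (b - c1) * cr (a - c2) (b - c2) < 0"
    by (rule shared_edge_apexes[OF K(1,2,4) e(1,2) 1])
  obtain c3 where 3: "hl K3 = convex hull {c3, a, b}" "cr (a - c3) (b - c3) \<noteq> 0"
    "cr (a - c1) (b - c1) * cr (a - c3) (b - c3) < 0"
    by (rule shared_edge_apexes[OF K(1,3) n1 e(1,3) 1])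
  have "cr (a - c2) (b - c2) * cr (a - c3) (b - c3) < 0"
    by (rule opposite_sides[OF 2(2) 3(2)]) (use disjoint[OF K(2,3) n2] 2 3 in simp)
  then show False using 2(3) 3(3) unfolding mult_less_0_iff by linarith
qed

lemma shared_edge_interior:
  assumes K: "K \<in> T" "K' \<in> T" "K \<noteq> K'" and e: "e \<in> tri_edges K" "e \<in> tri_edges K'"
  shows "rel_interior (convex hull e) \<subseteq> interior (hl K \<union> hl K')"
proof
  fix x assume x: "x \<in> rel_interior (convex hull e)"
  obtain c a b where 1: "e = {a, b}" "hl K = convex hull {c, a, b}" "cr (a - c) (b - c) \<noteq> 0"
    by (rule tri_edge_apex[OF noncollinear[OF K(1)] e(1)])
  obtain c' where 2: "hl K' = convex hull {c', a, b}" "cr (a - c') (b - c') \<noteq> 0"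
    "cr (a - c) (b - c) * cr (a - c') (b - c') < 0"
    by (rule shared_edge_apexes[OF K e 1])
  show "x \<in> interior (hl K \<union> hl K')" unfolding 1(2) 2(1)
    by (rule shared_edge_nbhd[OF 1(3) 2(2,3)]) (use x 1(1) in simp)
qed

lemma hl_subset_closure: "K \<in> T \<Longrightarrow> hl K \<subseteq> closure \<Omega>" using cover by blast

text \<open>The interior of the union of the two triangles is an open subset of \<open>closure \<Omega>\<close>. This is where
  the domain must lie on one side of its boundary.\<close>
lemma shared_edge_in_\<Omega>:
  assumes "K \<in> T" "K' \<in> T" "K \<noteq> K'" "e \<in> tri_edges K" "e \<in> tri_edges K'"
  shows "rel_interior (convex hull e) \<subseteq> \<Omega>"
proof -
  have "interior (hl K \<union> hl K') \<subseteq> interior (closure \<Omega>)"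
    using hl_subset_closure assms by (intro interior_mono) simp
  then show ?thesis using shared_edge_interior[OF assms] interior_closure_\<Omega> by simp
qed

lemma edge_in_frontier_iff:
  assumes K: "K \<in> T" "K2 \<in> T" and e: "e \<in> tri_edges K2"
  shows "convex hull e \<subseteq> frontier (hl K) \<longleftrightarrow> e \<in> tri_edges K"
proof
  assume "e \<in> tri_edges K" then show "convex hull e \<subseteq> frontier (hl K)"
    by (rule edge_in_frontier[OF noncollinear[OF K(1)]])
next
  assume sub: "convex hull e \<subseteq> frontier (hl K)"
  show "e \<in> tri_edges K"
  proof (cases "K = K2")
    case False
    have "frontier (hl K) \<subseteq> hl K" using hl_closed by (rule frontier_subset_closed)
    then have eK: "convex hull e \<subseteq> hl K" using sub by blast
    obtain c a b where *: "e = {a, b}" "hl K2 = convex hull {c, a, b}" "a \<noteq> b"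
      by (rule tri_edge_apex[OF noncollinear[OF K(2)] e])
    have ab: "a \<in> convex hull e" "b \<in> convex hull e" unfolding *(1) by (simp_all add: hull_inc)
    have eK2: "convex hull e \<subseteq> hl K2" unfolding * by (intro hull_mono) auto
    obtain g where g: "g \<in> tri_edges K" "g \<in> tri_edges K2" "hl K \<inter> hl K2 = convex hull g"
      by (rule common_edge[OF K False *(3)]) (use ab eK eK2 in blast)+
    have "e = g"
      by (rule edges_meet[OF noncollinear[OF K(2)] e g(2) *(3) ab]) (use g(3) ab eK eK2 in blast)+
    then show ?thesis using g by simp
  qed (use e in simp)
qed

text \<open>The triangle \<open>K\<close> covers no neighbourhood of the midpoint of its edge. As the other triangles are
  finitely many closed sets, one of them contains the midpoint, and by conformity it then contains the
  whole edge.\<close>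
lemma neighbour:
  assumes K: "K \<in> T" and e: "e \<in> tri_edges K" and in\<Omega>: "rel_interior (convex hull e) \<subseteq> \<Omega>"
  obtains K' where "K' \<in> T" "K' \<noteq> K" "e \<in> tri_edges K'"
proof -
  obtain c a b where 1: "e = {a, b}" "hl K = convex hull {c, a, b}" "verts K = {c, a, b}" "cr (a - c) (b - c) \<noteq> 0" "a \<noteq> b"
    by (rule tri_edge_apex[OF noncollinear[OF K] e])
  define x where "x = midpoint a b"
  have xr: "x \<in> rel_interior (convex hull e)" unfolding x_def 1(1) by (rule rel_interior_edge(2)[OF 1(4)])
  then have x\<Omega>: "x \<in> \<Omega>" using in\<Omega> by blast
  have xe: "x \<in> convex hull e" using xr rel_interior_subset by blast
  then have xf: "x \<in> frontier (hl K)" using edge_in_frontier[OF noncollinear[OF K] e] by blast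
  have "x \<in> (\<Union>K'\<in>T - {K}. hl K')"
  proof (rule ccontr)
    assume n: "x \<notin> (\<Union>K'\<in>T - {K}. hl K')"
    have "closed (\<Union>K'\<in>T - {K}. hl K')" using finite_T hl_closed by (intro closed_UN) auto
    then have o: "open (\<Omega> - (\<Union>K'\<in>T - {K}. hl K'))" by (intro open_Diff open_\<Omega>)
    have "\<Omega> - (\<Union>K'\<in>T - {K}. hl K') \<subseteq> hl K"
      using cover closure_subset[of \<Omega>] K by blast
    then have "x \<in> interior (hl K)" using o n x\<Omega> by (intro interiorI[OF o]) auto
    then show False using xf by (simp add: frontier_def)
  qed
  then obtain K' where K': "K' \<in> T" "K' \<noteq> K" "x \<in> hl K'" by blast
  have xK: "x \<in> hl K" using xf hl_closed frontier_subset_closed by blast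
  have "x \<in> convex hull (verts K \<inter> verts K')" using inter_hl[OF K K'(1)] K' xK by blast
  then have xF: "x \<in> convex hull (e \<inter> (verts K \<inter> verts K'))"
    using faces_Int[OF noncollinear[OF K], of e "verts K \<inter> verts K'"] xe 1 by auto
  have xab: "x \<noteq> a" "x \<noteq> b" unfolding x_def using 1(5) by simp_all
  have nz: "e \<inter> (verts K \<inter> verts K') \<noteq> {z}" if "x \<noteq> z" for z
  proof
    assume "e \<inter> (verts K \<inter> verts K') = {z}"
    then have "x \<in> convex hull {z}" using xF by (simp only:)
    then show False using that by simp
  qed
  have "e \<inter> (verts K \<inter> verts K') \<noteq> {}"
  proof
    assume "e \<inter> (verts K \<inter> verts K') = {}"
    then have "x \<in> convex hull {}" using xF by (simp only:)
    then show False by simp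
  qed
  moreover have "F = {} \<or> F = {a} \<or> F = {b} \<or> F = {a, b}" if "F \<subseteq> {a, b}" for F
    using that by (cases "a \<in> F"; cases "b \<in> F"; blast)
  moreover have "e \<inter> (verts K \<inter> verts K') \<subseteq> {a, b}" unfolding 1(1) by blast
  ultimately have "e \<inter> (verts K \<inter> verts K') = {a, b}" using nz[OF xab(1)] nz[OF xab(2)] by meson
  then have "e \<inter> (verts K \<inter> verts K') = e" using 1(1) by simp
  then have "e \<subseteq> verts K'" by blast
  then have "e \<in> tri_edges K'"
    using tri_edges_iff[OF noncollinear[OF K'(1)]] tri_edges_iff[OF noncollinear[OF K]] e by simp
  then show ?thesis using that K' by blast
qed

lemma edges_meet_global:
  assumes K: "K \<in> T" "K' \<in> T" and e: "e \<in> tri_edges K" "e' \<in> tri_edges K'"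
    and xy: "x \<noteq> y" "x \<in> convex hull e" "y \<in> convex hull e" "x \<in> convex hull e'" "y \<in> convex hull e'"
  shows "e = e'"
proof (cases "K = K'")
  case True
  then show ?thesis using edges_meet[OF noncollinear[OF K(1)] e(1) _ xy] e(2) by simp
next
  case False
  have sub: "convex hull e \<subseteq> hl K" "convex hull e' \<subseteq> hl K'"
    unfolding hl_def using e tri_edges_iff[OF noncollinear[OF K(1)]] tri_edges_iff[OF noncollinear[OF K(2)]]
    by (auto intro!: hull_mono)
  obtain g where g: "g \<in> tri_edges K" "g \<in> tri_edges K'" "hl K \<inter> hl K' = convex hull g"
    by (rule common_edge[OF K False xy(1)]) (use xy sub in blast)+
  have xg: "x \<in> convex hull g" "y \<in> convex hull g" using g(3) xy sub by blast+
  have "e = g" by (rule edges_meet[OF noncollinear[OF K(1)] e(1) g(1) xy(1-3) xg])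
  moreover have "e' = g" by (rule edges_meet[OF noncollinear[OF K(2)] e(2) g(2) xy(1,4,5) xg])
  ultimately show ?thesis by simp
qed

end

section \<open>Integrals and normals along edges\<close>

lemma sum_integral_le:
  fixes F :: "'n::euclidean_space \<Rightarrow> real"
  assumes I: "finite I" and sub: "\<And>i. i \<in> I \<Longrightarrow> S i \<subseteq> S0" and int: "\<And>i. i \<in> I \<Longrightarrow> F integrable_on S i"
    and int0: "F integrable_on S0" and nonneg: "\<And>x. x \<in> S0 \<Longrightarrow> 0 \<le> F x"
    and neg: "\<And>i j. i \<in> I \<Longrightarrow> j \<in> I \<Longrightarrow> i \<noteq> j \<Longrightarrow> negligible (S i \<inter> S j)"
  shows "(\<Sum>i\<in>I. integral (S i) F) \<le> integral S0 F"
proof -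
  have *: "(F has_integral (\<Sum>i\<in>J. integral (S i) F)) (\<Union>i\<in>J. S i)" if "finite J" "J \<subseteq> I" for J
    using that
  proof (induction J rule: finite_induct)
    case (insert j J)
    have "negligible (\<Union>i\<in>J. S j \<inter> S i)"
      using insert neg by (intro negligible_Union) auto
    then have n: "negligible (S j \<inter> (\<Union>i\<in>J. S i))" by simp
    have "(F has_integral (integral (S j) F + (\<Sum>i\<in>J. integral (S i) F))) (S j \<union> (\<Union>i\<in>J. S i))"
      by (rule has_integral_Un[OF _ _ n]) (use insert int in auto)
    then show ?case using insert by simp
  qed simp
  have h: "(F has_integral (\<Sum>i\<in>I. integral (S i) F)) (\<Union>i\<in>I. S i)" by (rule *[OF I order_refl])
  show ?thesis
    by (rule has_integral_subset_le[OF _ h integrable_integral[OF int0]]) (use sub nonneg in auto)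
qed

lemma integral_affine_unit:
  fixes h :: "real \<Rightarrow> real"
  assumes h: "continuous_on UNIV h" and st: "s \<noteq> t"
  shows "\<bar>t - s\<bar> * integral {0..1} (\<lambda>\<tau>. h (s + \<tau> * (t - s))) = integral {min s t..max s t} h"
proof -
  have "h integrable_on {min s t..max s t}"
    by (intro integrable_continuous_interval continuous_on_subset[OF h]) simp
  then have i: "(h has_integral integral {min s t..max s t} h) (cbox (min s t) (max s t))"
    by (simp add: integrable_integral)
  have m: "t - s \<noteq> 0" using st by simp
  have im: "(\<lambda>x. (1 / (t - s)) *\<^sub>R x + - ((1 / (t - s)) *\<^sub>R s)) ` cbox (min s t) (max s t) = {0..1}"
  proof -
    have e0: "(1 / (t - s)) *\<^sub>R s + - ((1 / (t - s)) *\<^sub>R s) = 0" by simp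
    have e1: "(1 / (t - s)) *\<^sub>R t + - ((1 / (t - s)) *\<^sub>R s) = 1"
      using m by (simp add: diff_divide_distrib[symmetric])
    show ?thesis
    proof (cases "s < t")
      case True
      then have "min s t = s" "max s t = t" "0 \<le> 1 / (t - s)" by simp_all
      then show ?thesis unfolding image_affinity_cbox e0 e1 using True by (simp add: e0[simplified] e1[simplified])
    next
      case False
      then have "min s t = t" "max s t = s" "\<not> 0 \<le> 1 / (t - s)" using st by simp_all
      then show ?thesis unfolding image_affinity_cbox using False by (simp add: e0[simplified] e1[simplified])
    qed
  qed
  have "((\<lambda>x. h ((t - s) *\<^sub>R x + s)) has_integral (1 / \<bar>t - s\<bar> ^ DIM(real)) *\<^sub>R integral {min s t..max s t} h) {0..1}"
    using has_integral_affinity[OF i m, of s] unfolding im .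
  then have "integral {0..1} (\<lambda>x. h ((t - s) *\<^sub>R x + s)) = integral {min s t..max s t} h / \<bar>t - s\<bar>"
    by (simp add: integral_unique)
  moreover have "(\<lambda>x. h ((t - s) *\<^sub>R x + s)) = (\<lambda>\<tau>. h (s + \<tau> * (t - s)))"
    by (simp add: mult.commute add.commute)
  ultimately show ?thesis using m by simp
qed

text \<open>The parametrisation chosen in \<open>edge_integral\<close> may run in either direction, whence \<open>min\<close> and
  \<open>max\<close>. All pieces of the edge from \<open>a\<close> to \<open>b\<close> are expressed by the one parameter \<open>u\<close> so
  that their integrals can be added.\<close>
lemma edge_integral_segment:
  fixes a b :: point
  defines "\<gamma> \<equiv> \<lambda>u::real. a + u *\<^sub>R (b - a)"
  assumes g: "continuous_on UNIV g" and ab: "a \<noteq> b" and st: "s \<noteq> t"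
  shows "edge_integral {\<gamma> s, \<gamma> t} g = dist a b * integral {min s t..max s t} (\<lambda>u. g (\<gamma> u))"
proof -
  have cont: "continuous_on UNIV (\<lambda>u. g (\<gamma> u))"
    unfolding \<gamma>_def by (rule continuous_on_compose2[OF g]) (auto intro!: continuous_intros)
  have *: "dist (\<gamma> s) (\<gamma> t) * integral {0..1} (\<lambda>\<tau>. g (\<gamma> s + \<tau> *\<^sub>R (\<gamma> t - \<gamma> s)))
     = dist a b * integral {min s t..max s t} (\<lambda>u. g (\<gamma> u))" if st: "s \<noteq> t" for s t
  proof -
    have d: "\<gamma> t - \<gamma> s = (t - s) *\<^sub>R (b - a)" unfolding \<gamma>_def by (simp add: algebra_simps)
    have "dist (\<gamma> s) (\<gamma> t) = \<bar>t - s\<bar> * dist a b"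
      unfolding dist_commute[of "\<gamma> s"] dist_commute[of a] unfolding dist_norm d by simp
    moreover have "\<gamma> s + \<tau> *\<^sub>R (\<gamma> t - \<gamma> s) = \<gamma> (s + \<tau> * (t - s))" for \<tau>
      unfolding d unfolding \<gamma>_def by (simp add: algebra_simps)
    ultimately show ?thesis using integral_affine_unit[OF cont st] by simp
  qed
  obtain p q where pq: "(SOME (p, q). {\<gamma> s, \<gamma> t} = {p, q}) = (p, q)" by (metis surj_pair)
  have "case (SOME (p, q). {\<gamma> s, \<gamma> t} = {p, q}) of (p, q) \<Rightarrow> {\<gamma> s, \<gamma> t} = {p, q}"
    by (rule someI[of "\<lambda>(p, q). {\<gamma> s, \<gamma> t} = {p, q}" "(\<gamma> s, \<gamma> t)"]) simp
  then have "{\<gamma> s, \<gamma> t} = {p, q}" unfolding pq by simp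
  then have "p = \<gamma> s \<and> q = \<gamma> t \<or> p = \<gamma> t \<and> q = \<gamma> s" by (auto simp: doubleton_eq_iff)
  then show ?thesis
  proof
    assume "p = \<gamma> s \<and> q = \<gamma> t"
    then show ?thesis unfolding edge_integral_def pq Let_def prod.case using *[OF st] by simp
  next
    assume "p = \<gamma> t \<and> q = \<gamma> s"
    then show ?thesis unfolding edge_integral_def pq Let_def prod.case
      using *[OF st[symmetric]] by (simp add: min.commute max.commute)
  qed
qed

lemma edge_integral_eq:
  fixes a b :: point
  assumes "continuous_on UNIV g" "a \<noteq> b"
  shows "edge_integral {a, b} g = dist a b * integral {0..1} (\<lambda>u. g (a + u *\<^sub>R (b - a)))"
  using edge_integral_segment[OF assms, of 0 1] by simp

lemma integrable_on_segment:
  fixes g :: func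
  assumes "continuous_on UNIV g"
  shows "(\<lambda>u. g (a + u *\<^sub>R (b - a))) integrable_on {s..t}"
  by (intro integrable_continuous_interval continuous_on_compose2[OF assms]) (auto intro!: continuous_intros)

lemma edge_integral_le_lincomb:
  assumes c: "continuous_on UNIV f" "continuous_on UNIV g" "continuous_on UNIV h" and e: "card e = 2"
    and le: "\<And>x. f x \<le> \<alpha> * g x + \<beta> * h x"
  shows "edge_integral e f \<le> \<alpha> * edge_integral e g + \<beta> * edge_integral e h"
proof -
  obtain a b where ab: "e = {a, b}" "a \<noteq> b" using e unfolding card_2_iff by blast
  let ?\<gamma> = "\<lambda>u::real. a + u *\<^sub>R (b - a)"
  have "integral {0..1} (\<lambda>u. f (?\<gamma> u)) \<le> integral {0..1} (\<lambda>u. \<alpha> * g (?\<gamma> u) + \<beta> * h (?\<gamma> u))"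
    by (intro integral_le integrable_add integrable_on_mult_right integrable_on_segment c le)
  also have "\<dots> = \<alpha> * integral {0..1} (\<lambda>u. g (?\<gamma> u)) + \<beta> * integral {0..1} (\<lambda>u. h (?\<gamma> u))"
    by (subst integral_add) ((rule integrable_on_mult_right integrable_on_segment c)+, simp)
  finally have "dist a b * integral {0..1} (\<lambda>u. f (?\<gamma> u))
     \<le> dist a b * (\<alpha> * integral {0..1} (\<lambda>u. g (?\<gamma> u)) + \<beta> * integral {0..1} (\<lambda>u. h (?\<gamma> u)))"
    by (rule mult_left_mono) simp
  then show ?thesis unfolding ab(1) edge_integral_eq[OF c(1) ab(2)] edge_integral_eq[OF c(2) ab(2)] edge_integral_eq[OF c(3) ab(2)]
    by (simp add: algebra_simps)
qed

lemma edge_integral_nonneg: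
  assumes "continuous_on UNIV g" "card e = 2" "\<And>x. 0 \<le> g x"
  shows "0 \<le> edge_integral e g"
proof -
  obtain a b where ab: "e = {a, b}" "a \<noteq> b" using assms(2) unfolding card_2_iff by blast
  show ?thesis unfolding ab(1) edge_integral_eq[OF assms(1) ab(2)]
    by (intro mult_nonneg_nonneg integral_nonneg integrable_on_segment assms) simp
qed

lemma edge_integral_0: "edge_integral e (\<lambda>x. 0) = 0"
  unfolding edge_integral_def by (simp add: split_beta Let_def)

lemma in_segment_param:
  fixes a b :: point
  assumes "x \<in> convex hull {a, b}"
  obtains u where "0 \<le> u" "u \<le> 1" "x = a + u *\<^sub>R (b - a)"
proof -
  obtain s t where "0 \<le> s" "0 \<le> t" "s + t = 1" "x = s *\<^sub>R a + t *\<^sub>R b" using assms unfolding convex_hull_2 by blast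
  moreover from this have "s = 1 - t" by simp
  ultimately show ?thesis by (intro that[of t]) (simp_all add: algebra_simps)
qed

lemma segment_param_in_hull:
  fixes a b :: point
  assumes "s \<le> u" "u \<le> t"
  shows "a + u *\<^sub>R (b - a) \<in> convex hull {a + s *\<^sub>R (b - a), a + t *\<^sub>R (b - a)}"
proof (cases "s = t")
  case True
  then show ?thesis using assms by simp
next
  case False
  define \<tau> where "\<tau> = (u - s) / (t - s)"
  have \<tau>: "0 \<le> \<tau>" "\<tau> \<le> 1" using assms False by (auto simp: \<tau>_def field_simps)
  have "\<tau> * (t - s) = u - s" using False by (simp add: \<tau>_def)
  then have u: "u = (1 - \<tau>) * s + \<tau> * t" by (simp add: algebra_simps)
  have "a + u *\<^sub>R (b - a) = (1 - \<tau>) *\<^sub>R (a + s *\<^sub>R (b - a)) + \<tau> *\<^sub>R (a + t *\<^sub>R (b - a))"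
    unfolding u by (simp add: algebra_simps)
  then show ?thesis using \<tau> unfolding convex_hull_2 mem_Collect_eq
    by (intro exI[of _ "1 - \<tau>"] exI[of _ \<tau>]) simp
qed

text \<open>In the parameter of \<open>e\<close>, the pieces become intervals that overlap in at most one point.\<close>
lemma sum_subedges_le:
  assumes g: "continuous_on UNIV g" "\<And>x. 0 \<le> g x" and e: "card e = 2" and E: "finite E"
    and sub: "\<And>e'. e' \<in> E \<Longrightarrow> card e' = 2 \<and> convex hull e' \<subseteq> convex hull e"
    and meet: "\<And>e1 e2 x y. e1 \<in> E \<Longrightarrow> e2 \<in> E \<Longrightarrow> x \<noteq> y \<Longrightarrow> x \<in> convex hull e1 \<Longrightarrow> y \<in> convex hull e1 \<Longrightarrow>
       x \<in> convex hull e2 \<Longrightarrow> y \<in> convex hull e2 \<Longrightarrow> e1 = e2"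
  shows "(\<Sum>e'\<in>E. edge_integral e' g) \<le> edge_integral e g"
proof -
  obtain a b where ab: "e = {a, b}" "a \<noteq> b" using e unfolding card_2_iff by blast
  let ?\<gamma> = "\<lambda>u::real. a + u *\<^sub>R (b - a)"
  have inj: "u = v" if "?\<gamma> u = ?\<gamma> v" for u v using that ab(2) by simp
  have "\<exists>s t. 0 \<le> s \<and> s < t \<and> t \<le> 1 \<and> e' = {?\<gamma> s, ?\<gamma> t}" if e': "e' \<in> E" for e'
  proof -
    obtain p q where pq: "e' = {p, q}" "p \<noteq> q" using sub[OF e'] unfolding card_2_iff by blast
    have "p \<in> convex hull {a, b}" "q \<in> convex hull {a, b}"
      using sub[OF e'] hull_subset[of e' convex] unfolding pq ab by auto
    note h = this
    obtain s where s: "0 \<le> s" "s \<le> 1" "p = ?\<gamma> s" by (rule in_segment_param[OF h(1)])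
    obtain t where t: "0 \<le> t" "t \<le> 1" "q = ?\<gamma> t" by (rule in_segment_param[OF h(2)])
    show ?thesis
    proof (cases "s < t")
      case True
      then show ?thesis using s t pq(1) by blast
    next
      case False
      then have "t < s" using pq s t by (cases "s = t") auto
      moreover have "e' = {?\<gamma> t, ?\<gamma> s}" unfolding pq(1) s(3) t(3) by (rule insert_commute)
      ultimately show ?thesis using s t by blast
    qed
  qed
  then obtain lo hi where lh: "\<And>e'. e' \<in> E \<Longrightarrow> 0 \<le> lo e' \<and> lo e' < hi e' \<and> hi e' \<le> 1 \<and> e' = {?\<gamma> (lo e'), ?\<gamma> (hi e')}"
    by metis
  have "(\<Sum>e'\<in>E. integral {lo e'..hi e'} (\<lambda>u. g (?\<gamma> u))) \<le> integral {0..1} (\<lambda>u. g (?\<gamma> u))"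
  proof (rule sum_integral_le[OF E])
    fix e1 e2 assume E12: "e1 \<in> E" "e2 \<in> E" "e1 \<noteq> e2"
    have "u = v" if uv: "u \<in> {lo e1..hi e1} \<inter> {lo e2..hi e2}" "v \<in> {lo e1..hi e1} \<inter> {lo e2..hi e2}" for u v
    proof (rule ccontr)
      assume "u \<noteq> v"
      then have n: "?\<gamma> u \<noteq> ?\<gamma> v" using inj by blast
      have in1: "?\<gamma> w \<in> convex hull e1" if "w \<in> {lo e1..hi e1}" for w
        using segment_param_in_hull[of "lo e1" w "hi e1" a b] that lh[OF E12(1)] by simp
      have in2: "?\<gamma> w \<in> convex hull e2" if "w \<in> {lo e2..hi e2}" for w
        using segment_param_in_hull[of "lo e2" w "hi e2" a b] that lh[OF E12(2)] by simp
      show False using meet[OF E12(1,2) n] in1 in2 uv E12(3) by blast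
    qed
    then have "\<exists>z. {lo e1..hi e1} \<inter> {lo e2..hi e2} \<subseteq> {z}" by blast
    then show "negligible ({lo e1..hi e1} \<inter> {lo e2..hi e2})"
      using negligible_sing negligible_subset by blast
  next
    show "{lo e'..hi e'} \<subseteq> {0..1}" if "e' \<in> E" for e' using lh[OF that] by simp
  qed (use g in \<open>auto intro: integrable_on_segment\<close>)
  then have "dist a b * (\<Sum>e'\<in>E. integral {lo e'..hi e'} (\<lambda>u. g (?\<gamma> u))) \<le> dist a b * integral {0..1} (\<lambda>u. g (?\<gamma> u))"
    by (rule mult_left_mono) simp
  moreover have "edge_integral e' g = dist a b * integral {lo e'..hi e'} (\<lambda>u. g (?\<gamma> u))" if "e' \<in> E" for e'
  proof -
    have "edge_integral {?\<gamma> (lo e'), ?\<gamma> (hi e')} g = dist a b * integral {min (lo e') (hi e')..max (lo e') (hi e')} (\<lambda>u. g (?\<gamma> u))"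
      by (rule edge_integral_segment[OF g(1) ab(2)]) (use lh[OF that] in simp)
    moreover have "{?\<gamma> (lo e'), ?\<gamma> (hi e')} = e'" "min (lo e') (hi e') = lo e'" "max (lo e') (hi e') = hi e'"
      using lh[OF that] by simp_all
    ultimately show ?thesis by (simp only:)
  qed
  ultimately show ?thesis
    unfolding ab(1) edge_integral_eq[OF g(1) ab(2)] by (simp add: sum_distrib_left)
qed

lemma diameter_pair: "diameter {a, b :: point} = dist a b"
proof (rule antisym)
  show "diameter {a, b} \<le> dist a b"
    by (rule diameter_le) (auto simp: dist_norm norm_minus_commute)
  show "dist a b \<le> diameter {a, b}"
    by (rule diameter_bounded_bound) auto
qed

text \<open>A piece of an edge that ends at its midpoint is contained in one half of it.\<close>
lemma diameter_subedge:
  fixes e e' :: "point set"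
  assumes "card e' = 2" "card e = 2" "convex hull e' \<subseteq> convex hull e"
  shows "diameter e' \<le> diameter e"
    "e = {a, b} \<Longrightarrow> midpoint a b \<in> e' \<Longrightarrow> diameter e' \<le> diameter e / 2"
proof -
  have D: "dist p q \<le> dist a b \<and> (p = midpoint a b \<longrightarrow> dist p q \<le> dist a b / 2)" if "e = {a, b}" "p \<in> e'" "q \<in> e'" for a b p q :: point
  proof -
    have "p \<in> convex hull {a, b}" "q \<in> convex hull {a, b}"
      using assms(3) that hull_subset[of e' convex] by auto
    note h = this
    obtain s where s: "0 \<le> s" "s \<le> 1" "p = a + s *\<^sub>R (b - a)" by (rule in_segment_param[OF h(1)])
    obtain t where t: "0 \<le> t" "t \<le> 1" "q = a + t *\<^sub>R (b - a)" by (rule in_segment_param[OF h(2)])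
    have "q - p = (t - s) *\<^sub>R (b - a)" unfolding s t by (simp add: algebra_simps)
    then have "norm (q - p) = \<bar>t - s\<bar> * norm (b - a)" by simp
    then have d: "dist p q = \<bar>t - s\<bar> * dist a b"
      by (simp add: dist_norm norm_minus_commute)
    have "dist p q \<le> 1 * dist a b" unfolding d by (rule mult_right_mono) (use s t in auto)
    moreover have "dist p q \<le> dist a b / 2" if "p = midpoint a b"
    proof -
      have "midpoint a b - q = (1/2 - t) *\<^sub>R (b - a)" unfolding t midpoint_def
        by (simp add: vec_eq_iff field_simps)
      then have "norm (midpoint a b - q) = \<bar>1/2 - t\<bar> * norm (b - a)" by simp
      then have "dist p q = \<bar>1/2 - t\<bar> * dist a b"
        unfolding that by (simp add: dist_norm norm_minus_commute)
      also have "\<dots> \<le> (1/2) * dist a b" by (rule mult_right_mono) (use t(1,2) in linarith, simp)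
      finally show ?thesis by simp
    qed
    ultimately show ?thesis by simp
  qed
  obtain p q where pq: "e' = {p, q}" using assms(1) unfolding card_2_iff by blast
  show "diameter e' \<le> diameter e"
  proof -
    obtain a b where "e = {a, b}" using assms(2) unfolding card_2_iff by blast
    then show ?thesis using D[of a b p q] unfolding pq by (simp add: diameter_pair)
  qed
  show "diameter e' \<le> diameter e / 2" if "e = {a, b}" "midpoint a b \<in> e'"
    using D[OF that(1), of p q] D[OF that(1), of q p] that unfolding pq by (auto simp: diameter_pair dist_commute)
qed

text \<open>In the plane, the cross product with \<open>d\<close> measures the component along any unit normal to \<open>d\<close>
  up to sign. As the left-hand side does not mention \<open>n\<close>, the squared component is the same for
  all unit normals.\<close>
lemma normal_component_unique:
  fixes d n G :: point
  assumes "norm n = 1" "d \<bullet> n = 0"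
  shows "(cr d G)\<^sup>2 = (d \<bullet> d) * (G \<bullet> n)\<^sup>2"
proof -
  have n: "n $ 1 * n $ 1 + n $ 2 * n $ 2 = 1"
    using assms(1) by (simp add: norm_eq_1 inner_vec_def sum_2)
  have dn: "d $ 1 * n $ 1 + d $ 2 * n $ 2 = 0" using assms(2) by (simp add: inner_vec_def sum_2)
  define l where "l = n $ 1 * d $ 2 - n $ 2 * d $ 1"
  have d1: "d $ 1 = - n $ 2 * l"
  proof -
    have "d $ 1 = d $ 1 * (n $ 1 * n $ 1 + n $ 2 * n $ 2)" using n by simp
    also have "\<dots> = n $ 1 * (d $ 1 * n $ 1 + d $ 2 * n $ 2) - n $ 2 * l" by (simp add: l_def algebra_simps)
    finally show ?thesis using dn by simp
  qed
  have d2: "d $ 2 = n $ 1 * l"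
  proof -
    have "d $ 2 = d $ 2 * (n $ 1 * n $ 1 + n $ 2 * n $ 2)" using n by simp
    also have "\<dots> = n $ 2 * (d $ 1 * n $ 1 + d $ 2 * n $ 2) + n $ 1 * l" by (simp add: l_def algebra_simps)
    finally show ?thesis using dn by simp
  qed
  have "cr d G = - l * (G \<bullet> n)" unfolding cr_def d1 d2 by (simp add: inner_vec_def sum_2 algebra_simps)
  moreover have "d \<bullet> d = l\<^sup>2 * (n $ 1 * n $ 1 + n $ 2 * n $ 2)"
    unfolding inner_vec_def sum_2 d1 d2 by (simp add: power2_eq_square algebra_simps)
  ultimately show ?thesis using n by (simp add: power_mult_distrib)
qed

lemma unit_normal:
  assumes "a \<noteq> b"
  shows "norm (unit_normal {a, b}) = 1" "(b - a) \<bullet> unit_normal {a, b} = 0"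
proof -
  define d where "d = b - a"
  define n where "n = (1 / norm d) *\<^sub>R (vector [- d $ 2, d $ 1] :: point)"
  have d: "norm d \<noteq> 0" using assms by (simp add: d_def)
  have "norm (vector [- d $ 2, d $ 1] :: point) = norm d"
    by (simp add: norm_vec_def L2_set_def sum_2 add.commute)
  then have n1: "norm n = 1" using d by (simp add: n_def)
  have dn: "d \<bullet> n = 0" by (simp add: n_def inner_vec_def sum_2)
  have dn': "(b - a) \<bullet> n = 0" "(a - b) \<bullet> n = 0"
    using dn by (simp_all add: d_def inner_diff_left)
  have "norm (unit_normal {a, b}) = 1 \<and> (\<forall>x\<in>{a, b}. \<forall>y\<in>{a, b}. (x - y) \<bullet> unit_normal {a, b} = 0)"
    unfolding unit_normal_def by (rule someI[of _ n]) (use n1 dn' in simp)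
  then show "norm (unit_normal {a, b}) = 1" "(b - a) \<bullet> unit_normal {a, b} = 0" by simp_all
qed

text \<open>The function \<open>unit_normal\<close> chooses separately for each edge, so the normals to an edge and to
  one of its pieces may be opposite. The square removes the sign.\<close>
lemma unit_normal_subedge:
  fixes G :: point
  assumes "card e' = 2" "card e = 2" "convex hull e' \<subseteq> convex hull e"
  shows "(G \<bullet> unit_normal e')\<^sup>2 = (G \<bullet> unit_normal e)\<^sup>2"
proof -
  obtain a b where ab: "e = {a, b}" "a \<noteq> b" using assms(2) unfolding card_2_iff by blast
  obtain p q where pq: "e' = {p, q}" "p \<noteq> q" using assms(1) unfolding card_2_iff by blast
  have "p \<in> convex hull {a, b}" "q \<in> convex hull {a, b}"
    using assms(3) hull_subset[of e' convex] unfolding ab pq by auto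
  note h = this
  obtain s where s: "p = a + s *\<^sub>R (b - a)" by (rule in_segment_param[OF h(1)])
  obtain t where t: "q = a + t *\<^sub>R (b - a)" by (rule in_segment_param[OF h(2)])
  have d: "q - p = (t - s) *\<^sub>R (b - a)" unfolding s t by (simp add: algebra_simps)
  have "(q - p) \<bullet> unit_normal e = 0" unfolding d ab(1) using unit_normal(2)[OF ab(2)] by simp
  then have "(cr (q - p) G)\<^sup>2 = ((q - p) \<bullet> (q - p)) * (G \<bullet> unit_normal e)\<^sup>2"
    using unit_normal(1)[OF ab(2)] by (intro normal_component_unique) (simp_all add: ab(1))
  moreover have "(cr (q - p) G)\<^sup>2 = ((q - p) \<bullet> (q - p)) * (G \<bullet> unit_normal e')\<^sup>2"
    using unit_normal[OF pq(2)] by (intro normal_component_unique) (simp_all add: pq(1))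
  moreover have "(q - p) \<bullet> (q - p) \<noteq> 0" using pq(2) by simp
  ultimately show ?thesis by simp
qed

section \<open>The error estimator on a fixed mesh\<close>

text \<open>The weight \<open>\<delta>\<close> is what later balances the reduction of the estimator against the change of the
  discrete solution.\<close>
lemma young: "(a + b)\<^sup>2 \<le> (1 + \<delta>) * a\<^sup>2 + (1 + 1 / \<delta>) * b\<^sup>2" if "\<delta> > 0" for a b \<delta> :: real
proof -
  have "0 \<le> (\<delta> * a - b)\<^sup>2 / \<delta>" using that by simp
  also have "\<dots> = \<delta> * a\<^sup>2 - 2 * a * b + b\<^sup>2 / \<delta>"
    using that by (simp add: power2_eq_square field_simps)
  finally show ?thesis by (simp add: power2_eq_square algebra_simps)
qed

lemma borel_measurable_lebesgue_on_AE:
  fixes f g :: func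
  assumes S: "S \<in> sets lebesgue" and g: "g \<in> borel_measurable (lebesgue_on S)"
    and ae: "AE x in lebesgue_on S. f x = g x"
  shows "f \<in> borel_measurable (lebesgue_on S)"
proof -
  have "AE x in lebesgue. x \<in> S \<longrightarrow> f x = g x" using ae S by (simp add: AE_restrict_space_iff)
  then have "AE x in lebesgue. (if x \<in> S then g x else 0) = (if x \<in> S then f x else 0)"
    by eventually_elim simp
  moreover have "(\<lambda>x. if x \<in> S then g x else 0) \<in> borel_measurable lebesgue"
    using g borel_measurable_if[OF S, of g] by simp
  ultimately have "(\<lambda>x. if x \<in> S then f x else 0) \<in> borel_measurable lebesgue"
    by (rule borel_measurable_AE[rotated])
  then show ?thesis using borel_measurable_if[OF S, of f] by simp
qed

lemma integrable_continuous_compact: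
  fixes g :: func
  assumes "compact S" "continuous_on UNIV g"
  shows "integrable (lebesgue_on S) g"
proof -
  have "integrable lborel (\<lambda>x. indicator S x *\<^sub>R g x)"
    by (intro borel_integrable_compact assms continuous_on_subset[OF assms(2)]) simp
  then have "integrable lebesgue (\<lambda>x. indicator S x *\<^sub>R g x)"
    by (subst integrable_completion) (auto dest: borel_measurable_integrable)
  moreover have "S \<inter> space lebesgue \<in> sets lebesgue" using assms(1) by (auto dest: compact_imp_closed)
  ultimately show ?thesis by (subst integrable_restrict_space) simp_all
qed

lemma p_of_pos:
  assumes "1 \<le> d"
  shows "1 \<le> p_of d"
proof -
  let ?P = "\<lambda>p. 1 \<le> p \<and> (p + 1) choose 2 \<le> d"
  have "p \<le> (p + 1) choose 2" for p :: nat
    by (induction p) (auto simp: numeral_2_eq_2)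
  then have "\<forall>p. ?P p \<longrightarrow> p \<le> d" using order_trans by blast
  moreover have "?P 1" using assms by (simp add: numeral_2_eq_2)
  ultimately have "?P (GREATEST p. ?P p)" by (intro GreatestI_nat[of ?P 1 d]) auto
  then show ?thesis unfolding p_of_def by blast
qed

lemma grad_lincomb:
  assumes "real_polynomial_function q" "real_polynomial_function q'"
  shows "grad (\<lambda>x. \<alpha> * q x + \<beta> * q' x) x = \<alpha> *\<^sub>R grad q x + \<beta> *\<^sub>R grad q' x"
  using real_polynomial_function_pd[OF assms(1)] real_polynomial_function_pd[OF assms(2)]
  unfolding grad_def vec_eq_iff by (simp add: pd_lincomb)

lemma laplacian_lincomb:
  assumes "real_polynomial_function q" "real_polynomial_function q'"
  shows "laplacian (\<lambda>x. \<alpha> * q x + \<beta> * q' x) x = \<alpha> * laplacian q x + \<beta> * laplacian q' x"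
proof -
  note d = real_polynomial_function_pd[OF assms(1)] real_polynomial_function_pd[OF assms(2)]
  have "pd i (\<lambda>x. \<alpha> * q x + \<beta> * q' x) = (\<lambda>x. \<alpha> * pd i q x + \<beta> * pd i q' x)" for i
    using d by (simp add: pd_lincomb fun_eq_iff)
  moreover have "pd i (\<lambda>x. \<alpha> * pd i q x + \<beta> * pd i q' x) x = \<alpha> * pd i (pd i q) x + \<beta> * pd i (pd i q') x" for i
    using d real_polynomial_function_pd[of "pd i q"] real_polynomial_function_pd[of "pd i q'"]
    by (intro pd_lincomb) blast+
  ultimately show ?thesis unfolding laplacian_def by (simp add: sum.distrib sum_distrib_left)
qed

lemma grad_inner_continuous:
  assumes "real_polynomial_function q" "real_polynomial_function q'"
  shows "continuous_on UNIV (\<lambda>x. (grad q x - grad q' x) \<bullet> n)"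
proof -
  have "continuous_on UNIV (pd i q)" "continuous_on UNIV (pd i q')" for i
    using real_polynomial_function_pd[OF assms(1)] real_polynomial_function_pd[OF assms(2)]
    by (simp_all add: real_polynomial_function_continuous)
  then have "continuous_on UNIV (grad q)" "continuous_on UNIV (grad q')"
    unfolding grad_def[abs_def] by (auto intro!: continuous_on_vec_lambda)
  then show ?thesis by (intro continuous_intros)
qed

text \<open>The functions in \<open>Vc_space\<close> are these and those of \<open>H10\<close>. The estimator only needs the
  polynomial pieces, so its properties are proved for this larger space.\<close>
definition pw_polys :: "hp \<Rightarrow> func set" where
  "pw_polys D = {w. \<forall>(K, d)\<in>D. \<exists>q \<in> polys (p_of d). AE x in lebesgue_on (hl K). w x = q x}"

lemma pw_polysD: "w \<in> pw_polys D \<Longrightarrow> (K, d) \<in> D \<Longrightarrow> \<exists>q\<in>polys (p_of d). AE x in lebesgue_on (hl K). w x = q x"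
  unfolding pw_polys_def by blast

lemma F_spaceD: "f \<in> F_space D \<Longrightarrow> (K, d) \<in> D \<Longrightarrow> \<exists>q\<in>polys (p_of d - 1). AE x in lebesgue_on (hl K). f x = q x"
  unfolding F_space_def by blast

lemma Vc_space_eq: "Vc_space \<Omega> D = H10 \<Omega> \<inter> pw_polys D"
  unfolding Vc_space_def pw_polys_def by blast

lemma zero_F_space: "(\<lambda>x. 0) \<in> F_space D"
proof -
  have "\<exists>q\<in>polys (p_of d - 1). AE x in lebesgue_on (hl K). 0 = q x" for K d
    by (rule bexI[OF _ zero_in_polys]) simp
  then show ?thesis unfolding F_space_def by blast
qed

lemma pw_polys_lincomb:
  assumes "w \<in> pw_polys D" "v \<in> pw_polys D"
  shows "(\<lambda>x. \<alpha> * w x + \<beta> * v x) \<in> pw_polys D"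
proof -
  have "\<exists>q\<in>polys (p_of d). AE x in lebesgue_on (hl K). \<alpha> * w x + \<beta> * v x = q x" if Kd: "(K, d) \<in> D" for K d
  proof -
    obtain q q' where q: "q \<in> polys (p_of d)" "AE x in lebesgue_on (hl K). w x = q x"
      and q': "q' \<in> polys (p_of d)" "AE x in lebesgue_on (hl K). v x = q' x"
      using pw_polysD[OF assms(1) Kd] pw_polysD[OF assms(2) Kd] by blast
    have "AE x in lebesgue_on (hl K). \<alpha> * w x + \<beta> * v x = \<alpha> * q x + \<beta> * q' x"
      using q(2) q'(2) by eventually_elim simp
    then show ?thesis by (rule bexI[OF _ polys_lincomb[OF q(1) q'(1)]])
  qed
  then show ?thesis unfolding pw_polys_def by blast
qed

locale hp_mesh = conforming_triangulation \<Omega> "fst ` D" for \<Omega> :: "point set" and D :: hp +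
  assumes inj: "inj_on fst D" and degree_pos: "(K, d) \<in> D \<Longrightarrow> 1 \<le> d" and bounded_\<Omega>: "bounded \<Omega>"
begin

lemma finite_D: "finite D" using finite_T inj by (rule finite_imageD)

lemma in_T: "(K, d) \<in> D \<Longrightarrow> K \<in> fst ` D" by force

lemma piece_eq:
  assumes "K \<in> fst ` D" "q \<in> polys n" "AE x in lebesgue_on (hl K). w x = q x"
  shows "piece w K = q"
  by (rule piece_eqI[OF assms(2,3) hl_lebesgue interior_hl_nonempty[OF noncollinear[OF assms(1)]]])

lemma piece:
  assumes "(K, d) \<in> D" "w \<in> pw_polys D"
  shows "piece w K \<in> polys (p_of d)" "AE x in lebesgue_on (hl K). w x = piece w K x"
proof -
  obtain q where q: "q \<in> polys (p_of d)" "AE x in lebesgue_on (hl K). w x = q x"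
    using pw_polysD[OF assms(2,1)] by blast
  have "piece w K = q" using piece_eq[OF in_T[OF assms(1)] q] .
  then show "piece w K \<in> polys (p_of d)" "AE x in lebesgue_on (hl K). w x = piece w K x" using q by simp_all
qed

lemma piece_polynomial:
  assumes "K \<in> fst ` D" "w \<in> pw_polys D"
  shows "real_polynomial_function (piece w K)"
proof -
  obtain d where "(K, d) \<in> D" using assms(1) by force
  then show ?thesis using piece(1) assms(2) polys_real_polynomial_function by blast
qed

lemma piece_lincomb:
  assumes "K \<in> fst ` D" "w \<in> pw_polys D" "v \<in> pw_polys D"
  shows "piece (\<lambda>x. \<alpha> * w x + \<beta> * v x) K = (\<lambda>x. \<alpha> * piece w K x + \<beta> * piece v K x)"
proof -
  obtain d where d: "(K, d) \<in> D" using assms(1) by force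
  have "AE x in lebesgue_on (hl K). \<alpha> * w x + \<beta> * v x = \<alpha> * piece w K x + \<beta> * piece v K x"
    using piece(2)[OF d assms(2)] piece(2)[OF d assms(3)] by eventually_elim simp
  then show ?thesis
    by (rule piece_eq[OF assms(1) polys_lincomb[OF piece(1)[OF d assms(2)] piece(1)[OF d assms(3)]]])
qed

lemma inner_edges_eq:
  assumes "K \<in> fst ` D"
  shows "inner_edges \<Omega> D K = {e \<in> tri_edges K. rel_interior (convex hull e) \<subseteq> \<Omega>}"
proof -
  have "e \<in> tri_edges K \<longleftrightarrow> e \<in> edges D \<and> convex hull e \<subseteq> frontier (hl K)" for e
    unfolding edges_def using edge_in_frontier_iff[OF assms] assms by blast
  then show ?thesis unfolding inner_edges_def by blast
qed

lemma finite_inner_edges: "K \<in> fst ` D \<Longrightarrow> finite (inner_edges \<Omega> D K)"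
  unfolding inner_edges_eq by (rule finite_subset[of _ "tri_edges K"]) (blast, cases K, simp)

lemma inner_edge_card: "K \<in> fst ` D \<Longrightarrow> e \<in> inner_edges \<Omega> D K \<Longrightarrow> card e = 2"
  using inner_edges_eq[of K] tri_edges_iff[OF noncollinear[of K]] by auto

text \<open>Exactly two triangles have a given interior edge, so the choice in \<open>normal_jump\<close> can only differ
  in their order.\<close>
lemma normal_jump_pair:
  assumes K: "K1 \<in> fst ` D" "K2 \<in> fst ` D" "K1 \<noteq> K2" and e: "e \<in> tri_edges K1" "e \<in> tri_edges K2"
  shows "(\<forall>w x. normal_jump (fst ` D) e w x = (grad (piece w K1) x - grad (piece w K2) x) \<bullet> unit_normal e)
    \<or> (\<forall>w x. normal_jump (fst ` D) e w x = (grad (piece w K2) x - grad (piece w K1) x) \<bullet> unit_normal e)"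
proof -
  let ?Q = "\<lambda>A B. A \<in> fst ` D \<and> B \<in> fst ` D \<and> A \<noteq> B \<and> convex hull e \<subseteq> frontier (hl A) \<and> convex hull e \<subseteq> frontier (hl B)"
  obtain A B where AB: "(SOME (A, B). ?Q A B) = (A, B)" by (cases "SOME (A, B). ?Q A B")
  have "?Q K1 K2" using K edge_in_frontier[OF noncollinear[OF K(1)] e(1)] edge_in_frontier[OF noncollinear[OF K(2)] e(2)] by blast
  then have "case (SOME (A, B). ?Q A B) of (A, B) \<Rightarrow> ?Q A B"
    by (intro someI[of "\<lambda>(A, B). ?Q A B" "(K1, K2)"]) simp
  then have P: "?Q A B" unfolding AB by simp
  then have eA: "e \<in> tri_edges A" "e \<in> tri_edges B"
    using edge_in_frontier_iff[OF _ K(1) e(1), of A] edge_in_frontier_iff[OF _ K(1) e(1), of B] by blast+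
  have "A = K1 \<and> B = K2 \<or> A = K2 \<and> B = K1"
    using at_most_two[OF K(1,2) _ K(3) e eA(1)] at_most_two[OF K(1,2) _ K(3) e eA(2)] P by auto
  moreover have "normal_jump (fst ` D) e w x = (grad (piece w A) x - grad (piece w B) x) \<bullet> unit_normal e" for w x
    unfolding normal_jump_def using AB by simp
  ultimately show ?thesis by blast
qed

lemma normal_jump_sq:
  assumes K: "K1 \<in> fst ` D" "K2 \<in> fst ` D" "K1 \<noteq> K2" and e: "e \<in> tri_edges K1" "e \<in> tri_edges K2"
  shows "(normal_jump (fst ` D) e w x)\<^sup>2 = ((grad (piece w K1) x - grad (piece w K2) x) \<bullet> unit_normal e)\<^sup>2"
proof -
  have "(grad (piece w K2) x - grad (piece w K1) x) \<bullet> unit_normal e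
      = - ((grad (piece w K1) x - grad (piece w K2) x) \<bullet> unit_normal e)"
    by (simp add: inner_diff_left)
  then show ?thesis using normal_jump_pair[OF assms] by (metis power2_minus)
qed

lemma inner_edge_pair:
  assumes "K \<in> fst ` D" "e \<in> inner_edges \<Omega> D K"
  obtains K' where "K' \<in> fst ` D" "K' \<noteq> K" "e \<in> tri_edges K" "e \<in> tri_edges K'"
proof -
  have e: "e \<in> tri_edges K" "rel_interior (convex hull e) \<subseteq> \<Omega>" using assms(2) unfolding inner_edges_eq[OF assms(1)] by auto
  show ?thesis by (rule neighbour[OF assms(1) e]) (use that e in blast)
qed

lemma normal_jump_linear_continuous:
  assumes K: "K \<in> fst ` D" and e: "e \<in> inner_edges \<Omega> D K" and w: "w \<in> pw_polys D" "v \<in> pw_polys D"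
  shows "normal_jump (fst ` D) e (\<lambda>x. \<alpha> * w x + \<beta> * v x) x
     = \<alpha> * normal_jump (fst ` D) e w x + \<beta> * normal_jump (fst ` D) e v x"
    "continuous_on UNIV (normal_jump (fst ` D) e w)"
proof -
  obtain K' where K': "K' \<in> fst ` D" "K' \<noteq> K" "e \<in> tri_edges K" "e \<in> tri_edges K'"
    by (rule inner_edge_pair[OF K e])
  obtain A B where AB: "A \<in> fst ` D" "B \<in> fst ` D" and
    J: "\<And>w x. normal_jump (fst ` D) e w x = (grad (piece w A) x - grad (piece w B) x) \<bullet> unit_normal e"
    using normal_jump_pair[OF K K'(1) K'(2)[symmetric] K'(3,4)] K K'(1) by blast
  note p = piece_polynomial[OF AB(1) w(1)] piece_polynomial[OF AB(2) w(1)]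
    piece_polynomial[OF AB(1) w(2)] piece_polynomial[OF AB(2) w(2)]
  show "normal_jump (fst ` D) e (\<lambda>x. \<alpha> * w x + \<beta> * v x) x
     = \<alpha> * normal_jump (fst ` D) e w x + \<beta> * normal_jump (fst ` D) e v x"
    unfolding J piece_lincomb[OF AB(1) w] piece_lincomb[OF AB(2) w] grad_lincomb[OF p(1,3)] grad_lincomb[OF p(2,4)]
    by (simp add: algebra_simps)
  show "continuous_on UNIV (normal_jump (fst ` D) e w)"
    unfolding J[abs_def] by (rule grad_inner_continuous[OF p(1,2)])
qed

lemma edge_term_nonneg:
  assumes "K \<in> fst ` D" "e \<in> inner_edges \<Omega> D K" "w \<in> pw_polys D"
  shows "0 \<le> edge_integral e (\<lambda>x. (normal_jump (fst ` D) e w x)\<^sup>2)"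
  using normal_jump_linear_continuous(2)[OF assms assms(3)] inner_edge_card[OF assms(1,2)]
  by (intro edge_integral_nonneg continuous_on_power) simp_all

lemma indicator_sq_nonneg:
  assumes "E \<in> D" "w \<in> pw_polys D"
  shows "0 \<le> indicator_sq \<Omega> D w f E"
proof -
  obtain K d where E: "E = (K, d)" by (cases E)
  have K: "K \<in> fst ` D" using assms(1) E by force
  have "0 \<le> (LINT x|lebesgue_on (hl K). (f x + laplacian (piece w K) x)\<^sup>2)" by (simp add: integral_nonneg_AE)
  then show ?thesis unfolding indicator_sq_def E prod.case
    using edge_term_nonneg[OF K _ assms(2)]
    by (intro add_nonneg_nonneg sum_nonneg mult_nonneg_nonneg divide_nonneg_nonneg)
      (simp_all add: diameter_ge_0 finite_imp_bounded card_ge_0_finite inner_edge_card[OF K])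
qed

text \<open>The right-hand side agrees with a polynomial only almost everywhere on the triangle. Completeness of
  the Lebesgue measure makes it measurable.\<close>
lemma residual_integrable:
  assumes "(K, d) \<in> D" "f \<in> F_space D" "w \<in> pw_polys D"
  shows "integrable (lebesgue_on (hl K)) (\<lambda>x. (f x + laplacian (piece w K) x)\<^sup>2)"
proof -
  obtain q where q: "q \<in> polys (p_of d - 1)" "AE x in lebesgue_on (hl K). f x = q x"
    using F_spaceD[OF assms(2,1)] by blast
  have c: "continuous_on UNIV q" "continuous_on UNIV (laplacian (piece w K))"
    using polys_real_polynomial_function[OF q(1)] piece_polynomial[OF in_T[OF assms(1)] assms(3)]
    by (auto intro: real_polynomial_function_continuous real_polynomial_function_laplacian)
  have i: "integrable (lebesgue_on (hl K)) (\<lambda>x. (q x + laplacian (piece w K) x)\<^sup>2)"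
    by (intro integrable_continuous_compact hl_compact continuous_intros c)
  have ae: "AE x in lebesgue_on (hl K). (f x + laplacian (piece w K) x)\<^sup>2 = (q x + laplacian (piece w K) x)\<^sup>2"
    using q(2) by eventually_elim simp
  show ?thesis
    by (subst integrable_cong_AE[OF _ _ ae])
      (use i borel_measurable_lebesgue_on_AE[OF hl_lebesgue _ ae] in \<open>auto dest: borel_measurable_integrable\<close>)
qed

text \<open>Residual and jump depend affinely on \<open>(w, f)\<close>, and both norms in the indicator are quadratic. The
  difference of the data of \<open>w\<close> and \<open>v\<close> has right-hand side zero.\<close>
lemma indicator_sq_young:
  assumes E: "E \<in> D" and f: "f \<in> F_space D" and w: "w \<in> pw_polys D" "v \<in> pw_polys D" and \<delta>: "\<delta> > 0"
  shows "indicator_sq \<Omega> D w f E \<le> (1 + \<delta>) * indicator_sq \<Omega> D v f E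
     + (1 + 1 / \<delta>) * indicator_sq \<Omega> D (\<lambda>x. 1 * w x + (- 1) * v x) (\<lambda>x. 0) E"
proof -
  obtain K d where Kd: "E = (K, d)" by (cases E)
  have D: "(K, d) \<in> D" and K: "K \<in> fst ` D" using E Kd by force+
  let ?z = "\<lambda>x. 1 * w x + (- 1) * v x"
  let ?V = "\<lambda>w f. LINT x|lebesgue_on (hl K). (f x + laplacian (piece w K) x)\<^sup>2"
  let ?J = "\<lambda>w e. edge_integral e (\<lambda>x. (normal_jump (fst ` D) e w x)\<^sup>2)"
  let ?c = "\<lambda>e. diameter e / (2 * real (p_edge D e))"
  have z: "?z \<in> pw_polys D" by (rule pw_polys_lincomb[OF w])
  note p = piece_polynomial[OF K w(1)] piece_polynomial[OF K w(2)]
  have lz: "laplacian (piece ?z K) x = laplacian (piece w K) x - laplacian (piece v K) x" for x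
    unfolding piece_lincomb[OF K w] laplacian_lincomb[OF p] by simp
  note i = residual_integrable[OF D f w(1)] residual_integrable[OF D f w(2)] residual_integrable[OF D zero_F_space z]
  have "?V w f \<le> (LINT x|lebesgue_on (hl K). (1 + \<delta>) * (f x + laplacian (piece v K) x)\<^sup>2
      + (1 + 1 / \<delta>) * (0 + laplacian (piece ?z K) x)\<^sup>2)"
  proof (rule integral_mono[OF i(1)])
    show "integrable (lebesgue_on (hl K)) (\<lambda>x. (1 + \<delta>) * (f x + laplacian (piece v K) x)\<^sup>2
      + (1 + 1 / \<delta>) * (0 + laplacian (piece ?z K) x)\<^sup>2)"
      by (intro Bochner_Integration.integrable_add integrable_mult_right i(2,3))
    fix x
    have "f x + laplacian (piece w K) x = (f x + laplacian (piece v K) x) + (0 + laplacian (piece ?z K) x)"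
      unfolding lz by simp
    then show "(f x + laplacian (piece w K) x)\<^sup>2 \<le> (1 + \<delta>) * (f x + laplacian (piece v K) x)\<^sup>2
      + (1 + 1 / \<delta>) * (0 + laplacian (piece ?z K) x)\<^sup>2"
      using young[OF \<delta>] by (simp only:)
  qed
  also have "\<dots> = (1 + \<delta>) * ?V v f + (1 + 1 / \<delta>) * ?V ?z (\<lambda>x. 0)"
    using i(2,3) by (subst Bochner_Integration.integral_add) (intro integrable_mult_right; assumption | simp)+
  finally have V: "?V w f \<le> (1 + \<delta>) * ?V v f + (1 + 1 / \<delta>) * ?V ?z (\<lambda>x. 0)" .
  have J: "?c e * ?J w e \<le> (1 + \<delta>) * (?c e * ?J v e) + (1 + 1 / \<delta>) * (?c e * ?J ?z e)"
    if e: "e \<in> inner_edges \<Omega> D K" for e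
  proof -
    note c = normal_jump_linear_continuous[OF K e]
    have "?J w e \<le> (1 + \<delta>) * ?J v e + (1 + 1 / \<delta>) * ?J ?z e"
    proof (rule edge_integral_le_lincomb)
      show "continuous_on UNIV (\<lambda>x. (normal_jump (fst ` D) e w x)\<^sup>2)"
        "continuous_on UNIV (\<lambda>x. (normal_jump (fst ` D) e v x)\<^sup>2)"
        "continuous_on UNIV (\<lambda>x. (normal_jump (fst ` D) e ?z x)\<^sup>2)"
        by (rule continuous_on_power, rule c(2)[OF w(1) w(1)], rule continuous_on_power, rule c(2)[OF w(2) w(2)],
            rule continuous_on_power, rule c(2)[OF z z])
      show "card e = 2" by (rule inner_edge_card[OF K e])
      fix x
      have "normal_jump (fst ` D) e w x = normal_jump (fst ` D) e v x + normal_jump (fst ` D) e ?z x"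
        unfolding c(1)[OF w] by simp
      then show "(normal_jump (fst ` D) e w x)\<^sup>2 \<le> (1 + \<delta>) * (normal_jump (fst ` D) e v x)\<^sup>2
         + (1 + 1 / \<delta>) * (normal_jump (fst ` D) e ?z x)\<^sup>2"
        using young[OF \<delta>] by (simp only:)
    qed
    moreover have "0 \<le> ?c e"
      by (intro divide_nonneg_nonneg diameter_ge_0) (simp_all add: finite_imp_bounded card_ge_0_finite inner_edge_card[OF K e])
    ultimately have "?c e * ?J w e \<le> ?c e * ((1 + \<delta>) * ?J v e + (1 + 1 / \<delta>) * ?J ?z e)"
      by (rule mult_left_mono)
    then show ?thesis by (simp only: distrib_left mult.left_commute)
  qed
  have "(\<Sum>e\<in>inner_edges \<Omega> D K. ?c e * ?J w e)
     \<le> (\<Sum>e\<in>inner_edges \<Omega> D K. (1 + \<delta>) * (?c e * ?J v e) + (1 + 1 / \<delta>) * (?c e * ?J ?z e))"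
    by (rule sum_mono) (rule J)
  also have "\<dots> = (1 + \<delta>) * (\<Sum>e\<in>inner_edges \<Omega> D K. ?c e * ?J v e) + (1 + 1 / \<delta>) * (\<Sum>e\<in>inner_edges \<Omega> D K. ?c e * ?J ?z e)"
    by (simp only: sum.distrib sum_distrib_left)
  finally have S: "(\<Sum>e\<in>inner_edges \<Omega> D K. ?c e * ?J w e) \<le> (1 + \<delta>) * (\<Sum>e\<in>inner_edges \<Omega> D K. ?c e * ?J v e)
     + (1 + 1 / \<delta>) * (\<Sum>e\<in>inner_edges \<Omega> D K. ?c e * ?J ?z e)" .
  define A where "A = measure lebesgue (hl K) / (real (p_of d))\<^sup>2"
  have "A * ?V w f \<le> A * ((1 + \<delta>) * ?V v f + (1 + 1 / \<delta>) * ?V ?z (\<lambda>x. 0))"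
    by (rule mult_left_mono[OF V]) (simp add: A_def)
  then have "A * ?V w f \<le> (1 + \<delta>) * (A * ?V v f) + (1 + 1 / \<delta>) * (A * ?V ?z (\<lambda>x. 0))"
    by (simp only: distrib_left mult.left_commute)
  from add_mono[OF this S] show ?thesis
    unfolding indicator_sq_def Kd prod.case A_def[symmetric] by (simp only: distrib_left add_ac)
qed

lemma estimator_sq:
  assumes "M \<subseteq> D" "w \<in> pw_polys D"
  shows "(estimator \<Omega> D M w f)\<^sup>2 = (\<Sum>E\<in>M. indicator_sq \<Omega> D w f E)"
  unfolding estimator_def using assms indicator_sq_nonneg by (intro real_sqrt_pow2 sum_nonneg) blast

lemma estimator_young:
  assumes "f \<in> F_space D" and w: "w \<in> pw_polys D" "v \<in> pw_polys D" and "\<delta> > 0"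
  shows "(estimator \<Omega> D D w f)\<^sup>2 \<le> (1 + \<delta>) * (estimator \<Omega> D D v f)\<^sup>2
     + (1 + 1 / \<delta>) * (estimator \<Omega> D D (\<lambda>x. 1 * w x + (- 1) * v x) (\<lambda>x. 0))\<^sup>2"
  unfolding estimator_sq[OF order_refl w(1)] estimator_sq[OF order_refl w(2)]
    estimator_sq[OF order_refl pw_polys_lincomb[OF w]] sum_distrib_left sum.distrib[symmetric]
  by (intro sum_mono indicator_sq_young assms)

lemma pmax_pos: "\<Omega> \<noteq> {} \<Longrightarrow> 1 \<le> pmax D"
proof -
  assume "\<Omega> \<noteq> {}"
  then have "fst ` D \<noteq> {}" using cover closure_subset[of \<Omega>] by auto
  then obtain K d where Kd: "(K, d) \<in> D" by auto
  have "p_of d \<le> pmax D" unfolding pmax_def using Kd finite_D by (intro Max_ge) force+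
  then show ?thesis using p_of_pos[OF degree_pos[OF Kd]] by linarith
qed

text \<open>Off the boundaries of the triangles, which form a null set, \<open>f\<close> agrees with a Borel function that
  is polynomial on each open triangle.\<close>
lemma F_space_L2:
  assumes f: "f \<in> F_space D"
  shows "f \<in> L2 \<Omega>"
proof -
  have "\<forall>K\<in>fst ` D. \<exists>q. real_polynomial_function q \<and> (AE x in lebesgue_on (hl K). f x = q x)"
  proof
    fix K assume "K \<in> fst ` D"
    then obtain d where "(K, d) \<in> D" by force
    from F_spaceD[OF f this] obtain q' where q': "q' \<in> polys (p_of d - 1)" "AE x in lebesgue_on (hl K). f x = q' x" by blast
    show "\<exists>q. real_polynomial_function q \<and> (AE x in lebesgue_on (hl K). f x = q x)"
      by (intro exI[of _ q'] conjI polys_real_polynomial_function[OF q'(1)] q'(2))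
  qed
  from bchoice[OF this] obtain q where qq:
    "\<forall>K\<in>fst ` D. real_polynomial_function (q K) \<and> (AE x in lebesgue_on (hl K). f x = q K x)" ..
  have q: "real_polynomial_function (q K)" "AE x in lebesgue_on (hl K). f x = q K x" if "K \<in> fst ` D" for K
    using qq that by blast+
  define g where "g x = (\<Sum>K\<in>fst ` D. indicator (interior (hl K)) x * q K x)" for x
  have m\<Omega>: "\<Omega> \<in> sets lebesgue" using open_\<Omega> by auto
  have gm: "g \<in> borel_measurable (lebesgue_on \<Omega>)"
  proof -
    have "g \<in> borel_measurable borel" unfolding g_def[abs_def]
      by (intro borel_measurable_sum borel_measurable_times borel_measurable_indicator
          borel_measurable_continuous_onI real_polynomial_function_continuous q(1)) simp_all
    then have "g \<in> borel_measurable lebesgue" by (simp add: measurable_completion)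
    then show ?thesis by (rule measurable_restrict_space1)
  qed
  have geq: "g x = q K x" if K: "K \<in> fst ` D" "x \<in> interior (hl K)" for K x
  proof -
    have "g x = (\<Sum>K'\<in>fst ` D. if K' = K then q K x else 0)"
      unfolding g_def
    proof (intro sum.cong refl)
      fix K' assume K': "K' \<in> fst ` D"
      show "indicator (interior (hl K')) x * q K' x = (if K' = K then q K x else 0)"
      proof (cases "K' = K")
        case True
        then show ?thesis using K(2) by simp
      next
        case False
        then have "x \<notin> interior (hl K')" using disjoint[OF K' K(1)] K(2) by blast
        then show ?thesis using False by simp
      qed
    qed
    then show ?thesis using K(1) finite_T by simp
  qed
  have "AE x in lebesgue. x \<in> \<Omega> \<longrightarrow> f x = g x"
  proof -
    have 1: "AE x in lebesgue. \<forall>K\<in>fst ` D. x \<in> hl K \<longrightarrow> f x = q K x"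
      using q(2) by (subst AE_finite_all[OF finite_T]) (simp add: AE_restrict_space_iff hl_lebesgue)
    have "negligible (\<Union>K\<in>fst ` D. frontier (hl K))"
      using finite_T by (intro negligible_Union) (auto intro: negligible_convex_frontier hl_convex)
    then have 2: "AE x in lebesgue. x \<notin> (\<Union>K\<in>fst ` D. frontier (hl K))"
      by (intro AE_not_in) (simp add: negligible_iff_null_sets)
    show ?thesis using 1 2
    proof eventually_elim
      case (elim x)
      show ?case
      proof
        assume "x \<in> \<Omega>"
        then obtain K where K: "K \<in> fst ` D" "x \<in> hl K" using cover closure_subset[of \<Omega>] by blast
        then have "x \<in> interior (hl K)" using elim(2) hl_closed[of K] by (auto simp: frontier_def)
        then show "f x = g x" using geq[OF K(1)] elim(1) K by metis
      qed
    qed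
  qed
  then have ae: "AE x in lebesgue_on \<Omega>. f x = g x" using m\<Omega> by (simp add: AE_restrict_space_iff)
  have "\<forall>K\<in>fst ` D. \<exists>B. \<forall>x\<in>hl K. \<bar>q K x\<bar> \<le> B"
  proof
    fix K assume K: "K \<in> fst ` D"
    have "bounded (q K ` hl K)"
      by (intro compact_imp_bounded compact_continuous_image hl_compact real_polynomial_function_continuous q(1) K)
    then show "\<exists>B. \<forall>x\<in>hl K. \<bar>q K x\<bar> \<le> B" unfolding bounded_iff by auto
  qed
  then obtain B where B: "\<And>K x. K \<in> fst ` D \<Longrightarrow> x \<in> hl K \<Longrightarrow> \<bar>q K x\<bar> \<le> B K" by metis
  have "\<bar>g x\<bar> \<le> (\<Sum>K\<in>fst ` D. \<bar>B K\<bar>)" for x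
  proof -
    have "\<bar>g x\<bar> \<le> (\<Sum>K\<in>fst ` D. \<bar>indicator (interior (hl K)) x * q K x\<bar>)"
      unfolding g_def by (rule sum_abs)
    also have "\<dots> \<le> (\<Sum>K\<in>fst ` D. \<bar>B K\<bar>)"
    proof (rule sum_mono)
      fix K assume K: "K \<in> fst ` D"
      show "\<bar>indicator (interior (hl K)) x * q K x\<bar> \<le> \<bar>B K\<bar>"
        using B[OF K, of x] interior_subset[of "hl K"] by (cases "x \<in> interior (hl K)") (auto intro: order_trans[OF _ abs_ge_self])
    qed
    finally show ?thesis .
  qed
  then have "g \<in> L2 \<Omega>" by (intro L2_bounded[OF bounded_\<Omega> m\<Omega> gm])
  then have i: "integrable (lebesgue_on \<Omega>) (\<lambda>x. (g x)\<^sup>2)" by (simp add: L2_def)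
  have fm: "f \<in> borel_measurable (lebesgue_on \<Omega>)" by (rule borel_measurable_lebesgue_on_AE[OF m\<Omega> gm ae])
  have "AE x in lebesgue_on \<Omega>. (f x)\<^sup>2 = (g x)\<^sup>2" using ae by eventually_elim simp
  then have "integrable (lebesgue_on \<Omega>) (\<lambda>x. (f x)\<^sup>2)"
    using i fm gm by (subst integrable_cong_AE[of _ _ "\<lambda>x. (g x)\<^sup>2"]) auto
  then show ?thesis using fm by (simp add: L2_def)
qed

end

section \<open>The error estimator under refinement\<close>

lemma AE_lebesgue_on_subset:
  assumes "AE x in lebesgue_on S. P x" "S' \<subseteq> S" "S \<in> sets lebesgue" "S' \<in> sets lebesgue"
  shows "AE x in lebesgue_on S'. P x"
proof -
  have "AE x in lebesgue. x \<in> S \<longrightarrow> P x" using assms by (simp add: AE_restrict_space_iff)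
  then have "AE x in lebesgue. x \<in> S' \<longrightarrow> P x" by eventually_elim (use assms(2) in blast)
  then show ?thesis using assms by (simp add: AE_restrict_space_iff)
qed

lemma grandchildren_cover:
  assumes "\<not> collinear (verts K)"
  shows "(\<Union>g\<in>grandchildren K. hl g) = hl K"
proof -
  have "(\<Union>g\<in>grandchildren K. hl g) = (\<Union>K'\<in>children K. (\<Union>g\<in>children K'. hl g))"
    unfolding grandchildren_def by blast
  also have "\<dots> = (\<Union>K'\<in>children K. hl K')"
    using children_cover[OF children_noncollinear[OF assms]] by simp
  also have "\<dots> = hl K" by (rule children_cover[OF assms])
  finally show ?thesis .
qed

lemma grandchild_noncollinear:
  "\<not> collinear (verts K) \<Longrightarrow> g \<in> grandchildren K \<Longrightarrow> \<not> collinear (verts g)"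
  unfolding grandchildren_def using children_noncollinear by blast

lemma grandchild_area:
  assumes "g \<in> grandchildren K"
  shows "measure lebesgue (hl g) = measure lebesgue (hl K) / 4"
proof -
  obtain K' where K': "K' \<in> children K" "g \<in> children K'" using assms unfolding grandchildren_def by blast
  show ?thesis unfolding child_area[OF K'(2)] child_area[OF K'(1)] by simp
qed

text \<open>Two bisections, and not one, put a new vertex on the midpoint of every side of \<open>K\<close>. This is why
  marked elements are replaced by their grandchildren: all edges on the boundary of \<open>K\<close> are halved.\<close>
lemma grandchild_edge_midpoint:
  assumes "g \<in> grandchildren K" "e' \<in> tri_edges g"
  shows "\<exists>p q. {p, q} \<in> tri_edges K \<and> midpoint p q \<in> e'"
proof -
  obtain v a b where K: "K = (v, a, b)" by (cases K)
  let ?m = "midpoint a b" and ?n = "midpoint v a" and ?l = "midpoint v b"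
  have "g \<in> {(?n, ?m, v), (?n, ?m, a), (?l, ?m, v), (?l, ?m, b)}"
    using assms(1) unfolding grandchildren_def K by auto
  then have "?m \<in> e' \<or> ?n \<in> e' \<or> ?l \<in> e'" using assms(2) by auto
  moreover have "{a, b} \<in> tri_edges K" "{v, a} \<in> tri_edges K" "{v, b} \<in> tri_edges K" by (simp_all add: K)
  ultimately show ?thesis by blast
qed

lemma grandchild_subedge_diameter:
  assumes nc: "\<not> collinear (verts K)" and g: "g \<in> grandchildren K" and e': "e' \<in> tri_edges g"
    and e: "e \<in> tri_edges K" and sub: "convex hull e' \<subseteq> convex hull e"
  shows "diameter e' \<le> (1/2) * diameter e"
proof -
  obtain p q where pq: "{p, q} \<in> tri_edges K" "midpoint p q \<in> e'"
    using grandchild_edge_midpoint[OF g e'] by blast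
  have h: "{p, q} \<subseteq> verts K" "card {p, q} = 2" and e2: "e \<subseteq> verts K" "card e = 2"
    using pq(1) e unfolding tri_edges_iff[OF nc] by auto
  have c': "card e' = 2" using e' tri_edges_iff[OF grandchild_noncollinear[OF nc g]] by blast
  have n: "p \<noteq> q" using h(2) by auto
  have "midpoint p q \<in> convex hull e" using hull_inc[OF pq(2)] sub by blast
  moreover have "midpoint p q \<in> convex hull {p, q}"
    unfolding segment_convex_hull[symmetric] by (rule midpoint_in_closed_segment)
  ultimately have mF: "midpoint p q \<in> convex hull ({p, q} \<inter> e)"
    using faces_Int[OF nc h(1) e2(1)] by blast
  have "{p, q} \<inter> e = {p, q}"
  proof (rule ccontr)
    assume "{p, q} \<inter> e \<noteq> {p, q}"
    then consider "{p, q} \<inter> e = {}" | "{p, q} \<inter> e = {p}" | "{p, q} \<inter> e = {q}" by auto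
    then show False
      by cases (use mF n in \<open>simp_all only: convex_hull_empty convex_hull_singleton empty_iff singleton_iff midpoint_eq_endpoint\<close>)
  qed
  then have "{p, q} \<subseteq> e" by blast
  then have "e = {p, q}" using card_subset_eq[of e "{p, q}"] e2(2) h(2) card_ge_0_finite[of e] by simp
  then show ?thesis using diameter_subedge(2)[OF c' e2(2) sub _ pq(2)] by simp
qed

lemma (in hp_mesh) p_edge_pos:
  assumes "(K, d) \<in> D" "e \<in> tri_edges K"
  shows "1 \<le> p_edge D e"
proof -
  let ?S = "{p_of d | K d. (K, d) \<in> D \<and> convex hull e \<subseteq> frontier (hl K)}"
  have fin: "finite ?S"
    by (rule finite_subset[of _ "(\<lambda>(K, d). p_of d) ` D"]) (use finite_D in force)+
  have "p_of d \<in> ?S" using assms edge_in_frontier[OF noncollinear[OF in_T[OF assms(1)]] assms(2)] by blast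
  then have "Min ?S \<in> ?S" by (intro Min_in fin) blast
  then obtain K' d' where "(K', d') \<in> D" "Min ?S = p_of d'" by blast
  then show ?thesis unfolding p_edge_def using p_of_pos[OF degree_pos] by metis
qed

locale hp_refinement = coarse: hp_mesh \<Omega> D + fine: hp_mesh \<Omega> D'
  for \<Omega> :: "point set" and D D' :: hp +
  assumes refines: "refines (fst ` D') (fst ` D)"
    and inherit: "(K', d') \<in> D' \<Longrightarrow> (K, d) \<in> D \<Longrightarrow> hl K' \<subseteq> hl K \<Longrightarrow> d' = d"
begin

lemma parent: "K' \<in> fst ` D' \<Longrightarrow> \<exists>K\<in>fst ` D. hl K' \<subseteq> hl K"
  using refines unfolding refines_def by blast

lemma parent_unique:
  assumes "K' \<in> fst ` D'" "K1 \<in> fst ` D" "K2 \<in> fst ` D" "hl K' \<subseteq> hl K1" "hl K' \<subseteq> hl K2"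
  shows "K1 = K2"
  by (rule coarse.hl_subset_eq[OF assms(2-5) interior_hl_nonempty[OF fine.noncollinear[OF assms(1)]]])

lemma F_space_mono:
  assumes f: "f \<in> F_space D"
  shows "f \<in> F_space D'"
proof -
  have "\<exists>q\<in>polys (p_of d' - 1). AE x in lebesgue_on (hl K'). f x = q x" if E': "(K', d') \<in> D'" for K' d'
  proof -
    obtain K d where K: "(K, d) \<in> D" "hl K' \<subseteq> hl K" using parent[OF fine.in_T[OF E']] by force
    obtain q where q: "q \<in> polys (p_of d - 1)" "AE x in lebesgue_on (hl K). f x = q x"
      using F_spaceD[OF f K(1)] by blast
    show ?thesis using q(1) AE_lebesgue_on_subset[OF q(2) K(2) hl_lebesgue hl_lebesgue]
      unfolding inherit[OF E' K] by blast
  qed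
  then show ?thesis unfolding F_space_def by blast
qed

lemma pw_polys_mono:
  assumes w: "w \<in> pw_polys D"
  shows "w \<in> pw_polys D'"
proof -
  have "\<exists>q\<in>polys (p_of d'). AE x in lebesgue_on (hl K'). w x = q x" if E': "(K', d') \<in> D'" for K' d'
  proof -
    obtain K d where K: "(K, d) \<in> D" "hl K' \<subseteq> hl K" using parent[OF fine.in_T[OF E']] by force
    obtain q where q: "q \<in> polys (p_of d)" "AE x in lebesgue_on (hl K). w x = q x"
      using pw_polysD[OF w K(1)] by blast
    show ?thesis using q(1) AE_lebesgue_on_subset[OF q(2) K(2) hl_lebesgue hl_lebesgue]
      unfolding inherit[OF E' K] by blast
  qed
  then show ?thesis unfolding pw_polys_def by blast
qed

lemma piece_refine:
  assumes "K' \<in> fst ` D'" "K \<in> fst ` D" "hl K' \<subseteq> hl K" and w: "w \<in> pw_polys D"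
  shows "piece w K' = piece w K"
proof -
  obtain d where d: "(K, d) \<in> D" using assms(2) by force
  show ?thesis
    by (rule fine.piece_eq[OF assms(1) coarse.piece(1)[OF d w]
          AE_lebesgue_on_subset[OF coarse.piece(2)[OF d w] assms(3) hl_lebesgue hl_lebesgue]])
qed

lemma pmax_eq: "pmax D' = pmax D"
proof -
  have "(\<lambda>(K, d). p_of d) ` D' = (\<lambda>(K, d). p_of d) ` D"
  proof (intro equalityI subsetI)
    fix p assume "p \<in> (\<lambda>(K, d). p_of d) ` D'"
    then obtain K' d' where E': "(K', d') \<in> D'" "p = p_of d'" by auto
    obtain K d where K: "(K, d) \<in> D" "hl K' \<subseteq> hl K" using parent[OF fine.in_T[OF E'(1)]] by force
    show "p \<in> (\<lambda>(K, d). p_of d) ` D" using K(1) E'(2) inherit[OF E'(1) K] by force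
  next
    fix p assume "p \<in> (\<lambda>(K, d). p_of d) ` D"
    then obtain K d where E: "(K, d) \<in> D" "p = p_of d" by auto
    have K: "K \<in> fst ` D" by (rule coarse.in_T[OF E(1)])
    obtain y where y: "y \<in> interior (hl K)" using interior_hl_nonempty[OF coarse.noncollinear[OF K]] by blast
    then have "y \<in> closure \<Omega>" using interior_subset coarse.hl_subset_closure[OF K] by blast
    then obtain K' where K': "K' \<in> fst ` D'" "y \<in> hl K'" using fine.cover by blast
    obtain K2 where K2: "K2 \<in> fst ` D" "hl K' \<subseteq> hl K2" using parent[OF K'(1)] by blast
    have "interior (hl K) \<inter> interior (hl K') \<noteq> {}"
      using y K'(2) closure_interior_hl[OF fine.noncollinear[OF K'(1)]] open_Int_closure_eq_empty[OF open_interior]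
      by blast
    then have "K = K2" using coarse.disjoint[OF K K2(1)] interior_mono[OF K2(2)] by blast
    then have sub: "hl K' \<subseteq> hl K" using K2 by simp
    obtain d' where "(K', d') \<in> D'" using K'(1) by force
    then show "p \<in> (\<lambda>(K, d). p_of d) ` D'" using E inherit[OF _ E(1) sub] by force
  qed
  then show ?thesis unfolding pmax_def by simp
qed

lemma edge_subset_hl:
  assumes "\<not> collinear (verts K)" "e \<in> tri_edges K"
  shows "convex hull e \<subseteq> hl K"
  using edge_in_frontier[OF assms] frontier_subset_closed[OF hl_closed] by blast

text \<open>Two triangles inside \<open>K\<close> cover a neighbourhood of the relative interior of their common edge,
  which therefore lies in the interior of \<open>K\<close>.\<close>
lemma siblings_share_no_boundary_edge:
  assumes K': "K1' \<in> fst ` D'" "K2' \<in> fst ` D'" "K1' \<noteq> K2'" and e': "e' \<in> tri_edges K1'" "e' \<in> tri_edges K2'"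
    and sub: "hl K1' \<subseteq> hl K" "hl K2' \<subseteq> hl K"
    and K: "K \<in> fst ` D" and e: "e \<in> tri_edges K" "convex hull e' \<subseteq> convex hull e"
  shows False
proof -
  have "rel_interior (convex hull e') \<subseteq> interior (hl K1' \<union> hl K2')"
    by (rule fine.shared_edge_interior[OF K' e'])
  also have "\<dots> \<subseteq> interior (hl K)" using sub by (intro interior_mono) blast
  finally have 1: "rel_interior (convex hull e') \<subseteq> interior (hl K)" .
  have "e' \<noteq> {}" using e'(1) tri_edges_iff[OF fine.noncollinear[OF K'(1)]] by auto
  then have "rel_interior (convex hull e') \<noteq> {}"
    using rel_interior_eq_empty[OF convex_convex_hull, of e'] by simp
  then obtain x where x: "x \<in> rel_interior (convex hull e')" by blast
  then have "x \<in> frontier (hl K)"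
    using rel_interior_subset e edge_in_frontier[OF coarse.noncollinear[OF K] e(1)] by blast
  then show False using 1 x by (auto simp: frontier_def)
qed

lemma edge_two_points:
  assumes "K' \<in> fst ` D'" "e' \<in> tri_edges K'"
  obtains x y where "x \<noteq> y" "x \<in> convex hull e'" "y \<in> convex hull e'"
proof -
  have "card e' = 2" using assms tri_edges_iff[OF fine.noncollinear] by blast
  then obtain x y where "e' = {x, y}" "x \<noteq> y" unfolding card_2_iff by blast
  then show ?thesis by (intro that[of x y]) (simp_all add: hull_inc)
qed

text \<open>The edge lies in the intersection of the two parents, which by conformity is a common edge of them.\<close>
lemma cousins_share_edge:
  assumes K': "K1' \<in> fst ` D'" "K2' \<in> fst ` D'" and e': "e' \<in> tri_edges K1'" "e' \<in> tri_edges K2'"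
    and K: "K1 \<in> fst ` D" "K2 \<in> fst ` D" "K1 \<noteq> K2" and sub: "hl K1' \<subseteq> hl K1" "hl K2' \<subseteq> hl K2"
  obtains e where "e \<in> tri_edges K1" "e \<in> tri_edges K2" "convex hull e' \<subseteq> convex hull e"
proof -
  obtain x y where xy: "x \<noteq> y" "x \<in> convex hull e'" "y \<in> convex hull e'" by (rule edge_two_points[OF K'(1) e'(1)])
  have s: "convex hull e' \<subseteq> hl K1" "convex hull e' \<subseteq> hl K2"
    using edge_subset_hl[OF fine.noncollinear[OF K'(1)] e'(1)] edge_subset_hl[OF fine.noncollinear[OF K'(2)] e'(2)] sub
    by blast+
  obtain e where "e \<in> tri_edges K1" "e \<in> tri_edges K2" "hl K1 \<inter> hl K2 = convex hull e"
    by (rule coarse.common_edge[OF K xy(1)]) (use xy s in blast)+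
  then show ?thesis using that s by blast
qed

text \<open>The two triangles at \<open>e'\<close> descend from the two triangles at \<open>e\<close>, one from each. Hence the
  polynomial pieces on both sides, and the degrees, are those at \<open>e\<close>.\<close>
lemma subedge_of_inner_edge:
  assumes K': "K' \<in> fst ` D'" and K: "K \<in> fst ` D" and sub: "hl K' \<subseteq> hl K"
    and e': "e' \<in> inner_edges \<Omega> D' K'" and e: "e \<in> tri_edges K" "convex hull e' \<subseteq> convex hull e"
  shows "e \<in> inner_edges \<Omega> D K"
    "p_edge D e \<le> p_edge D' e'"
    "w \<in> pw_polys D \<Longrightarrow> (normal_jump (fst ` D') e' w x)\<^sup>2 = (normal_jump (fst ` D) e w x)\<^sup>2"
proof -
  obtain K2' where K2': "K2' \<in> fst ` D'" "K2' \<noteq> K'" "e' \<in> tri_edges K'" "e' \<in> tri_edges K2'"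
    by (rule fine.inner_edge_pair[OF K' e'])
  obtain K2 where K2: "K2 \<in> fst ` D" "hl K2' \<subseteq> hl K2" using parent[OF K2'(1)] by blast
  have ne: "K \<noteq> K2"
    using siblings_share_no_boundary_edge[OF K' K2'(1) K2'(2)[symmetric] K2'(3,4) sub _ K e] K2(2) by blast
  obtain g where g: "g \<in> tri_edges K" "g \<in> tri_edges K2" "convex hull e' \<subseteq> convex hull g"
    by (rule cousins_share_edge[OF K' K2'(1,3,4) K K2(1) ne sub K2(2)])
  obtain x y where xy: "x \<noteq> y" "x \<in> convex hull e'" "y \<in> convex hull e'" by (rule edge_two_points[OF K' K2'(3)])
  have "e = g"
    by (rule edges_meet[OF coarse.noncollinear[OF K] e(1) g(1) xy(1)]) (use xy e(2) g(3) in blast)+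
  then have e2: "e \<in> tri_edges K2" using g(2) by simp
  show "e \<in> inner_edges \<Omega> D K"
    unfolding coarse.inner_edges_eq[OF K] using e(1) coarse.shared_edge_in_\<Omega>[OF K K2(1) ne e(1) e2] by blast
  show "(normal_jump (fst ` D') e' w x)\<^sup>2 = (normal_jump (fst ` D) e w x)\<^sup>2" if w: "w \<in> pw_polys D" for w x
  proof -
    have c: "card e' = 2" "card e = 2"
      using K2'(3) e(1) tri_edges_iff[OF fine.noncollinear[OF K']] tri_edges_iff[OF coarse.noncollinear[OF K]] by blast+
    show ?thesis
      unfolding fine.normal_jump_sq[OF K' K2'(1) K2'(2)[symmetric] K2'(3,4)] coarse.normal_jump_sq[OF K K2(1) ne e(1) e2]
        piece_refine[OF K' K sub w] piece_refine[OF K2'(1) K2 w]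
      by (rule unit_normal_subedge[OF c e(2)])
  qed
  let ?S = "{p_of d | K d. (K, d) \<in> D \<and> convex hull e \<subseteq> frontier (hl K)}"
  let ?S' = "{p_of d | K d. (K, d) \<in> D' \<and> convex hull e' \<subseteq> frontier (hl K)}"
  obtain dK' where dK': "(K', dK') \<in> D'" using K' by force
  have "p_of dK' \<in> ?S'" using dK' edge_in_frontier[OF fine.noncollinear[OF K'] K2'(3)] by blast
  then have "?S' \<noteq> {}" by blast
  moreover have "finite ?S"
    by (rule finite_subset[of _ "(\<lambda>(K, d). p_of d) ` D"]) (use coarse.finite_D in force)+
  moreover have "?S' \<subseteq> ?S"
  proof
    fix p assume "p \<in> ?S'"
    then obtain L' d' where L': "(L', d') \<in> D'" "convex hull e' \<subseteq> frontier (hl L')" "p = p_of d'" by blast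
    have "e' \<in> tri_edges L'" using fine.edge_in_frontier_iff[OF fine.in_T[OF L'(1)] K' K2'(3)] L'(2) by blast
    then have "L' = K' \<or> L' = K2'"
      using fine.at_most_two[OF K' K2'(1) fine.in_T[OF L'(1)] K2'(2)[symmetric] K2'(3,4)] by blast
    then obtain L where L: "L \<in> fst ` D" "hl L' \<subseteq> hl L" "e \<in> tri_edges L" using K sub e(1) K2 e2 by blast
    obtain d where d: "(L, d) \<in> D" using L(1) by force
    have "convex hull e \<subseteq> frontier (hl L)" by (rule edge_in_frontier[OF coarse.noncollinear[OF L(1)] L(3)])
    then show "p \<in> ?S" using d L'(3) inherit[OF L'(1) d L(2)] by blast
  qed
  ultimately show "p_edge D e \<le> p_edge D' e'" unfolding p_edge_def by (intro Min_antimono)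
qed

text \<open>Both triangles at such an edge descend from \<open>K\<close>, where the function is a single polynomial.\<close>
lemma new_edge_no_jump:
  assumes K': "K' \<in> fst ` D'" and K: "K \<in> fst ` D" and sub: "hl K' \<subseteq> hl K"
    and e': "e' \<in> inner_edges \<Omega> D' K'" and new: "\<And>e. e \<in> tri_edges K \<Longrightarrow> \<not> convex hull e' \<subseteq> convex hull e"
    and w: "w \<in> pw_polys D"
  shows "normal_jump (fst ` D') e' w x = 0"
proof -
  obtain K2' where K2': "K2' \<in> fst ` D'" "K2' \<noteq> K'" "e' \<in> tri_edges K'" "e' \<in> tri_edges K2'"
    by (rule fine.inner_edge_pair[OF K' e'])
  obtain K2 where K2: "K2 \<in> fst ` D" "hl K2' \<subseteq> hl K2" using parent[OF K2'(1)] by blast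
  have "K = K2"
  proof (rule ccontr)
    assume "K \<noteq> K2"
    then obtain g where "g \<in> tri_edges K" "g \<in> tri_edges K2" "convex hull e' \<subseteq> convex hull g"
      by (rule cousins_share_edge[OF K' K2'(1,3,4) K K2(1) _ sub K2(2)])
    then show False using new by blast
  qed
  then have "piece w K' = piece w K2'"
    using piece_refine[OF K' K sub w] piece_refine[OF K2'(1) K2 w] by simp
  then have "(normal_jump (fst ` D') e' w x)\<^sup>2 = 0"
    unfolding fine.normal_jump_sq[OF K' K2'(1) K2'(2)[symmetric] K2'(3,4)] by simp
  then show ?thesis by simp
qed

definition descendants :: "tri \<Rightarrow> hp" where
  "descendants K = {E \<in> D'. hl (fst E) \<subseteq> hl K}"

lemma finite_descendants: "finite (descendants K)"
  unfolding descendants_def using fine.finite_D by simp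

lemma descendantsD: "E \<in> descendants K \<Longrightarrow> E \<in> D' \<and> fst E \<in> fst ` D' \<and> hl (fst E) \<subseteq> hl K"
  unfolding descendants_def by blast

lemma residual_descendants:
  assumes Kd: "(K, d) \<in> D" and f: "f \<in> F_space D" and w: "w \<in> pw_polys D"
  shows "(\<Sum>E\<in>descendants K. LINT x|lebesgue_on (hl (fst E)). (f x + laplacian (piece w (fst E)) x)\<^sup>2)
     \<le> (LINT x|lebesgue_on (hl K). (f x + laplacian (piece w K) x)\<^sup>2)"
proof -
  let ?F = "\<lambda>x. (f x + laplacian (piece w K) x)\<^sup>2"
  have K: "K \<in> fst ` D" by (rule coarse.in_T[OF Kd])
  have i0: "integrable (lebesgue_on (hl K)) ?F" by (rule coarse.residual_integrable[OF Kd f w])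
  have i: "integrable (lebesgue_on (hl (fst E))) ?F" if E: "E \<in> descendants K" for E
  proof -
    have E': "(fst E, snd E) \<in> D'" using descendantsD[OF E] by simp
    have "integrable (lebesgue_on (hl (fst E))) (\<lambda>x. (f x + laplacian (piece w (fst E)) x)\<^sup>2)"
      by (rule fine.residual_integrable[OF E' F_space_mono[OF f] pw_polys_mono[OF w]])
    then show ?thesis using piece_refine[of "fst E" K w] descendantsD[OF E] K w by simp
  qed
  have "(\<Sum>E\<in>descendants K. LINT x|lebesgue_on (hl (fst E)). (f x + laplacian (piece w (fst E)) x)\<^sup>2)
     = (\<Sum>E\<in>descendants K. integral (hl (fst E)) ?F)"
  proof (rule sum.cong[OF refl])
    fix E assume E: "E \<in> descendants K"
    have "piece w (fst E) = piece w K" using piece_refine[of "fst E" K w] descendantsD[OF E] K w by simp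
    then show "(LINT x|lebesgue_on (hl (fst E)). (f x + laplacian (piece w (fst E)) x)\<^sup>2) = integral (hl (fst E)) ?F"
      using lebesgue_integral_eq_integral[OF i[OF E] hl_lebesgue] by simp
  qed
  also have "\<dots> \<le> integral (hl K) ?F"
  proof (rule sum_integral_le[OF finite_descendants])
    show "hl (fst E) \<subseteq> hl K" if "E \<in> descendants K" for E using descendantsD[OF that] by blast
    show "?F integrable_on hl (fst E)" if "E \<in> descendants K" for E
      by (rule integrable_on_lebesgue_on[OF i[OF that] hl_lebesgue])
    show "?F integrable_on hl K" by (rule integrable_on_lebesgue_on[OF i0 hl_lebesgue])
    fix E1 E2 assume E: "E1 \<in> descendants K" "E2 \<in> descendants K" "E1 \<noteq> E2"
    then have "fst E1 \<noteq> fst E2" using fine.inj descendantsD unfolding inj_on_def by blast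
    then have "interior (hl (fst E1) \<inter> hl (fst E2)) = {}"
      using fine.disjoint descendantsD[OF E(1)] descendantsD[OF E(2)] by simp
    then show "negligible (hl (fst E1) \<inter> hl (fst E2))"
      using negligible_convex_interior[OF convex_Int[OF hl_convex hl_convex]] by blast
  qed simp
  also have "\<dots> = (LINT x|lebesgue_on (hl K). ?F x)" by (rule lebesgue_integral_eq_integral[OF i0 hl_lebesgue, symmetric])
  finally show ?thesis .
qed

text \<open>Edges created in the interior of \<open>K\<close> contribute nothing. The others are grouped by the side of
  \<open>K\<close> that contains them; on each side they are non-overlapping pieces with the same jump, a weight
  at most \<open>c\<close> times as large, and exactly one adjacent descendant of \<open>K\<close>.\<close>
lemma jumps_descendants:
  assumes Kd: "(K, d) \<in> D" and w: "w \<in> pw_polys D" and c: "0 \<le> c"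
    and diam: "\<And>E e' e. E \<in> descendants K \<Longrightarrow> e' \<in> tri_edges (fst E) \<Longrightarrow> e \<in> tri_edges K \<Longrightarrow>
        convex hull e' \<subseteq> convex hull e \<Longrightarrow> diameter e' \<le> c * diameter e"
  shows "(\<Sum>E\<in>descendants K. \<Sum>e'\<in>inner_edges \<Omega> D' (fst E). diameter e' / (2 * real (p_edge D' e'))
            * edge_integral e' (\<lambda>x. (normal_jump (fst ` D') e' w x)\<^sup>2))
     \<le> c * (\<Sum>e\<in>inner_edges \<Omega> D K. diameter e / (2 * real (p_edge D e))
            * edge_integral e (\<lambda>x. (normal_jump (fst ` D) e w x)\<^sup>2))"
proof -
  define I where "I = inner_edges \<Omega> D K"
  define t where "t e' = diameter e' / (2 * real (p_edge D' e'))
            * edge_integral e' (\<lambda>x. (normal_jump (fst ` D') e' w x)\<^sup>2)" for e'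
  define P where "P = (SIGMA E:descendants K. inner_edges \<Omega> D' (fst E))"
  define Q where "Q e = {y \<in> P. convex hull (snd y) \<subseteq> convex hull e}" for e
  have K: "K \<in> fst ` D" by (rule coarse.in_T[OF Kd])
  have nc: "\<not> collinear (verts K)" by (rule coarse.noncollinear[OF K])
  have finI: "finite I" unfolding I_def by (rule coarse.finite_inner_edges[OF K])
  have I: "e \<in> tri_edges K" if "e \<in> I" for e using that unfolding I_def coarse.inner_edges_eq[OF K] by blast
  have finP: "finite P" unfolding P_def
    using descendantsD by (intro finite_SigmaI finite_descendants fine.finite_inner_edges) blast
  have PD: "fst (fst y) \<in> fst ` D' \<and> hl (fst (fst y)) \<subseteq> hl K \<and> fst y \<in> descendants K
      \<and> snd y \<in> inner_edges \<Omega> D' (fst (fst y)) \<and> snd y \<in> tri_edges (fst (fst y))" if y: "y \<in> P" for y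
  proof -
    have 1: "fst y \<in> descendants K" "snd y \<in> inner_edges \<Omega> D' (fst (fst y))" using y unfolding P_def by auto
    note 2 = descendantsD[OF 1(1)]
    then show ?thesis using 1 fine.inner_edges_eq[of "fst (fst y)"] by blast
  qed
  have "(\<Sum>E\<in>descendants K. \<Sum>e'\<in>inner_edges \<Omega> D' (fst E). t e') = (\<Sum>y\<in>P. t (snd y))"
  proof -
    have "\<forall>E\<in>descendants K. finite (inner_edges \<Omega> D' (fst E))"
      using descendantsD fine.finite_inner_edges by blast
    from sum.Sigma[OF finite_descendants this, of "\<lambda>E e'. t e'"] show ?thesis
      unfolding P_def by (simp only: case_prod_unfold)
  qed
  also have "\<dots> = (\<Sum>y\<in>(\<Union>e\<in>I. Q e). t (snd y))"
  proof (rule sum.mono_neutral_right[OF finP])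
    show "(\<Union>e\<in>I. Q e) \<subseteq> P" unfolding Q_def by blast
    show "\<forall>y\<in>P - (\<Union>e\<in>I. Q e). t (snd y) = 0"
    proof
      fix y assume y: "y \<in> P - (\<Union>e\<in>I. Q e)"
      then have yP: "y \<in> P" by blast
      note y' = PD[OF yP]
      have "\<not> convex hull (snd y) \<subseteq> convex hull e" if e: "e \<in> tri_edges K" for e
      proof
        assume s: "convex hull (snd y) \<subseteq> convex hull e"
        have "e \<in> I" unfolding I_def using subedge_of_inner_edge(1)[OF _ K _ _ e s, of "fst (fst y)"] y' by blast
        then show False using y s unfolding Q_def by blast
      qed
      then have "normal_jump (fst ` D') (snd y) w x = 0" for x
        using new_edge_no_jump[OF _ K _ _ _ w, of "fst (fst y)" "snd y"] y' by blast
      then show "t (snd y) = 0" unfolding t_def by (simp add: edge_integral_0)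
    qed
  qed
  also have "\<dots> = (\<Sum>e\<in>I. \<Sum>y\<in>Q e. t (snd y))"
  proof (rule sum.UNION_disjoint[OF finI])
    show "\<forall>e\<in>I. finite (Q e)" unfolding Q_def using finP by simp
    show "\<forall>e\<in>I. \<forall>g\<in>I. e \<noteq> g \<longrightarrow> Q e \<inter> Q g = {}"
    proof (intro ballI impI)
      fix e g assume eg: "e \<in> I" "g \<in> I" "e \<noteq> g"
      show "Q e \<inter> Q g = {}"
      proof (rule ccontr)
        assume "Q e \<inter> Q g \<noteq> {}"
        then obtain y where y: "y \<in> P" "convex hull (snd y) \<subseteq> convex hull e" "convex hull (snd y) \<subseteq> convex hull g"
          unfolding Q_def by blast
        obtain p q where pq: "p \<noteq> q" "p \<in> convex hull (snd y)" "q \<in> convex hull (snd y)"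
          using edge_two_points[of "fst (fst y)" "snd y"] PD[OF y(1)] by blast
        have "e = g" by (rule edges_meet[OF nc I[OF eg(1)] I[OF eg(2)] pq(1)]) (use pq y in blast)+
        then show False using eg(3) by simp
      qed
    qed
  qed
  also have "\<dots> \<le> (\<Sum>e\<in>I. c * (diameter e / (2 * real (p_edge D e)) * edge_integral e (\<lambda>x. (normal_jump (fst ` D) e w x)\<^sup>2)))"
  proof (rule sum_mono)
    fix e assume eI: "e \<in> I"
    note e = I[OF eI]
    have eI': "e \<in> inner_edges \<Omega> D K" using eI unfolding I_def .
    let ?G = "\<lambda>x. (normal_jump (fst ` D) e w x)\<^sup>2"
    have G: "continuous_on UNIV ?G" by (intro continuous_on_power coarse.normal_jump_linear_continuous(2)[OF K eI' w w])
    have p: "1 \<le> p_edge D e" by (rule coarse.p_edge_pos[OF Kd e])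
    define k where "k = c * (diameter e / (2 * real (p_edge D e)))"
    have diam_nonneg: "0 \<le> diameter e"
      by (intro diameter_ge_0 finite_imp_bounded card_ge_0_finite) (simp add: coarse.inner_edge_card[OF K eI'])
    have k: "0 \<le> k" unfolding k_def using c diam_nonneg by simp
    have inj: "inj_on snd (Q e)"
    proof (rule inj_onI)
      fix y z assume yz: "y \<in> Q e" "z \<in> Q e" "snd y = snd z"
      then have P: "y \<in> P" "z \<in> P" "convex hull (snd y) \<subseteq> convex hull e" unfolding Q_def by auto
      have "fst (fst y) = fst (fst z)"
      proof (rule ccontr)
        assume "fst (fst y) \<noteq> fst (fst z)"
        then show False
          using siblings_share_no_boundary_edge[of "fst (fst y)" "fst (fst z)" "snd y" K e] PD[OF P(1)] PD[OF P(2)] yz(3) K e P(3)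
          by metis
      qed
      then have "fst y = fst z"
        using fine.inj PD[OF P(1)] PD[OF P(2)] descendantsD unfolding inj_on_def by blast
      then show "y = z" using yz(3) by (rule prod_eqI)
    qed
    have tle: "t (snd y) \<le> k * edge_integral (snd y) ?G" if y: "y \<in> Q e" for y
    proof -
      have yP: "y \<in> P" and s: "convex hull (snd y) \<subseteq> convex hull e" using y unfolding Q_def by auto
      have y1: "fst (fst y) \<in> fst ` D'" "hl (fst (fst y)) \<subseteq> hl K" "fst y \<in> descendants K"
         "snd y \<in> inner_edges \<Omega> D' (fst (fst y))" "snd y \<in> tri_edges (fst (fst y))" using PD[OF yP] by blast+
      note S = subedge_of_inner_edge[OF y1(1) K y1(2,4) e s]
      have J: "(\<lambda>x. (normal_jump (fst ` D') (snd y) w x)\<^sup>2) = ?G" using S(3)[OF w] by (rule ext)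
      have "diameter (snd y) / (2 * real (p_edge D' (snd y))) \<le> c * diameter e / (2 * real (p_edge D e))"
        by (rule frac_le) (use diam[OF y1(3,5) e s] c diam_nonneg p S(2) in simp_all)
      then have "diameter (snd y) / (2 * real (p_edge D' (snd y))) \<le> k" unfolding k_def by simp
      moreover have "0 \<le> edge_integral (snd y) ?G"
        by (rule edge_integral_nonneg[OF G]) (simp_all add: fine.inner_edge_card[OF y1(1,4)])
      ultimately show ?thesis unfolding t_def J by (rule mult_right_mono)
    qed
    have "(\<Sum>y\<in>Q e. t (snd y)) \<le> (\<Sum>y\<in>Q e. k * edge_integral (snd y) ?G)" by (rule sum_mono) (rule tle)
    also have "\<dots> = k * (\<Sum>e'\<in>snd ` Q e. edge_integral e' ?G)"
      unfolding sum.reindex[OF inj] comp_def sum_distrib_left ..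
    also have "\<dots> \<le> k * edge_integral e ?G"
    proof (rule mult_left_mono[OF _ k], rule sum_subedges_le[OF G])
      show "card e = 2" by (rule coarse.inner_edge_card[OF K eI'])
      show "finite (snd ` Q e)" unfolding Q_def using finP by simp
      show "card e' = 2 \<and> convex hull e' \<subseteq> convex hull e" if e': "e' \<in> snd ` Q e" for e'
      proof -
        obtain y where y: "y \<in> P" "e' = snd y" "convex hull (snd y) \<subseteq> convex hull e" using e' unfolding Q_def by blast
        have "card (snd y) = 2" using fine.inner_edge_card[of "fst (fst y)" "snd y"] PD[OF y(1)] by blast
        then show ?thesis using y by simp
      qed
      fix e1 e2 p q
      assume E: "e1 \<in> snd ` Q e" "e2 \<in> snd ` Q e" and pq: "p \<noteq> q" "p \<in> convex hull e1" "q \<in> convex hull e1"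
        "p \<in> convex hull e2" "q \<in> convex hull e2"
      obtain y1 y2 where y: "y1 \<in> P" "y2 \<in> P" "e1 = snd y1" "e2 = snd y2" using E unfolding Q_def by blast
      show "e1 = e2"
        using fine.edges_meet_global[of "fst (fst y1)" "fst (fst y2)" e1 e2 p q] PD[OF y(1)] PD[OF y(2)] y(3,4) pq by blast
    qed simp
    finally show "(\<Sum>y\<in>Q e. t (snd y)) \<le> c * (diameter e / (2 * real (p_edge D e)) * edge_integral e ?G)"
      unfolding k_def by (simp only: mult.assoc)
  qed
  finally show ?thesis unfolding t_def I_def sum_distrib_left .
qed

text \<open>The common factor \<open>c\<close> covers both uses: 1 for arbitrary descendants, and one half for the
  grandchildren of a marked element.\<close>
lemma indicator_descendants:
  assumes Kd: "(K, d) \<in> D" and f: "f \<in> F_space D" and w: "w \<in> pw_polys D" and c: "0 \<le> c"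
    and area: "\<And>E. E \<in> descendants K \<Longrightarrow> measure lebesgue (hl (fst E)) \<le> c * measure lebesgue (hl K)"
    and diam: "\<And>E e' e. E \<in> descendants K \<Longrightarrow> e' \<in> tri_edges (fst E) \<Longrightarrow> e \<in> tri_edges K \<Longrightarrow>
        convex hull e' \<subseteq> convex hull e \<Longrightarrow> diameter e' \<le> c * diameter e"
  shows "(\<Sum>E\<in>descendants K. indicator_sq \<Omega> D' w f E) \<le> c * indicator_sq \<Omega> D w f (K, d)"
proof -
  let ?V = "\<lambda>K. LINT x|lebesgue_on (hl K). (f x + laplacian (piece w K) x)\<^sup>2"
  let ?S' = "\<lambda>K. \<Sum>e'\<in>inner_edges \<Omega> D' K. diameter e' / (2 * real (p_edge D' e'))
            * edge_integral e' (\<lambda>x. (normal_jump (fst ` D') e' w x)\<^sup>2)"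
  define A where "A = measure lebesgue (hl K) / (real (p_of d))\<^sup>2"
  have A: "0 \<le> c * A" using c by (simp add: A_def)
  have "indicator_sq \<Omega> D' w f E \<le> (c * A) * ?V (fst E) + ?S' (fst E)" if E: "E \<in> descendants K" for E
  proof -
    have E': "(fst E, snd E) \<in> D'" and s: "hl (fst E) \<subseteq> hl K" using descendantsD[OF E] by auto
    have d: "snd E = d" by (rule inherit[OF E' Kd s])
    have "measure lebesgue (hl (fst E)) / (real (p_of d))\<^sup>2 \<le> c * measure lebesgue (hl K) / (real (p_of d))\<^sup>2"
      by (rule divide_right_mono[OF area[OF E]]) simp
    then have "measure lebesgue (hl (fst E)) / (real (p_of d))\<^sup>2 * ?V (fst E) \<le> (c * A) * ?V (fst E)"
      unfolding A_def by (intro mult_right_mono) (simp_all add: integral_nonneg_AE)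
    then show ?thesis unfolding indicator_sq_def split_beta d by simp
  qed
  then have "(\<Sum>E\<in>descendants K. indicator_sq \<Omega> D' w f E)
      \<le> (\<Sum>E\<in>descendants K. (c * A) * ?V (fst E) + ?S' (fst E))" by (rule sum_mono)
  also have "\<dots> = (c * A) * (\<Sum>E\<in>descendants K. ?V (fst E)) + (\<Sum>E\<in>descendants K. ?S' (fst E))"
    by (simp only: sum.distrib sum_distrib_left)
  also have "\<dots> \<le> (c * A) * ?V K + c * (\<Sum>e\<in>inner_edges \<Omega> D K. diameter e / (2 * real (p_edge D e))
            * edge_integral e (\<lambda>x. (normal_jump (fst ` D) e w x)\<^sup>2))"
    by (intro add_mono mult_left_mono[OF residual_descendants[OF Kd f w] A] jumps_descendants[OF Kd w c diam])
  also have "\<dots> = c * indicator_sq \<Omega> D w f (K, d)"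
    unfolding indicator_sq_def A_def by (simp add: distrib_left)
  finally show ?thesis .
qed

lemma indicator_descendants_le:
  assumes Kd: "(K, d) \<in> D" and f: "f \<in> F_space D" and w: "w \<in> pw_polys D"
  shows "(\<Sum>E\<in>descendants K. indicator_sq \<Omega> D' w f E) \<le> indicator_sq \<Omega> D w f (K, d)"
proof -
  have "(\<Sum>E\<in>descendants K. indicator_sq \<Omega> D' w f E) \<le> 1 * indicator_sq \<Omega> D w f (K, d)"
  proof (rule indicator_descendants[OF Kd f w])
    fix E assume E: "E \<in> descendants K"
    show "measure lebesgue (hl (fst E)) \<le> 1 * measure lebesgue (hl K)"
      using measure_mono_fmeasurable[OF _ hl_lebesgue lmeasurable_compact[OF hl_compact]] descendantsD[OF E] by simp
    fix e' e assume e: "e' \<in> tri_edges (fst E)" "e \<in> tri_edges K" "convex hull e' \<subseteq> convex hull e"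
    have "card e' = 2" "card e = 2"
      using e(1,2) tri_edges_iff[OF fine.noncollinear] tri_edges_iff[OF coarse.noncollinear[OF coarse.in_T[OF Kd]]] descendantsD[OF E]
      by blast+
    then show "diameter e' \<le> 1 * diameter e" using diameter_subedge(1)[OF _ _ e(3)] by simp
  qed simp
  then show ?thesis by simp
qed

text \<open>The jump terms are halved because the edges are; the residual terms even shrink by the factor 4.\<close>
lemma indicator_marked:
  assumes Kd: "(K, d) \<in> D" and f: "f \<in> F_space D" and w: "w \<in> pw_polys D"
    and marked: "grandchildren K \<subseteq> fst ` D'"
  shows "(\<Sum>E\<in>descendants K. indicator_sq \<Omega> D' w f E) \<le> (1/2) * indicator_sq \<Omega> D w f (K, d)"
proof -
  have nc: "\<not> collinear (verts K)" by (rule coarse.noncollinear[OF coarse.in_T[OF Kd]])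
  have gc: "fst E \<in> grandchildren K" if E: "E \<in> descendants K" for E
  proof -
    note D = descendantsD[OF E]
    obtain y where y: "y \<in> interior (hl (fst E))" using interior_hl_nonempty[OF fine.noncollinear] D by blast
    then have "y \<in> (\<Union>g\<in>grandchildren K. hl g)" unfolding grandchildren_cover[OF nc] using D interior_subset by blast
    then obtain g where g: "g \<in> grandchildren K" "y \<in> hl g" by blast
    have "interior (hl (fst E)) \<inter> interior (hl g) \<noteq> {}"
      using y g(2) closure_interior_hl[OF grandchild_noncollinear[OF nc g(1)]] open_Int_closure_eq_empty[OF open_interior]
      by blast
    then have "fst E = g" using fine.disjoint[of "fst E" g] D marked g(1) by blast
    then show ?thesis using g(1) by simp
  qed
  show ?thesis
  proof (rule indicator_descendants[OF Kd f w])
    fix E assume E: "E \<in> descendants K"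
    show "measure lebesgue (hl (fst E)) \<le> (1/2) * measure lebesgue (hl K)"
      using grandchild_area[OF gc[OF E]] measure_nonneg[of lebesgue "hl K"] by linarith
    fix e' e assume "e' \<in> tri_edges (fst E)" "e \<in> tri_edges K" "convex hull e' \<subseteq> convex hull e"
    then show "diameter e' \<le> (1/2) * diameter e" by (rule grandchild_subedge_diameter[OF nc gc[OF E]])
  qed simp
qed

text \<open>The indicators of marked elements are halved and the others do not grow, so the squared estimator
  loses at least half of its marked part.\<close>
lemma estimator_reduction:
  assumes f: "f \<in> F_space D" and w: "w \<in> pw_polys D" and M: "M \<subseteq> D"
    and marked: "\<And>K d. (K, d) \<in> M \<Longrightarrow> grandchildren K \<subseteq> fst ` D'"
    and bulk: "\<theta> * (estimator \<Omega> D D w f)\<^sup>2 \<le> (estimator \<Omega> D M w f)\<^sup>2"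
  shows "(estimator \<Omega> D' D' w f)\<^sup>2 \<le> (1 - \<theta> / 2) * (estimator \<Omega> D D w f)\<^sup>2"
proof -
  let ?i = "indicator_sq \<Omega> D w f"
  have "D' = (\<Union>X\<in>D. descendants (fst X))"
  proof (intro equalityI subsetI)
    fix E assume E: "E \<in> D'"
    then obtain K where "K \<in> fst ` D" "hl (fst E) \<subseteq> hl K" using parent by blast
    then show "E \<in> (\<Union>X\<in>D. descendants (fst X))" using E unfolding descendants_def by blast
  qed (use descendantsD in blast)
  then have "(\<Sum>E\<in>D'. indicator_sq \<Omega> D' w f E) = (\<Sum>E\<in>(\<Union>X\<in>D. descendants (fst X)). indicator_sq \<Omega> D' w f E)" by (rule arg_cong)
  also have "\<dots> = (\<Sum>X\<in>D. \<Sum>E\<in>descendants (fst X). indicator_sq \<Omega> D' w f E)"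
  proof (rule sum.UNION_disjoint[OF coarse.finite_D])
    show "\<forall>X\<in>D. finite (descendants (fst X))" using finite_descendants by blast
    show "\<forall>X\<in>D. \<forall>Y\<in>D. X \<noteq> Y \<longrightarrow> descendants (fst X) \<inter> descendants (fst Y) = {}"
    proof (intro ballI impI)
      fix X Y assume XY: "X \<in> D" "Y \<in> D" "X \<noteq> Y"
      then have "fst X \<noteq> fst Y" using coarse.inj unfolding inj_on_def by blast
      then show "descendants (fst X) \<inter> descendants (fst Y) = {}"
        using parent_unique[of _ "fst X" "fst Y"] descendantsD XY(1,2) by blast
    qed
  qed
  also have "\<dots> \<le> (\<Sum>X\<in>D. ?i X - (if X \<in> M then (1/2) * ?i X else 0))"
  proof (rule sum_mono)
    fix X assume X: "X \<in> D"
    obtain K d where Kd: "X = (K, d)" by (cases X)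
    show "(\<Sum>E\<in>descendants (fst X). indicator_sq \<Omega> D' w f E) \<le> ?i X - (if X \<in> M then (1/2) * ?i X else 0)"
    proof (cases "X \<in> M")
      case True
      then show ?thesis using indicator_marked[OF _ f w marked, of K d d] X unfolding Kd by simp
    next
      case False
      then show ?thesis using indicator_descendants_le[OF _ f w, of K d] X unfolding Kd by simp
    qed
  qed
  also have "\<dots> = (\<Sum>X\<in>D. ?i X) - (1/2) * (\<Sum>X\<in>M. ?i X)"
    using M coarse.finite_D by (simp add: sum_subtractf sum.If_cases Int_absorb1 sum_divide_distrib)
  finally show ?thesis
    using bulk unfolding coarse.estimator_sq[OF order_refl w] coarse.estimator_sq[OF M w]
      fine.estimator_sq[OF order_refl pw_polys_mono[OF w]]
    by (simp add: algebra_simps)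
qed

end

section \<open>Contraction and the number of iterations\<close>

text \<open>Here \<open>e\<close>, \<open>E\<close> are the squared error and estimator before the step and \<open>e'\<close>, \<open>E'\<close> those after
  it, \<open>z\<close> is the squared distance of the two discrete solutions, \<open>Z\<close> its squared estimator, and
  \<open>s\<^sup>2\<close> the reduction factor of the estimator. The factor \<open>(1 - s) * r\<close> in front of the
  estimator is the one for which the term in \<open>Z\<close> is absorbed by \<open>z\<close>. What remains is the loss
  \<open>(1 - s)\<^sup>2 * r * E\<close>; as both \<open>e\<close> and \<open>r * E\<close> are at most \<open>R * E\<close>, it is a fixed fraction
  of the whole quantity.\<close>
lemma contraction_arithmetic:
  fixes s r R e e' E E' Z z :: real
  assumes s: "0 < s" "s < 1" and r: "0 < r" and R: "0 < R"
    and gal: "e = e' + z" and eff: "r * Z \<le> z"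
    and est: "E' \<le> (1 / s) * (s\<^sup>2 * E) + (1 / (1 - s)) * Z"
    and rel: "e \<le> R * E" and eff': "r * E \<le> e" and E: "0 \<le> E"
  shows "e' + (1 - s) * r * E' \<le> (1 - (1 - s)\<^sup>2 / 2 * (r / R)) * (e + (1 - s) * r * E)"
proof -
  have "(1 - s) * r * E' \<le> (1 - s) * r * ((1 / s) * (s\<^sup>2 * E) + (1 / (1 - s)) * Z)"
    by (rule mult_left_mono[OF est]) (use s r in simp)
  also have "\<dots> = (1 - s) * r * (s * E) + r * Z" using s by (simp add: power2_eq_square field_simps)
  also have "\<dots> \<le> (1 - s) * r * (s * E) + z" using eff by simp
  finally have 1: "e' + (1 - s) * r * E' \<le> e + (1 - s) * r * E - (1 - s)\<^sup>2 * r * E"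
    unfolding gal by (simp add: power2_eq_square algebra_simps)
  have "(1 - s) * r * E \<le> 1 * (r * E)"
    unfolding mult.assoc by (rule mult_right_mono) (use s r E in auto)
  then have "e + (1 - s) * r * E \<le> 2 * (R * E)" using rel eff' by linarith
  then have "(1 - s)\<^sup>2 / 2 * (r / R) * (e + (1 - s) * r * E) \<le> (1 - s)\<^sup>2 / 2 * (r / R) * (2 * (R * E))"
    by (rule mult_left_mono) (use r R in simp)
  also have "\<dots> = (1 - s)\<^sup>2 * r * E" using R by simp
  finally have 2: "(1 - s)\<^sup>2 / 2 * (r / R) * (e + (1 - s) * r * E) \<le> (1 - s)\<^sup>2 * r * E" .
  have "(1 - (1 - s)\<^sup>2 / 2 * (r / R)) * (e + (1 - s) * r * E)
    = (e + (1 - s) * r * E) - (1 - s)\<^sup>2 / 2 * (r / R) * (e + (1 - s) * r * E)"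
    by (simp only: left_diff_distrib mult_1_left)
  then show ?thesis using 1 2 by linarith
qed

text \<open>As \<open>1 - x\<close> may be negative, its powers cannot be bounded by those of the exponential. It is
  compared with \<open>exp (- x)\<close> in every single step instead, where it multiplies a nonnegative number.\<close>
lemma iteration_count:
  fixes q :: "nat \<Rightarrow> real"
  assumes step: "\<And>i. i < M \<Longrightarrow> q (Suc i) \<le> (1 - x) * q i" and nonneg: "\<And>i. i \<le> M \<Longrightarrow> 0 \<le> q i"
  shows "q M \<le> exp (- (x * real M)) * q 0"
  using assms
proof (induction M)
  case (Suc M)
  have "q (Suc M) \<le> (1 - x) * q M" using Suc.prems(1) by simp
  also have "\<dots> \<le> exp (- x) * q M"
    using exp_ge_add_one_self[of "- x"] Suc.prems(2)[of M] by (intro mult_right_mono) auto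
  also have "\<dots> \<le> exp (- x) * (exp (- (x * real M)) * q 0)"
    using Suc.IH Suc.prems by (intro mult_left_mono) auto
  also have "\<dots> = exp (- (x * real (Suc M))) * q 0"
    by (simp add: algebra_simps flip: exp_add)
  finally show ?case .
qed simp

lemma conforming_hp_mesh:
  assumes \<Omega>: "polygonal_domain \<Omega>" and K0: "initial_triangulation \<Omega> K0" and D: "D \<in> conf_hp_partitions K0 \<kappa>"
  shows "hp_mesh \<Omega> D"
proof -
  have hp: "D \<in> hp_partitions K0" and c: "fst ` D \<in> conf_partitions K0"
    using D unfolding conf_hp_partitions_def by auto
  show ?thesis
  proof unfold_locales
    show "triangulation \<Omega> (fst ` D)"
      using partitions_triangulation[of \<Omega> K0] K0 c unfolding initial_triangulation_def conf_partitions_def by blast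
    show "conforming (fst ` D)" using c unfolding conf_partitions_def by blast
    show "interior (closure \<Omega>) = \<Omega>" "bounded \<Omega>" using \<Omega> unfolding polygonal_domain_def by auto
    show "inj_on fst D" using hp unfolding hp_partitions_def by blast
    show "1 \<le> d" if "(K, d) \<in> D" for K d using hp that unfolding hp_partitions_def by auto
  qed
qed

lemma is_refinement_hp_refinement:
  assumes \<Omega>: "polygonal_domain \<Omega>" and K0: "initial_triangulation \<Omega> K0" and D: "D \<in> conf_hp_partitions K0 \<kappa>"
    and ref: "is_refinement K0 \<kappa> D M D'"
  shows "hp_refinement \<Omega> D D'" "(K, d) \<in> M \<Longrightarrow> grandchildren K \<subseteq> fst ` D'" "hp_le D D'"
    "D' \<in> conf_hp_partitions K0 \<kappa>"
proof -
  show D': "D' \<in> conf_hp_partitions K0 \<kappa>" using ref unfolding is_refinement_def by blast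
  have adm: "fst ` D' \<in> admissible_refinements K0 D M" using ref unfolding is_refinement_def by blast
  then show "grandchildren K \<subseteq> fst ` D'" if "(K, d) \<in> M" using that unfolding admissible_refinements_def by blast
  have r: "refines (fst ` D') (fst ` D)"
    using adm unfolding admissible_refinements_def mem_Collect_eq by (elim conjE)
  have d0: "\<forall>(K', d')\<in>D'. \<forall>(K, d)\<in>D. hl K' \<subseteq> hl K \<longrightarrow> d' = d"
    using ref unfolding is_refinement_def by (elim conjE)
  have d: "d' = d" if "(K', d') \<in> D'" "(K, d) \<in> D" "hl K' \<subseteq> hl K" for K' d' K d
  proof -
    have 1: "\<forall>(K, d)\<in>D. hl K' \<subseteq> hl K \<longrightarrow> d' = d" using bspec[OF d0 that(1)] by simp
    show ?thesis using bspec[OF 1 that(2)] that(3) by simp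
  qed
  show "hp_le D D'" unfolding hp_le_def split_beta
  proof (intro conjI r ballI impI)
    fix x y assume "x \<in> D" "y \<in> D'" "hl (fst y) \<subseteq> hl (fst x)"
    then show "snd x \<le> snd y" using d[of "fst y" "snd y" "fst x" "snd x"] by simp
  qed
  interpret coarse: hp_mesh \<Omega> D by (rule conforming_hp_mesh[OF \<Omega> K0 D])
  interpret fine: hp_mesh \<Omega> D' by (rule conforming_hp_mesh[OF \<Omega> K0 D'])
  show "hp_refinement \<Omega> D D'"
    by unfold_locales (fact r, fact d)
qed

locale reduce_setting =
  fixes \<Omega> :: "point set" and K0 :: "tri set"
    and \<kappa> \<theta> \<gamma> \<epsilon> R :: real
    and r :: "hp \<Rightarrow> real"
    and u :: "func \<Rightarrow> func" and uD :: "hp \<Rightarrow> func \<Rightarrow> func"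
  assumes domain: "polygonal_domain \<Omega>"
    and initial: "initial_triangulation \<Omega> K0"
    and \<theta>: "0 < \<theta>" "\<theta> \<le> 1"
    and \<gamma>: "\<gamma> = (1 - \<theta>) + \<theta> / 2"
    and \<epsilon>: "\<epsilon> > 0"
    and u: "\<And>f. f \<in> L2 \<Omega> \<Longrightarrow> weak_solution \<Omega> f (u f)"
    and uD: "\<And>D f. D \<in> conf_hp_partitions K0 \<kappa> \<Longrightarrow> f \<in> L2 \<Omega> \<Longrightarrow>
               best_approximation \<Omega> (Vc_space \<Omega> D) (u f) (uD D f)"
    and R: "R > 0"
    and reliable: "\<And>D f. D \<in> conf_hp_partitions K0 \<kappa> \<Longrightarrow> f \<in> F_space D \<Longrightarrow>
               (err \<Omega> u uD D f)\<^sup>2 \<le> R * (estimator \<Omega> D D (uD D f) f)\<^sup>2"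
    and r_size: "\<exists>C>0. \<forall>D\<in>conf_hp_partitions K0 \<kappa>.
               equiv_upto C (r D) (real (pmax D) powr (- 2 - 2 * \<epsilon>))"
    and r_pmax: "\<And>D D'. D \<in> conf_hp_partitions K0 \<kappa> \<Longrightarrow> D' \<in> conf_hp_partitions K0 \<kappa> \<Longrightarrow>
               pmax D = pmax D' \<Longrightarrow> r D = r D'"
    and efficient: "\<And>D f w. D \<in> conf_hp_partitions K0 \<kappa> \<Longrightarrow> f \<in> F_space D \<Longrightarrow> w \<in> Vc_space \<Omega> D \<Longrightarrow>
               r D * (estimator \<Omega> D D w f)\<^sup>2 \<le> (H1_seminorm \<Omega> (\<lambda>x. u f x - w x))\<^sup>2"
begin

lemma nonempty: "\<Omega> \<noteq> {}"
  using domain unfolding polygonal_domain_def by blast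

sublocale bounded_open_set \<Omega>
  by unfold_locales (use domain in \<open>auto simp: polygonal_domain_def\<close>)

abbreviation meshes :: "hp set" where "meshes \<equiv> conf_hp_partitions K0 \<kappa>"

lemma mesh: "D \<in> meshes \<Longrightarrow> hp_mesh \<Omega> D"
  by (rule conforming_hp_mesh[OF domain initial])

lemma pmax_ge_1: "D \<in> meshes \<Longrightarrow> 1 \<le> pmax D"
  by (rule hp_mesh.pmax_pos[OF mesh nonempty])

lemma r_pos:
  assumes D: "D \<in> meshes"
  shows "0 < r D"
proof -
  obtain C where C: "C > 0" "equiv_upto C (r D) (real (pmax D) powr (- 2 - 2 * \<epsilon>))" using r_size D by blast
  have "0 < real (pmax D) powr (- 2 - 2 * \<epsilon>)" using pmax_ge_1[OF D] by simp
  also have "\<dots> \<le> C * r D" using C(2) unfolding equiv_upto_def by blast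
  finally show ?thesis using C(1) by (simp add: zero_less_mult_iff)
qed

lemma f_L2: "D \<in> meshes \<Longrightarrow> f \<in> F_space D \<Longrightarrow> f \<in> L2 \<Omega>"
  by (rule hp_mesh.F_space_L2[OF mesh])

lemma u_H1: "f \<in> L2 \<Omega> \<Longrightarrow> u f \<in> H1 \<Omega>"
  using u H10_H1 unfolding weak_solution_def by blast

lemma Vc_H1: "Vc_space \<Omega> D \<subseteq> H1 \<Omega>"
  unfolding Vc_space_eq using H10_H1 by blast

lemma Vc_lincomb: "w \<in> Vc_space \<Omega> D \<Longrightarrow> v \<in> Vc_space \<Omega> D \<Longrightarrow> (\<lambda>x. \<alpha> * w x + \<beta> * v x) \<in> Vc_space \<Omega> D"
  unfolding Vc_space_eq using H10_lincomb pw_polys_lincomb by blast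

lemma Galerkin_Vc: "D \<in> meshes \<Longrightarrow> f \<in> L2 \<Omega> \<Longrightarrow> uD D f \<in> Vc_space \<Omega> D"
  using uD unfolding best_approximation_def by blast

abbreviation E2 :: "hp \<Rightarrow> func \<Rightarrow> real" where "E2 D f \<equiv> (estimator \<Omega> D D (uD D f) f)\<^sup>2"

lemma efficient_Galerkin:
  assumes "D \<in> meshes" "f \<in> F_space D"
  shows "r D * E2 D f \<le> (err \<Omega> u uD D f)\<^sup>2"
  unfolding err_def by (rule efficient[OF assms Galerkin_Vc[OF assms(1) f_L2[OF assms]]])

lemma sqrt_\<gamma>: "0 < sqrt \<gamma>" "sqrt \<gamma> < 1" "(sqrt \<gamma>)\<^sup>2 = 1 - \<theta> / 2"
  using \<theta> unfolding \<gamma> by simp_all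

lemma contraction:
  assumes D: "D \<in> meshes" and f: "f \<in> F_space D" and M: "M \<subseteq> D"
    and bulk: "\<theta> * E2 D f \<le> (estimator \<Omega> D M (uD D f) f)\<^sup>2"
    and ref: "is_refinement K0 \<kappa> D M D'"
  shows "(err \<Omega> u uD D' f)\<^sup>2 + (1 - sqrt \<gamma>) * r D * E2 D' f
    \<le> (1 - (1 - sqrt \<gamma>)\<^sup>2 / 2 * (r D / R)) * ((err \<Omega> u uD D f)\<^sup>2 + (1 - sqrt \<gamma>) * r D * E2 D f)"
proof -
  note ref' = is_refinement_hp_refinement[OF domain initial D ref]
  interpret hp_refinement \<Omega> D D' by (rule ref'(1))
  have D': "D' \<in> meshes" by (rule ref'(4))
  have f': "f \<in> F_space D'" by (rule F_space_mono[OF f])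
  have fL: "f \<in> L2 \<Omega>" by (rule f_L2[OF D f])
  define U where "U = uD D f"
  define U' where "U' = uD D' f"
  define Z where "Z = (\<lambda>x. 1 * U' x + (- 1) * U x)"
  have U: "U \<in> Vc_space \<Omega> D" and U': "U' \<in> Vc_space \<Omega> D'"
    unfolding U_def U'_def by (rule Galerkin_Vc[OF D fL], rule Galerkin_Vc[OF D' fL])
  have UD': "U \<in> Vc_space \<Omega> D'" using U pw_polys_mono unfolding Vc_space_eq by blast
  have Z: "Z \<in> Vc_space \<Omega> D'" unfolding Z_def by (rule Vc_lincomb[OF U' UD'])
  have pw: "U \<in> pw_polys D" "U \<in> pw_polys D'" "U' \<in> pw_polys D'" using U UD' U' unfolding Vc_space_eq by blast+
  have rr: "r D' = r D" by (rule r_pmax[OF D' D pmax_eq])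
  have gal: "(err \<Omega> u uD D f)\<^sup>2 = (err \<Omega> u uD D' f)\<^sup>2 + (H1_seminorm \<Omega> Z)\<^sup>2"
  proof -
    have "best_approximation \<Omega> (Vc_space \<Omega> D') (u f) U'" unfolding U'_def by (rule uD[OF D' fL])
    from best_approximation_pythagoras[OF Vc_H1 Vc_lincomb u_H1[OF fL] this UD']
    have "(H1_seminorm \<Omega> (\<lambda>x. u f x - U x))\<^sup>2
       = (H1_seminorm \<Omega> (\<lambda>x. u f x - U' x))\<^sup>2 + (H1_seminorm \<Omega> (\<lambda>x. U' x - U x))\<^sup>2" .
    then show ?thesis unfolding err_def U_def U'_def Z_def by simp
  qed
  have zero: "(\<lambda>x. 0) \<in> L2 \<Omega>" by (rule f_L2[OF D zero_F_space])
  have effZ: "r D * (estimator \<Omega> D' D' Z (\<lambda>x. 0))\<^sup>2 \<le> (H1_seminorm \<Omega> Z)\<^sup>2"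
  proof -
    have "Z \<in> H1 \<Omega>" using Vc_H1 Z by blast
    then have "H1_seminorm \<Omega> (\<lambda>x. u (\<lambda>x. 0) x - Z x) = H1_seminorm \<Omega> Z"
      by (rule H1_seminorm_minus_weak_solution_0[OF u[OF zero]])
    then show ?thesis using efficient[OF D' zero_F_space Z] unfolding rr by simp
  qed
  define s where "s = sqrt \<gamma>"
  note s = sqrt_\<gamma>[folded s_def]
  \<comment> \<open>chosen such that the factor \<open>s\<^sup>2\<close> of the reduced estimator becomes \<open>s\<close>\<close>
  define \<delta> where "\<delta> = (1 - s) / s"
  have \<delta>: "\<delta> > 0" "1 + \<delta> = 1 / s" "1 + 1 / \<delta> = 1 / (1 - s)"
    using s(1,2) unfolding \<delta>_def by (simp_all add: field_simps)
  have "(estimator \<Omega> D' D' U' f)\<^sup>2 \<le> (1 / s) * (estimator \<Omega> D' D' U f)\<^sup>2 + (1 / (1 - s)) * (estimator \<Omega> D' D' Z (\<lambda>x. 0))\<^sup>2"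
    using fine.estimator_young[OF f' pw(3,2) \<delta>(1)] unfolding \<delta>(2,3) Z_def .
  moreover have "(estimator \<Omega> D' D' U f)\<^sup>2 \<le> s\<^sup>2 * (estimator \<Omega> D D U f)\<^sup>2"
    unfolding s(3) by (rule estimator_reduction[OF f pw(1) M ref'(2) bulk[folded U_def]])
  then have "(1 / s) * (estimator \<Omega> D' D' U f)\<^sup>2 \<le> (1 / s) * (s\<^sup>2 * (estimator \<Omega> D D U f)\<^sup>2)"
    by (rule mult_left_mono) (use s(1) in simp)
  ultimately have est: "(estimator \<Omega> D' D' U' f)\<^sup>2 \<le> (1 / s) * (s\<^sup>2 * (estimator \<Omega> D D U f)\<^sup>2)
     + (1 / (1 - s)) * (estimator \<Omega> D' D' Z (\<lambda>x. 0))\<^sup>2" by linarith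
  show ?thesis
    unfolding s_def[symmetric] U_def[symmetric] U'_def[symmetric]
    by (rule contraction_arithmetic[OF s(1,2) r_pos[OF D] R gal effZ est])
      (use reliable[OF D f] efficient_Galerkin[OF D f] in \<open>simp_all add: U_def\<close>)
qed

lemma reduce_run_invariant:
  assumes run: "reduce_run \<Omega> K0 \<kappa> \<theta> uD D f N Ds" and D: "D \<in> meshes" and f: "f \<in> F_space D" and i: "i \<le> N"
  shows "Ds i \<in> meshes \<and> f \<in> F_space (Ds i) \<and> pmax (Ds i) = pmax D"
  using i
proof (induction i)
  case 0
  then show ?case using run D f unfolding reduce_run_def by simp
next
  case (Suc i)
  then have IH: "Ds i \<in> meshes" "f \<in> F_space (Ds i)" "pmax (Ds i) = pmax D" by simp_all
  obtain M where ref: "is_refinement K0 \<kappa> (Ds i) M (Ds (Suc i))"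
    using run Suc.prems unfolding reduce_run_def by (meson Suc_le_lessD)
  note ref' = is_refinement_hp_refinement[OF domain initial IH(1) ref]
  interpret hp_refinement \<Omega> "Ds i" "Ds (Suc i)" by (rule ref'(1))
  show ?case using ref'(4) F_space_mono[OF IH(2)] pmax_eq IH(3) by simp
qed

lemma reduce_step:
  assumes run: "reduce_run \<Omega> K0 \<kappa> \<theta> uD D f N Ds" and D: "D \<in> meshes" and f: "f \<in> F_space D" and i: "i < N"
  shows "hp_le (Ds i) (Ds (Suc i))"
    "reduce_quantity \<Omega> u uD r \<gamma> D f (Ds (Suc i))
      \<le> (1 - (1 - sqrt \<gamma>)\<^sup>2 / 2 * (r D / R)) * reduce_quantity \<Omega> u uD r \<gamma> D f (Ds i)"
proof -
  have inv: "Ds i \<in> meshes" "f \<in> F_space (Ds i)" "pmax (Ds i) = pmax D"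
    using reduce_run_invariant[OF run D f, of i] i by simp_all
  obtain M where M: "M \<subseteq> Ds i" "\<theta> * E2 (Ds i) f \<le> (estimator \<Omega> (Ds i) M (uD (Ds i) f) f)\<^sup>2"
    and ref: "is_refinement K0 \<kappa> (Ds i) M (Ds (Suc i))"
    using run i unfolding reduce_run_def by blast
  show "hp_le (Ds i) (Ds (Suc i))" by (rule is_refinement_hp_refinement(3)[OF domain initial inv(1) ref])
  show "reduce_quantity \<Omega> u uD r \<gamma> D f (Ds (Suc i))
      \<le> (1 - (1 - sqrt \<gamma>)\<^sup>2 / 2 * (r D / R)) * reduce_quantity \<Omega> u uD r \<gamma> D f (Ds i)"
    using contraction[OF inv(1,2) M ref] r_pmax[OF inv(1) D inv(3)] unfolding reduce_quantity_def by simp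
qed

text \<open>Efficiency bounds the estimator part of the quantity by the error part.\<close>
lemma reduce_quantity_bounds:
  assumes run: "reduce_run \<Omega> K0 \<kappa> \<theta> uD D f N Ds" and D: "D \<in> meshes" and f: "f \<in> F_space D" and i: "i \<le> N"
  shows "(err \<Omega> u uD (Ds i) f)\<^sup>2 \<le> reduce_quantity \<Omega> u uD r \<gamma> D f (Ds i)"
    "reduce_quantity \<Omega> u uD r \<gamma> D f (Ds i) \<le> 2 * (err \<Omega> u uD (Ds i) f)\<^sup>2"
proof -
  have inv: "Ds i \<in> meshes" "f \<in> F_space (Ds i)" "pmax (Ds i) = pmax D"
    using reduce_run_invariant[OF run D f i] by simp_all
  have eff: "r D * E2 (Ds i) f \<le> (err \<Omega> u uD (Ds i) f)\<^sup>2"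
    using efficient_Galerkin[OF inv(1,2)] r_pmax[OF inv(1) D inv(3)] by simp
  have n: "0 \<le> r D * E2 (Ds i) f" using r_pos[OF D] by simp
  have "0 \<le> (1 - sqrt \<gamma>) * (r D * E2 (Ds i) f)" using n sqrt_\<gamma>(2) by simp
  then show "(err \<Omega> u uD (Ds i) f)\<^sup>2 \<le> reduce_quantity \<Omega> u uD r \<gamma> D f (Ds i)"
    unfolding reduce_quantity_def mult.assoc by simp
  have "(1 - sqrt \<gamma>) * (r D * E2 (Ds i) f) \<le> 1 * (r D * E2 (Ds i) f)"
    by (rule mult_right_mono[OF _ n]) (use sqrt_\<gamma>(1) in simp)
  then show "reduce_quantity \<Omega> u uD r \<gamma> D f (Ds i) \<le> 2 * (err \<Omega> u uD (Ds i) f)\<^sup>2"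
    unfolding reduce_quantity_def mult.assoc using eff by simp
qed

lemma err_nonneg: "0 \<le> err \<Omega> u uD D f"
  unfolding err_def H1_seminorm_def by (simp add: integral_nonneg_AE)

lemma error_reduction:
  assumes run: "reduce_run \<Omega> K0 \<kappa> \<theta> uD D f M Ds" and D: "D \<in> meshes" and f: "f \<in> F_space D"
    and \<rho>: "0 < \<rho>" and M: "ln 2 + 2 * ln (1 / \<rho>) \<le> (1 - sqrt \<gamma>)\<^sup>2 / 2 * (r D / R) * real M"
  shows "err \<Omega> u uD (Ds M) f \<le> \<rho> * err \<Omega> u uD D f"
proof -
  define x where "x = (1 - sqrt \<gamma>)\<^sup>2 / 2 * (r D / R)"
  let ?q = "\<lambda>i. reduce_quantity \<Omega> u uD r \<gamma> D f (Ds i)"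
  have D0: "Ds 0 = D" using run unfolding reduce_run_def by blast
  have "(err \<Omega> u uD (Ds M) f)\<^sup>2 \<le> ?q M" by (rule reduce_quantity_bounds(1)[OF run D f order_refl])
  also have "\<dots> \<le> exp (- (x * real M)) * ?q 0"
  proof (rule iteration_count[where q = ?q])
    show "?q (Suc i) \<le> (1 - x) * ?q i" if "i < M" for i unfolding x_def by (rule reduce_step(2)[OF run D f that])
    show "0 \<le> ?q i" if "i \<le> M" for i
      by (rule order_trans[OF zero_le_power2 reduce_quantity_bounds(1)[OF run D f that]])
  qed
  also have "\<dots> \<le> exp (- (x * real M)) * (2 * (err \<Omega> u uD D f)\<^sup>2)"
    using reduce_quantity_bounds(2)[OF run D f, of 0] D0 by (intro mult_left_mono) simp_all
  also have "\<dots> \<le> exp (- (ln 2 + 2 * ln (1 / \<rho>))) * (2 * (err \<Omega> u uD D f)\<^sup>2)"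
    using M unfolding x_def by (intro mult_right_mono) simp_all
  also have "exp (- (ln 2 + 2 * ln (1 / \<rho>))) = \<rho>\<^sup>2 / 2"
  proof -
    have "- (ln 2 + 2 * ln (1 / \<rho>)) = ln \<rho> + ln \<rho> - ln 2" using \<rho> by (simp add: ln_div)
    then have "exp (- (ln 2 + 2 * ln (1 / \<rho>))) = exp (ln \<rho>) * exp (ln \<rho>) / exp (ln 2)"
      by (simp only: exp_add exp_diff)
    then show ?thesis using \<rho> by (simp add: power2_eq_square)
  qed
  also have "\<rho>\<^sup>2 / 2 * (2 * (err \<Omega> u uD D f)\<^sup>2) = (\<rho> * err \<Omega> u uD D f)\<^sup>2" by (simp add: power_mult_distrib)
  finally show ?thesis by (rule power2_le_imp_le) (simp add: \<rho> err_nonneg less_imp_le)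
qed

text \<open>The number \<open>M\<close> is the least integer with \<open>exp (- x M) \<le> \<rho>\<^sup>2 / 2\<close>, where \<open>x\<close> is the relative
  decrease per step and the 2 pays for the equivalence of quantity and error. Since \<open>1 / x\<close> is
  comparable to \<open>pmax D powr (2 + 2 * \<epsilon>)\<close>, \<open>M\<close> is comparable to its product with \<open>ln (1 / \<rho>)\<close>. The
  bound \<open>ln (1 / \<rho>) \<ge> ln (1 / \<rho>0)\<close> absorbs the term \<open>ln 2\<close> and the rounding.\<close>
lemma iteration_bounds:
  assumes \<rho>0: "0 < \<rho>0" "\<rho>0 < 1"
  shows "\<exists>C>0. \<forall>D\<in>meshes. \<forall>\<rho>. (0 < \<rho> \<and> \<rho> \<le> \<rho>0) \<or> \<rho> = 1 \<longrightarrow>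
           (\<exists>M::nat. equiv_upto C (real M) (ln (1 / \<rho>) * real (pmax D) powr (2 + 2 * \<epsilon>)) \<and>
              (\<forall>f\<in>F_space D. \<forall>Ds. reduce_run \<Omega> K0 \<kappa> \<theta> uD D f M Ds \<longrightarrow>
                 err \<Omega> u uD (Ds M) f \<le> \<rho> * err \<Omega> u uD D f))"
proof -
  obtain C0 where C0: "C0 > 0" "\<And>D. D \<in> meshes \<Longrightarrow> equiv_upto C0 (r D) (real (pmax D) powr (- 2 - 2 * \<epsilon>))"
    using r_size by blast
  define c where "c = (1 - sqrt \<gamma>)\<^sup>2 / 2"
  have c: "c > 0" using sqrt_\<gamma>(2) by (simp add: c_def)
  define L0 where "L0 = ln (1 / \<rho>0)"
  have L0: "L0 > 0" using \<rho>0 by (simp add: L0_def)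
  define C1 where "C1 = (ln 2 / L0 + 2) * (R * C0 / c) + 1 / L0"
  define C2 where "C2 = c * C0 / (2 * R)"
  have C1: "C1 > 0" using L0 R C0(1) c unfolding C1_def by (intro add_pos_pos mult_pos_pos divide_pos_pos) simp_all
  have C2: "C2 > 0" using R C0(1) c unfolding C2_def by simp
  have "\<exists>M::nat. equiv_upto (max C1 C2) (real M) (ln (1 / \<rho>) * real (pmax D) powr (2 + 2 * \<epsilon>)) \<and>
              (\<forall>f\<in>F_space D. \<forall>Ds. reduce_run \<Omega> K0 \<kappa> \<theta> uD D f M Ds \<longrightarrow>
                 err \<Omega> u uD (Ds M) f \<le> \<rho> * err \<Omega> u uD D f)"
    if D: "D \<in> meshes" and \<rho>: "(0 < \<rho> \<and> \<rho> \<le> \<rho>0) \<or> \<rho> = 1" for D \<rho>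
  proof (cases "\<rho> = 1")
    case True
    have "err \<Omega> u uD (Ds 0) f \<le> \<rho> * err \<Omega> u uD D f" if "reduce_run \<Omega> K0 \<kappa> \<theta> uD D f 0 Ds" for f Ds
      using that True unfolding reduce_run_def by simp
    then show ?thesis using True by (intro exI[of _ 0]) (simp add: equiv_upto_def)
  next
    case False
    then have \<rho>: "0 < \<rho>" "\<rho> \<le> \<rho>0" using \<rho> by auto
    define P where "P = real (pmax D) powr (2 + 2 * \<epsilon>)"
    define L where "L = ln (1 / \<rho>)"
    define x where "x = c * (r D / R)"
    define M where "M = nat \<lceil>(ln 2 + 2 * L) / x\<rceil>"
    have P: "1 \<le> P" unfolding P_def using pmax_ge_1[OF D] \<epsilon> by (intro ge_one_powr_ge_zero) simp_all
    have L: "L0 \<le> L" unfolding L_def L0_def using \<rho> \<rho>0 by (simp add: frac_le)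
    have rD: "0 < r D" by (rule r_pos[OF D])
    have x: "0 < x" unfolding x_def using c rD R by simp
    have "real (pmax D) powr (- 2 - 2 * \<epsilon>) = 1 / P"
      unfolding P_def using powr_minus_divide[of "real (pmax D)" "2 + 2 * \<epsilon>"] by simp
    then have "r D \<le> C0 * (1 / P)" "1 / P \<le> C0 * r D" using C0(2)[OF D] unfolding equiv_upto_def by simp_all
    then have rP: "r D * P \<le> C0" "1 \<le> C0 * r D * P" using P by (simp_all add: field_simps)
    have M_lower: "(ln 2 + 2 * L) / x \<le> real M" unfolding M_def by linarith
    have pos: "0 \<le> (ln 2 + 2 * L) / x" using x L L0 by simp
    have M_upper: "real M \<le> (ln 2 + 2 * L) / x + 1" unfolding M_def using pos by linarith
    have "1 / x \<le> R * C0 / c * P"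
    proof -
      have "1 / x = R / c * (1 / r D)" unfolding x_def using R by simp
      also have "\<dots> \<le> R / c * (C0 * P)"
        using rP(2) rD R c by (intro mult_left_mono) (simp_all add: field_simps)
      finally show ?thesis by simp
    qed
    moreover have ln2: "ln 2 + 2 * L \<le> (ln 2 / L0 + 2) * L"
    proof -
      have "ln 2 = ln 2 / L0 * L0" using L0 by simp
      also have "\<dots> \<le> ln 2 / L0 * L" using L L0 by (intro mult_left_mono) simp_all
      finally show ?thesis by (simp add: distrib_right)
    qed
    ultimately have "(ln 2 + 2 * L) * (1 / x) \<le> ((ln 2 / L0 + 2) * L) * (R * C0 / c * P)"
      using x L L0 by (intro mult_mono) simp_all
    moreover have "1 \<le> 1 / L0 * (L * P)"
    proof -
      have "L0 * 1 \<le> L * P" using L P L0 by (intro mult_mono) simp_all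
      then show ?thesis using L0 by (simp add: field_simps)
    qed
    ultimately have "real M \<le> ((ln 2 / L0 + 2) * L) * (R * C0 / c * P) + 1 / L0 * (L * P)"
      using M_upper by simp
    also have "\<dots> = C1 * (L * P)" unfolding C1_def by (simp add: algebra_simps)
    also have "\<dots> \<le> max C1 C2 * (L * P)" using L L0 P by (intro mult_right_mono) simp_all
    finally have up: "real M \<le> max C1 C2 * (L * P)" .
    have "L * P \<le> C2 * (2 * L / x)"
    proof -
      have "C2 * (2 * L / x) = L * (C0 / r D)" unfolding C2_def x_def using R c rD by (simp add: field_simps)
      moreover have "P \<le> C0 / r D" using rP(1) rD by (simp add: field_simps)
      moreover have "L * P \<le> L * (C0 / r D)" using calculation(2) L L0 by (intro mult_left_mono) simp_all
      ultimately show ?thesis by simp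
    qed
    also have "\<dots> \<le> C2 * real M"
    proof (rule mult_left_mono)
      have "2 * L / x \<le> (ln 2 + 2 * L) / x" using x by (intro divide_right_mono) simp_all
      then show "2 * L / x \<le> real M" using M_lower by linarith
    qed (use C2 in simp)
    also have "\<dots> \<le> max C1 C2 * real M" by (intro mult_right_mono) simp_all
    finally have lo: "L * P \<le> max C1 C2 * real M" .
    have "ln 2 + 2 * ln (1 / \<rho>) \<le> (1 - sqrt \<gamma>)\<^sup>2 / 2 * (r D / R) * real M"
      using M_lower x unfolding L_def[symmetric] c_def[symmetric] x_def[symmetric] by (simp add: field_simps)
    then have "\<forall>f\<in>F_space D. \<forall>Ds. reduce_run \<Omega> K0 \<kappa> \<theta> uD D f M Ds \<longrightarrow> err \<Omega> u uD (Ds M) f \<le> \<rho> * err \<Omega> u uD D f"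
      using error_reduction[OF _ D _ \<rho>(1)] by blast
    then show ?thesis using up lo unfolding equiv_upto_def L_def P_def by blast
  qed
  then show ?thesis using C1 by (intro exI[of _ "max C1 C2"]) simp
qed

end

theorem mainTheorem5:
  fixes \<Omega> :: "point set" and K0 :: "tri set"
    and \<kappa> \<theta> \<gamma> \<epsilon> R :: real
    and r :: "hp \<Rightarrow> real"
    and u :: "func \<Rightarrow> func" and uD :: "hp \<Rightarrow> func \<Rightarrow> func"
  assumes "polygonal_domain \<Omega>"
    and "initial_triangulation \<Omega> K0"
    and "\<kappa> \<ge> 1"
    and "0 < \<theta>" "\<theta> \<le> 1"
    and "\<gamma> = (1 - \<theta>) + \<theta> / 2"
    and "\<epsilon> > 0"
    and u: "\<And>f. f \<in> L2 \<Omega> \<Longrightarrow> weak_solution \<Omega> f (u f)"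
    and uD: "\<And>D f. D \<in> conf_hp_partitions K0 \<kappa> \<Longrightarrow> f \<in> L2 \<Omega> \<Longrightarrow>
               best_approximation \<Omega> (Vc_space \<Omega> D) (u f) (uD D f)"
    and "R > 0"
    and reliable: "\<And>D f. D \<in> conf_hp_partitions K0 \<kappa> \<Longrightarrow> f \<in> F_space D \<Longrightarrow>
               (err \<Omega> u uD D f)\<^sup>2 \<le> R * (estimator \<Omega> D D (uD D f) f)\<^sup>2"
    and r_size: "\<exists>C>0. \<forall>D\<in>conf_hp_partitions K0 \<kappa>.
               equiv_upto C (r D) (real (pmax D) powr (- 2 - 2 * \<epsilon>))"
    and r_pmax: "\<And>D D'. D \<in> conf_hp_partitions K0 \<kappa> \<Longrightarrow> D' \<in> conf_hp_partitions K0 \<kappa> \<Longrightarrow>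
               pmax D = pmax D' \<Longrightarrow> r D = r D'"
    and efficient: "\<And>D f w. D \<in> conf_hp_partitions K0 \<kappa> \<Longrightarrow> f \<in> F_space D \<Longrightarrow> w \<in> Vc_space \<Omega> D \<Longrightarrow>
               r D * (estimator \<Omega> D D w f)\<^sup>2 \<le> (H1_seminorm \<Omega> (\<lambda>x. u f x - w x))\<^sup>2"
  shows
    "(\<forall>D\<in>conf_hp_partitions K0 \<kappa>. \<forall>f\<in>F_space D. \<forall>N Ds. reduce_run \<Omega> K0 \<kappa> \<theta> uD D f N Ds \<longrightarrow>
        (\<forall>i<N. hp_le (Ds i) (Ds (Suc i)) \<and>
               reduce_quantity \<Omega> u uD r \<gamma> D f (Ds (Suc i))
                 \<le> (1 - (1 - sqrt \<gamma>)\<^sup>2 / 2 * (r D / R)) * reduce_quantity \<Omega> u uD r \<gamma> D f (Ds i)))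
     \<and>
     (\<exists>C>0. \<forall>D\<in>conf_hp_partitions K0 \<kappa>. \<forall>f\<in>F_space D. \<forall>N Ds. reduce_run \<Omega> K0 \<kappa> \<theta> uD D f N Ds \<longrightarrow>
        (\<forall>i\<le>N. equiv_upto C (reduce_quantity \<Omega> u uD r \<gamma> D f (Ds i)) ((err \<Omega> u uD (Ds i) f)\<^sup>2)))
     \<and>
     \<comment> \<open>As \<open>M\<close> is an integer, the equivalence is uniform for \<open>\<rho>\<close> bounded away from 1, and for \<open>\<rho> = 1\<close>.\<close>
     (\<forall>\<rho>0. 0 < \<rho>0 \<and> \<rho>0 < 1 \<longrightarrow>
        (\<exists>C>0. \<forall>D\<in>conf_hp_partitions K0 \<kappa>. \<forall>\<rho>. (0 < \<rho> \<and> \<rho> \<le> \<rho>0) \<or> \<rho> = 1 \<longrightarrow>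
           (\<exists>M::nat. equiv_upto C (real M) (ln (1 / \<rho>) * real (pmax D) powr (2 + 2 * \<epsilon>)) \<and>
              (\<forall>f\<in>F_space D. \<forall>Ds. reduce_run \<Omega> K0 \<kappa> \<theta> uD D f M Ds \<longrightarrow>
                 err \<Omega> u uD (Ds M) f \<le> \<rho> * err \<Omega> u uD D f))))"
proof -
  interpret reduce_setting \<Omega> K0 \<kappa> \<theta> \<gamma> \<epsilon> R r u uD
    by (rule reduce_setting.intro) (fact assms)+
  have equiv: "equiv_upto 2 (reduce_quantity \<Omega> u uD r \<gamma> D f (Ds i)) ((err \<Omega> u uD (Ds i) f)\<^sup>2)"
    if "D \<in> conf_hp_partitions K0 \<kappa>" "f \<in> F_space D" "reduce_run \<Omega> K0 \<kappa> \<theta> uD D f N Ds" "i \<le> N" for D f N Ds i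
  proof -
    note b = reduce_quantity_bounds[OF that(3,1,2,4)]
    have "0 \<le> (err \<Omega> u uD (Ds i) f)\<^sup>2" by simp
    then show ?thesis using b unfolding equiv_upto_def by linarith
  qed
  show ?thesis
    by (intro conjI exI[of _ 2]) (use reduce_step equiv iteration_bounds in simp_all)
qed

end
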